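(* Let $\tau\in\mathbb{R}$ and let $\gamma:[0,\infty)\to\mathbb{R}^{\ge 0}$ be a monotone increasing function with $\gamma(t)=O(t^2)$ as $t\to 0$. \begin{enumerate} \item An analytic function $f:\Pi\to\overline{\Pi}$ is $\gamma$-regular at $\tau$ if and only if there exists a $\gamma$-augury $\lambda$ such that $AJ^{\tau}_{f,\lambda}(d)$ is bounded as $d\to 0$. \item Suppose in addition that $\sqrt{\gamma(t)}$ is a $\gamma$-augury. Let $f:\Pi\to\overline{\Pi}$ be an analytic function. The following are equivalent: (a) $f$ is $\gamma$-regular at $\tau$; (b) for some $C,D>0$, $J_f(z)$ is bounded on $S^{\sqrt{D\gamma(Ct)}}_{\tau}$ as $z\to\tau$; (c) for some $C,D>0$, $\displaystyle\limsup_{t\to 0} J_f\big(\tau+t+iD\gamma(C|t|)\big)<\infty$ (with $t$ real, $t\neq 0$). \item Suppose (in addition to the hypotheses on $\gamma$ in the first sentence) that $\gamma(t)/t$ is a $\gamma$-augury. An analytic function $f:\Pi\to\overline{\Pi}$ is $\gamma$-regular at $\tau$ if and only if for some $C>0$ the quantity $AJ^{\tau}_{f,\gamma(Ct)/(Ct)}(d)$ is bounded as $d\to 0$. \end{enumerate}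
   Context: $\Pi=\{z\in\mathbb{C}:\operatorname{Im} z>0\}$ and $\overline{\Pi}$ is the closed upper half plane. For analytic $f:\Pi\to\overline{\Pi}$ the Julia quotient is $J_f(z)=\frac{\operatorname{Im} f(z)}{\operatorname{Im} z}$, $z\in\Pi$. The Nevanlinna measure $\mu_f$ of $f$ is the positive Borel measure on $\mathbb{R}$ that is the weak limit, as $y\to 0^+$, of the measures $\operatorname{Im} f(x+iy)\,dx$. $\gamma$-regularity: let $\gamma:[0,\infty)\to\mathbb{R}^{\ge0}$ be monotone increasing with $\gamma(t)=O(t^2)$ as $t\to0$ (with $\gamma(t)>0$ for $t>0$, and the convention $1/0=+\infty$). An analytic $f:\Pi\to\overline\Pi$ is $\gamma$-regular at $\tau$ if there is $C>0$ such that $t\mapsto \frac{1}{\gamma(C|t-\tau|)}$ is integrable on a neighborhood of $\tau$ with respect to $\mu_f$. $\gamma$-augury: a function $\lambda:[0,\infty)\to\mathbb{R}^{\ge0}$ with $\lambda(t)=o(t)$ as $t\to0$ is a $\gamma$-augury if there is $C>0$ such that $\frac{t\,\lambda(Ct)\,\mathrm{d}\gamma(t)}{\gamma(t)^2}$ is integrable on $[0,1)$, where $\mathrm{d}\gamma$ is the distributional derivative of $\gamma$ (a positive measure). For a function $\lambda:[0,\infty)\to\mathbb{R}^{\ge0}$, the $\lambda$-Stolz region at $\tau$ is $S^{\lambda}_{\tau}=\{z\in\Pi:\ \text{for some } c>0,\ \operatorname{dist}(z,\partial\Pi)\ge\lambda(c)\text{ and }\sqrt{\operatorname{dist}(z,\tau)^2-\operatorname{dist}(z,\partial\Pi)^2}\le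 c\}$, i.e. $\operatorname{Im} z\ge\lambda(c)$ and $|\operatorname{Re} z-\tau|\le c$. $S_\tau^{\sqrt{D\gamma(Ct)}}$ means $S_\tau^\lambda$ with $\lambda(t)=\sqrt{D\gamma(Ct)}$. "$J_f$ is bounded on $S$ as $z\to\tau$" means $J_f$ is bounded on the intersection of $S$ with some neighborhood of $\tau$. For $d>0$ put $C_d=\{z:\operatorname{dist}(z,\partial\Pi)=\lambda(d),\ \sqrt{\operatorname{dist}(z,\tau)^2-\operatorname{dist}(z,\partial\Pi)^2}\le d\}=\{x+i\lambda(d):|x-\tau|\le d\}$. The amortized Julia quotient is $AJ^{\tau}_{f,\lambda}(d)=\frac{1}{|C_d|}\int_{C_d}J_f(z)\,|dz|$, where $|C_d|$ is arclength; explicitly $AJ^\tau_{f,\lambda}(d)=\frac{1}{2d}\int_{\tau-d}^{\tau+d}J_f(x+i\lambda(d))\,dx$. $AJ^\tau_{f,\gamma(Ct)/(Ct)}$ is this quantity with $\lambda(t)=\gamma(Ct)/(Ct)$.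
   Formalization: In the definition of a γ-augury, γ(t)² at a jump of γ is read as the product of one-sided limits γ(t−)γ(t+), so that dγ/γ² = d(−1/γ); with the pointwise value, part 1 fails for some step functions γ. For continuous γ nothing changes. *)

theory Defs
  imports "HOL-Analysis.Analysis" "HOL-Library.Landau_Symbols"
begin

definition upper_half_plane :: "complex set" where
  "upper_half_plane = {z. Im z > 0}"

text \<open>Analytic maps from the open to the closed upper half plane.\<close>

definition pick_function :: "(complex \<Rightarrow> complex) \<Rightarrow> bool" where
  "pick_function f \<longleftrightarrow> f analytic_on upper_half_plane \<and> (\<forall>z\<in>upper_half_plane. Im (f z) \<ge> 0)"

definition julia_quotient :: "(complex \<Rightarrow> complex) \<Rightarrow> complex \<Rightarrow> real" where
  "julia_quotient f z = Im (f z) / Im z"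

text \<open>The measures on the line that occur here are in general infinite, but finite on compact
  sets; their weak convergence is tested against compactly supported continuous functions.\<close>

definition weak_limit :: "('b \<Rightarrow> real measure) \<Rightarrow> real measure \<Rightarrow> 'b filter \<Rightarrow> bool" where
  "weak_limit M \<mu> F \<longleftrightarrow>
     (\<forall>\<phi>::real \<Rightarrow> real. continuous_on UNIV \<phi> \<and> compact (closure {x. \<phi> x \<noteq> 0}) \<longrightarrow>
        ((\<lambda>y. \<integral>x. \<phi> x \<partial>M y) \<longlongrightarrow> (\<integral>x. \<phi> x \<partial>\<mu>)) F)"

definition nevanlinna_measure :: "(complex \<Rightarrow> complex) \<Rightarrow> real measure" where
  "nevanlinna_measure f =
     (THE \<mu>. sets \<mu> = sets borel \<and> (\<forall>K. compact K \<longrightarrow> emeasure \<mu> K < \<infinity>) \<and>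
        weak_limit (\<lambda>y. density lborel (\<lambda>x. ennreal (Im (f (Complex x y))))) \<mu> (at_right 0))"

text \<open>Division takes place in \<^typ>\<open>ennreal\<close>, where \<open>1 / 0 = \<infinity>\<close>. The integrand is
  nonnegative, and Borel whenever \<open>\<gamma>\<close> is monotone on \<open>[0, \<infinity>)\<close>, so integrability
  is finiteness of the integral.\<close>

definition gamma_regular :: "(real \<Rightarrow> real) \<Rightarrow> (complex \<Rightarrow> complex) \<Rightarrow> real \<Rightarrow> bool" where
  "gamma_regular \<gamma> f \<tau> \<longleftrightarrow>
     (\<exists>C>0. \<exists>U. open U \<and> \<tau> \<in> U \<and>
        (\<integral>\<^sup>+t\<in>U. (1 / ennreal (\<gamma> (C * \<bar>t - \<tau>\<bar>))) \<partial>(nevanlinna_measure f)) < \<infinity>)"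

text \<open>Functions on \<open>[0, \<infinity>)\<close> are represented by functions on the reals whose values at
  negative arguments are irrelevant. Where one-sided limits are taken, \<open>\<gamma>\<close> is extended
  to the left by the constant \<open>\<gamma> 0\<close>.\<close>

definition left_value :: "(real \<Rightarrow> real) \<Rightarrow> real \<Rightarrow> real" where
  "left_value \<gamma> t = Lim (at_left t) (\<lambda>s. \<gamma> (max 0 s))"

definition right_value :: "(real \<Rightarrow> real) \<Rightarrow> real \<Rightarrow> real" where
  "right_value \<gamma> t = Lim (at_right t) (\<lambda>s. \<gamma> (max 0 s))"

text \<open>The distributional derivative of a monotone \<open>\<gamma>\<close> is the Lebesgue--Stieltjes measure
  of its right-continuous version.\<close>

definition distributional_derivative :: "(real \<Rightarrow> real) \<Rightarrow> real measure" where
  "distributional_derivative \<gamma> = interval_measure (right_value \<gamma>)"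

text \<open>The measure \<open>d\<gamma>\<close> does not see the value of \<open>\<gamma>\<close> at a jump but charges that
  point, so \<open>d\<gamma> / \<gamma>\<^sup>2\<close> needs a convention there. The square is read as the product
  of the two one-sided limits, which is the unique choice for which
  \<open>d\<gamma> / \<gamma>\<^sup>2 = d(- 1 / \<gamma>)\<close> for every monotone positive \<open>\<gamma>\<close>. At a point of
  continuity it is \<open>\<gamma>(t)\<^sup>2\<close>.\<close>

definition stieltjes_square :: "(real \<Rightarrow> real) \<Rightarrow> real \<Rightarrow> real" where
  "stieltjes_square \<gamma> t = left_value \<gamma> t * right_value \<gamma> t"

lemma stieltjes_square_continuous:
  assumes "isCont \<gamma> t" "t > 0"
  shows "stieltjes_square \<gamma> t = (\<gamma> t)\<^sup>2"
proof -
  have "isCont \<gamma> (max 0 t)"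
    using assms by (simp add: max_def)
  then have "((\<lambda>s. \<gamma> (max 0 s)) \<longlongrightarrow> \<gamma> (max 0 t)) (at t)"
    by (intro isCont_tendsto_compose[of _ \<gamma>]) (auto intro!: tendsto_intros)
  then have "((\<lambda>s. \<gamma> (max 0 s)) \<longlongrightarrow> \<gamma> t) (at t)"
    using assms(2) by (simp add: max_def)
  then have "left_value \<gamma> t = \<gamma> t" "right_value \<gamma> t = \<gamma> t"
    unfolding left_value_def right_value_def filterlim_at_split
    by (auto intro!: tendsto_Lim)
  then show ?thesis
    by (simp add: stieltjes_square_def power2_eq_square)
qed

definition gamma_augury :: "(real \<Rightarrow> real) \<Rightarrow> (real \<Rightarrow> real) \<Rightarrow> bool" where
  "gamma_augury \<gamma> l \<longleftrightarrow>
     (\<forall>t\<ge>0. l t \<ge> 0) \<and> l \<in> o[at_right 0](\<lambda>t. t) \<and>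
     (\<exists>C>0. set_integrable (distributional_derivative \<gamma>) {0..<1}
               (\<lambda>t. t * l (C * t) / stieltjes_square \<gamma> t))"

text \<open>For \<open>z\<close> in the upper half plane the distance to the boundary is \<open>Im z\<close>, and
  the root of \<open>dist(z, \<tau>)\<^sup>2 - (Im z)\<^sup>2\<close> is \<open>\<bar>Re z - \<tau>\<bar>\<close>.\<close>

definition stolz_region :: "(real \<Rightarrow> real) \<Rightarrow> real \<Rightarrow> complex set" where
  "stolz_region l \<tau> = {z \<in> upper_half_plane. \<exists>c>0. Im z \<ge> l c \<and> \<bar>Re z - \<tau>\<bar> \<le> c}"

definition julia_bounded_on ::
  "(complex \<Rightarrow> complex) \<Rightarrow> complex set \<Rightarrow> real \<Rightarrow> bool" where
  "julia_bounded_on f S \<tau> \<longleftrightarrow>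
     (\<exists>U. open U \<and> complex_of_real \<tau> \<in> U \<and> bounded (julia_quotient f ` (S \<inter> U)))"

definition amortized_julia ::
  "(complex \<Rightarrow> complex) \<Rightarrow> (real \<Rightarrow> real) \<Rightarrow> real \<Rightarrow> real \<Rightarrow> real" where
  "amortized_julia f l \<tau> d =
     1 / (2 * d) * integral {\<tau> - d..\<tau> + d} (\<lambda>x. julia_quotient f (Complex x (l d)))"

text \<open>The Julia quotient lives on the open half plane, so the amortized quotient at \<open>d\<close> is
  defined only if \<open>l d > 0\<close>. Boundedness as \<open>d\<close> tends to \<open>0\<close> includes that it is
  defined for all small \<open>d > 0\<close>; otherwise \<open>l = 0\<close> would always qualify, through the
  junk values of \<open>f\<close> on the real line.\<close>

definition amortized_julia_bounded ::
  "(complex \<Rightarrow> complex) \<Rightarrow> (real \<Rightarrow> real) \<Rightarrow> real \<Rightarrow> bool" where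
  "amortized_julia_bounded f l \<tau> \<longleftrightarrow>
     (\<exists>B. \<forall>\<^sub>F d in at_right 0. l d > 0 \<and> \<bar>amortized_julia f l \<tau> d\<bar> \<le> B)"

end

theory Submission
  imports Defs "HOL-Complex_Analysis.Cauchy_Integral_Formula" "HOL-Probability.Probability"
begin

text \<open>The imaginary part of a Pick function \<open>f\<close> is a nonnegative harmonic function, so it has a
  Nevanlinna representation: for some \<open>b \<ge> 0\<close> and some measure \<open>\<mu>\<close> on the line,

    \<open>J\<^sub>f(x + i y) = b + (1 / \<pi>) \<integral> d\<mu>(t) / ((t - x)\<^sup>2 + y\<^sup>2)\<close>.

  It is obtained from the disc: the Cayley transform turns \<open>Im f\<close> into a nonnegative harmonic
  function, the Poisson formula on circles of radius \<open>r < 1\<close> and Helly's selection theorem for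
  \<open>r \<rightarrow> 1\<close> represent that function by a measure on angles. This measure, weighted by a multiple
  of \<open>1 + t\<^sup>2\<close>, is pushed forward by \<open>\<theta> \<mapsto> t = - cot(\<theta> / 2)\<close>, and its mass at the point at
  infinity becomes \<open>b\<close> (\<open>nevanlinna_representation\<close>). As \<open>y \<rightarrow> 0\<close>, Fubini's theorem and the approximate identity
  property of the Poisson kernel show that \<open>Im f(x + i y) dx\<close> converges to \<open>\<mu>\<close>; as limits are
  unique, \<open>\<mu>\<close> is the Nevanlinna measure (\<open>nevanlinna_measure_eq\<close>).

  The theorem then becomes a statement on the mass \<open>m(d)\<close> that \<open>\<mu>\<close> gives to the interval
  \<open>(\<tau> - d, \<tau> + d)\<close>. On the one hand, \<open>d\<gamma> / \<gamma>\<^sup>2 = d(- 1 / \<gamma>)\<close>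
  (\<open>integral_inverse_stieltjes_square\<close>) and Tonelli's theorem (\<open>tonelli_ball\<close>) make
  \<open>\<gamma>\<close>-regularity equivalent to \<open>\<mu>{\<tau>} = 0\<close> together with the integrability near \<open>0\<close> of
  \<open>m(C t) d\<gamma>(t) / \<gamma>(t)\<^sup>2\<close> for some \<open>C\<close>. On the other hand, averaging the Poisson kernel gives

    \<open>m(d) \<le> 4 \<pi> AJ(d) d \<lambda>(d)\<close>  and  \<open>AJ(d) \<le> b + m(2 d) / (2 d \<lambda>(d)) + 4 q\<close>

  (\<open>ball_mass_le_amortized_julia\<close>, \<open>amortized_julia_le_ball_mass\<close>), the first one if
  \<open>\<lambda>(d) \<le> d\<close>, the second one if \<open>\<mu>{\<tau>} = 0\<close>. Here
  \<open>q \<ge> \<integral> d\<mu>(t) / (t - \<tau>)\<^sup>2\<close>, an integral that is finite in the regular case because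
  \<open>\<gamma>(t) = O(t\<^sup>2)\<close>. So an augury with bounded amortized quotient yields regularity, and conversely
  \<open>\<lambda>(d) = m(2 d) / d\<close>, plus a small term that makes it positive, is a suitable augury.

  The statements on \<open>\<gamma>(t) / t\<close> and on the Stolz region follow from these bounds and the pointwise
  analogue of the second one (\<open>julia_le\<close>), since regularity gives \<open>m(d) = O(\<gamma>(C d))\<close>.
  The curve has height \<open>\<gamma>(C |t|)\<close> and not its square root. This is harmless: if \<open>sqrt \<gamma>\<close>
  is an augury, then \<open>\<gamma>(c s) = O(\<gamma>(s)\<^sup>2)\<close> for some \<open>c > 0\<close> (\<open>sqrt_augury_square_decay\<close>), so the square is absorbed by the constant \<open>C\<close>.\<close>

section \<open>Herglotz representation on the disc\<close>

lemma poisson_integral_disc: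
  assumes hol: "G holomorphic_on ball 0 \<rho>" and "\<rho> > 1" and w: "cmod w < 1"
  shows "((\<lambda>\<theta>. (1 - (cmod w)\<^sup>2) / (cmod (cis \<theta> - w))\<^sup>2 * Im (G (cis \<theta>))) has_integral 2 * pi * Im (G w)) {0..2*pi}"
proof -
  \<comment> \<open>Cauchy's formula for \<open>G\<close> at \<open>w\<close> is added to the one at \<open>0\<close> for a function that is
    holomorphic on the disc and vanishes at \<open>0\<close>; on the circle the two kernels add up to the
    Poisson kernel.\<close>
  let ?k = "\<lambda>u. G u * cnj w * u / (1 - cnj w * u)"
  have nz: "1 - cnj w * u \<noteq> 0" if "u \<in> cball 0 1" for u
  proof
    assume "1 - cnj w * u = 0"
    then have "cmod w * cmod u = 1"
      by (metis complex_mod_cnj eq_iff_diff_eq_0 norm_mult norm_one)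
    moreover have "cmod w * cmod u \<le> cmod w * 1"
      using that by (intro mult_left_mono) auto
    ultimately show False
      using w by auto
  qed
  have holc: "G holomorphic_on cball 0 1"
    using hol by (rule holomorphic_on_subset) (use \<open>\<rho> > 1\<close> in auto)
  have kc: "?k holomorphic_on cball 0 1"
    using holc nz by (intro holomorphic_intros) auto
  have 1: "((\<lambda>u. G u / (u - w)) has_contour_integral 2 * of_real pi * \<i> * G w) (circlepath 0 1)"
    using holc w by (intro Cauchy_integral_circlepath)
      (auto intro: holomorphic_on_imp_continuous_on holomorphic_on_subset)
  have 2: "((\<lambda>u. ?k u / (u - 0)) has_contour_integral 2 * of_real pi * \<i> * ?k 0) (circlepath 0 1)"
    using kc by (intro Cauchy_integral_circlepath)
      (auto intro: holomorphic_on_imp_continuous_on holomorphic_on_subset)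
  have "((\<lambda>u. G u / (u - w) + ?k u / (u - 0)) has_contour_integral 2 * of_real pi * \<i> * G w) (circlepath 0 1)"
    using has_contour_integral_add[OF 1 2] by simp
  then have 3: "((\<lambda>t. (G (cis t) / (cis t - w) + ?k (cis t) / cis t) * (\<i> * cis t)) has_integral 2 * of_real pi * \<i> * G w) {0..2*pi}"
    unfolding circlepath_def by (subst (asm) has_contour_integral_part_circlepath_iff) (simp_all add: mult.assoc)
  have eq: "(G (cis t) / (cis t - w) + ?k (cis t) / cis t) * (\<i> * cis t)
     = \<i> * (of_real ((1 - (cmod w)\<^sup>2) / (cmod (cis t - w))\<^sup>2) * G (cis t))" for t
  proof -
    have u: "cis t \<noteq> w" "cis t \<noteq> 0" using w by auto
    have n: "1 - cnj w * cis t \<noteq> 0" by (rule nz) auto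
    have a: "cis t * cnj (cis t) = 1" by (simp add: cis_cnj cis_mult)
    have b: "1 - cnj w * cis t = cis t * cnj (cis t - w)"
      using a by (simp add: algebra_simps)
    have c: "complex_of_real ((cmod (cis t - w))\<^sup>2) = (cis t - w) * cnj (cis t - w)"
      "complex_of_real (1 - (cmod w)\<^sup>2) = cis t * cnj (cis t) - w * cnj w"
      unfolding of_real_diff complex_norm_square a by simp_all
    have d: "cnj (cis t - w) \<noteq> 0" using u by simp
    have gen1: "(g / a + g * w' * u / (u * d) / u) * (\<i> * u) = \<i> * (g * (u / a + w' / d))"
      if "u \<noteq> 0" "a \<noteq> 0" "d \<noteq> 0" for g a w' u d :: complex
      using that by (simp add: field_simps)
    have gen2: "u / (u - w) + w' / (v - w') = (u * v - w * w') / ((u - w) * (v - w'))"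
      if "u - w \<noteq> 0" "v - w' \<noteq> 0" for u v w' :: complex
      using that by (simp add: field_simps)
    have "(G (cis t) / (cis t - w) + ?k (cis t) / cis t) * (\<i> * cis t)
      = \<i> * (G (cis t) * (cis t / (cis t - w) + cnj w / cnj (cis t - w)))"
      unfolding b using u d by (intro gen1) auto
    also have "cis t / (cis t - w) + cnj w / cnj (cis t - w) = (cis t * cnj (cis t) - w * cnj w) / ((cis t - w) * cnj (cis t - w))"
      using u d unfolding complex_cnj_diff by (intro gen2) auto
    finally show ?thesis
      unfolding of_real_divide c by (simp add: mult_ac)
  qed
  have "((\<lambda>t. - \<i> * (\<i> * (of_real ((1 - (cmod w)\<^sup>2) / (cmod (cis t - w))\<^sup>2) * G (cis t)))) has_integral - \<i> * (2 * of_real pi * \<i> * G w)) {0..2*pi}"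
    using has_integral_mult_right[OF 3, of "- \<i>"] unfolding eq .
  then have "((\<lambda>t. of_real ((1 - (cmod w)\<^sup>2) / (cmod (cis t - w))\<^sup>2) * G (cis t)) has_integral of_real (2 * pi) * G w) {0..2*pi}"
    by (simp add: algebra_simps)
  from has_integral_linear[OF this bounded_linear_Im] show ?thesis
    by (simp add: o_def Im_complex_of_real mult.assoc)
qed

text \<open>The Poisson kernel of the unit disc at the interior point \<open>w\<close> and the boundary point \<open>cis \<theta>\<close>.
  It is kept as a function of the angle \<open>\<theta>\<close>, hence \<open>2 \<pi>\<close>-periodic on the whole line.\<close>
definition disc_kernel :: "complex \<Rightarrow> real \<Rightarrow> real" where
  "disc_kernel w \<theta> = (1 - (cmod w)\<^sup>2) / (cmod (cis \<theta> - w))\<^sup>2"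

lemma disc_kernel_nonneg: "cmod w < 1 \<Longrightarrow> disc_kernel w \<theta> \<ge> 0"
  unfolding disc_kernel_def by (intro divide_nonneg_nonneg) (auto simp: power_le_one)

lemma disc_kernel_le:
  assumes "cmod w < 1"
  shows "disc_kernel w \<theta> \<le> (1 - (cmod w)\<^sup>2) / (1 - cmod w)\<^sup>2"
proof -
  have "1 - cmod w \<le> cmod (cis \<theta> - w)"
    using norm_triangle_ineq2[of "cis \<theta>" w] by simp
  then show ?thesis
    unfolding disc_kernel_def using assms
    by (intro divide_left_mono power_mono mult_pos_pos) (auto simp: power_le_one)
qed

lemma isCont_disc_kernel: "cmod w < 1 \<Longrightarrow> isCont (disc_kernel w) \<theta>"
  unfolding disc_kernel_def cis_conv_exp by (intro continuous_intros) (auto simp: cis_conv_exp[symmetric])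

lemma disc_kernel_0: "disc_kernel 0 \<theta> = 1"
  by (simp add: disc_kernel_def)

lemma poisson_integral_subdisc:
  assumes hol: "G holomorphic_on ball 0 1" and r: "0 < r" "r < 1" and w: "cmod w < 1"
  shows "((\<lambda>\<theta>. disc_kernel w \<theta> * Im (G (of_real r * cis \<theta>))) has_integral 2 * pi * Im (G (of_real r * w))) {0..2*pi}"
proof -
  have "(\<lambda>u. G (of_real r * u)) holomorphic_on ball 0 (1 / r)"
  proof (rule holomorphic_on_compose_gen[unfolded o_def, OF _ hol])
    show "(\<lambda>u. complex_of_real r * u) ` ball 0 (1 / r) \<subseteq> ball 0 1"
      using r by (auto simp: norm_mult dist_norm field_simps)
  qed (intro holomorphic_intros)
  from poisson_integral_disc[OF this _ w] r show ?thesis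
    by (simp add: disc_kernel_def)
qed

text \<open>The Herglotz representation, with the measure normalised to a probability measure \<open>M\<close> on
  angles. Where \<open>M\<close> lives is immaterial, since the kernel is periodic. The case \<open>c = 0\<close> covers
  functions with vanishing imaginary part.\<close>
lemma herglotz_disc:
  assumes hol: "G holomorphic_on ball 0 1" and nn: "\<And>w. cmod w < 1 \<Longrightarrow> Im (G w) \<ge> 0"
  shows "\<exists>c M. c \<ge> 0 \<and> real_distribution M \<and>
           (\<forall>w. cmod w < 1 \<longrightarrow> Im (G w) = c * (\<integral>\<theta>. disc_kernel w \<theta> \<partial>M))"
proof (cases "Im (G 0) = 0")
  case True
  have "Im (G w) = 0" if "cmod w < 1" for w
  proof -
    define r where "r = (1 + cmod w) / 2"
    define v where "v = w / of_real r"
    have r: "0 < r" "r < 1" "cmod w < r"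
      unfolding r_def using that norm_ge_zero[of w] by (simp_all add: field_simps del: norm_ge_zero)
    then have v: "cmod v < 1" and w: "w = of_real r * v"
      by (auto simp: v_def norm_divide)
    \<comment> \<open>Harnack's inequality, from the bound on the kernel\<close>
    define K where "K = (1 - (cmod v)\<^sup>2) / (1 - cmod v)\<^sup>2"
    have ge0: "0 \<le> Im (G (of_real r * cis t))" for t
      using r by (intro nn) (simp add: norm_mult)
    have "2 * pi * Im (G (of_real r * v)) \<le> K * (2 * pi * Im (G (of_real r * 0)))"
    proof (rule has_integral_le)
      show "((\<lambda>\<theta>. disc_kernel v \<theta> * Im (G (of_real r * cis \<theta>))) has_integral 2 * pi * Im (G (of_real r * v))) {0..2*pi}"
        by (rule poisson_integral_subdisc[OF hol r(1,2) v])
      show "((\<lambda>\<theta>. K * (disc_kernel 0 \<theta> * Im (G (of_real r * cis \<theta>)))) has_integral K * (2 * pi * Im (G (of_real r * 0)))) {0..2*pi}"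
        by (intro has_integral_mult_right poisson_integral_subdisc[OF hol r(1,2)]) simp
      show "disc_kernel v t * Im (G (of_real r * cis t)) \<le> K * (disc_kernel 0 t * Im (G (of_real r * cis t)))" for t
        using mult_right_mono[OF disc_kernel_le[OF v] ge0] unfolding K_def disc_kernel_0 mult_1 .
    qed
    with True have "Im (G w) \<le> 0"
      using pi_gt_zero by (simp add: w mult_le_0_iff)
    with nn[OF that] show ?thesis by simp
  qed
  moreover have "real_distribution (return borel (0::real))"
    by (intro real_distribution.intro prob_space_return real_distribution_axioms.intro) auto
  ultimately show ?thesis
    by (intro exI[of _ 0] exI[of _ "return borel (0::real)"]) auto
next
  case False
  define c where "c = Im (G 0)"
  have c: "c > 0"
    using False nn[of 0] by (simp add: c_def)
  define r :: "nat \<Rightarrow> real" where "r n = 1 - 1 / real (n + 2)" for n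
  have r: "0 < r n" "r n < 1" for n
    by (auto simp: r_def)
  have r_lim: "r \<longlonglongrightarrow> 1"
  proof -
    have "(\<lambda>n. 1 - 1 / real (n + 2)) \<longlonglongrightarrow> 1 - 0"
      by (intro tendsto_diff tendsto_const LIMSEQ_ignore_initial_segment lim_1_over_n)
    then show ?thesis by (simp add: r_def[abs_def])
  qed
  define h where "h n \<theta> = Im (G (of_real (r n) * cis \<theta>)) / (2 * pi * c)" for n \<theta>
  have in_ball: "of_real (r n) * cis \<theta> \<in> ball 0 1" for n \<theta>
    using r[of n] by (simp add: norm_mult)
  have h_cont: "continuous_on UNIV (h n)" for n
    unfolding h_def using c in_ball
    by (intro continuous_intros continuous_on_compose2[OF holomorphic_on_imp_continuous_on[OF hol]]) auto
  have h_nn: "h n \<theta> \<ge> 0" for n \<theta>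
    unfolding h_def using c in_ball[of n \<theta>] by (intro divide_nonneg_nonneg nn) auto
  define \<mu> where "\<mu> n = density lborel (\<lambda>\<theta>. ennreal (indicator {0..2*pi} \<theta> * h n \<theta>))" for n
  have h_meas [measurable]: "h n \<in> borel_measurable borel" for n
    using h_cont by (intro borel_measurable_continuous_onI)
  have k_cont: "continuous_on UNIV (disc_kernel w)" if "cmod w < 1" for w
    using isCont_disc_kernel[OF that] by (simp add: continuous_at_imp_continuous_on)
  have int: "set_integrable lborel {0..2*pi} (\<lambda>\<theta>. h n \<theta> * disc_kernel w \<theta>)" if "cmod w < 1" for n w
    by (intro borel_integrable_atLeastAtMost' continuous_intros continuous_on_subset[OF h_cont]
         continuous_on_subset[OF k_cont[OF that]]) auto
  have val: "(LINT \<theta>:{0..2*pi}|lborel. h n \<theta> * disc_kernel w \<theta>) = Im (G (of_real (r n) * w)) / c"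
    if "cmod w < 1" for n w
  proof -
    have "((\<lambda>\<theta>. 1 / (2 * pi * c) * (disc_kernel w \<theta> * Im (G (of_real (r n) * cis \<theta>)))) has_integral
        1 / (2 * pi * c) * (2 * pi * Im (G (of_real (r n) * w)))) {0..2*pi}"
      by (intro has_integral_mult_right poisson_integral_subdisc[OF hol r that])
    then have "((\<lambda>\<theta>. h n \<theta> * disc_kernel w \<theta>) has_integral Im (G (of_real (r n) * w)) / c) {0..2*pi}"
      using c by (simp add: h_def field_simps)
    then show ?thesis
      using set_borel_integral_eq_integral(2)[OF int[OF that]] by (simp add: integral_unique)
  qed
  have \<mu>_int: "(\<integral>\<theta>. disc_kernel w \<theta> \<partial>\<mu> n) = Im (G (of_real (r n) * w)) / c" if "cmod w < 1" for n w
  proof -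
    have [measurable]: "disc_kernel w \<in> borel_measurable borel"
      using k_cont[OF that] by (intro borel_measurable_continuous_onI)
    have "(\<integral>\<theta>. disc_kernel w \<theta> \<partial>\<mu> n) = (\<integral>\<theta>. (indicator {0..2*pi} \<theta> * h n \<theta>) *\<^sub>R disc_kernel w \<theta> \<partial>lborel)"
      unfolding \<mu>_def by (intro integral_density) (auto simp: h_nn)
    also have "\<dots> = Im (G (of_real (r n) * w)) / c"
      using val[OF that, of n] by (simp add: set_lebesgue_integral_def mult.assoc)
    finally show ?thesis .
  qed
  have nn1: "(\<integral>\<^sup>+\<theta>. ennreal (indicator {0..2*pi} \<theta> * h n \<theta>) \<partial>lborel) = 1" for n
  proof -
    have "(\<integral>\<^sup>+\<theta>. ennreal (indicator {0..2*pi} \<theta> * h n \<theta>) \<partial>lborel) = ennreal (\<integral>\<theta>. indicator {0..2*pi} \<theta> * h n \<theta> \<partial>lborel)"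
      using int[of 0 n] by (intro nn_integral_eq_integral) (auto simp: h_nn set_integrable_def disc_kernel_0)
    also have "\<dots> = 1"
      using val[of 0 n] c by (simp add: set_lebesgue_integral_def disc_kernel_0 c_def)
    finally show ?thesis .
  qed
  have dist: "real_distribution (\<mu> n)" for n
  proof (intro real_distribution.intro real_distribution_axioms.intro prob_spaceI)
    show "emeasure (\<mu> n) (space (\<mu> n)) = 1"
      using nn1[of n] by (simp add: \<mu>_def emeasure_density)
  qed (auto simp: \<mu>_def)
  have supp: "measure (\<mu> n) {-1<..8} = 1" for n
  proof -
    have "2 * pi \<le> 8" using pi_less_4 by simp
    then have "emeasure (\<mu> n) {-1<..8} = (\<integral>\<^sup>+\<theta>. ennreal (indicator {0..2*pi} \<theta> * h n \<theta>) \<partial>lborel)"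
      unfolding \<mu>_def
      by (subst emeasure_density) (auto intro!: nn_integral_cong split: split_indicator)
    then show ?thesis by (simp add: nn1 measure_def)
  qed
  have "tight \<mu>"
    unfolding tight_def using dist supp by (intro conjI allI impI exI[of _ "-1"] exI[of _ "8"]) auto
  from tight_imp_convergent_subsubsequence[OF this strict_mono_id]
  obtain s M where s: "strict_mono (s :: nat \<Rightarrow> nat)" and M: "real_distribution M"
    and conv: "weak_conv_m (\<mu> \<circ> id \<circ> s) M"
    by auto
  have "Im (G w) = c * (\<integral>\<theta>. disc_kernel w \<theta> \<partial>M)" if w: "cmod w < 1" for w
  proof -
    have "(\<lambda>n. \<integral>\<theta>. disc_kernel w \<theta> \<partial>(\<mu> \<circ> id \<circ> s) n) \<longlonglongrightarrow> (\<integral>\<theta>. disc_kernel w \<theta> \<partial>M)"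
      using dist M conv disc_kernel_le[OF w] disc_kernel_nonneg[OF w]
      by (intro weak_conv_imp_integral_bdd_continuous_conv[where B = "(1 - (cmod w)\<^sup>2) / (1 - cmod w)\<^sup>2"] isCont_disc_kernel[OF w]) (auto simp: o_def)
    then have 1: "(\<lambda>n. Im (G (of_real (r (s n)) * w)) / c) \<longlonglongrightarrow> (\<integral>\<theta>. disc_kernel w \<theta> \<partial>M)"
      by (simp add: \<mu>_int[OF w])
    have "isCont G w"
      using hol w by (meson continuous_on_eq_continuous_at holomorphic_on_imp_continuous_on mem_ball_0 open_ball)
    moreover have "(\<lambda>n. of_real (r (s n)) * w) \<longlonglongrightarrow> of_real 1 * w"
      using LIMSEQ_subseq_LIMSEQ[OF r_lim s] unfolding o_def by (intro tendsto_intros)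
    ultimately have "(\<lambda>n. Im (G (of_real (r (s n)) * w)) / c) \<longlonglongrightarrow> Im (G w) / c"
      using c by (intro tendsto_intros isCont_tendsto_compose[of w G]) auto
    from LIMSEQ_unique[OF 1 this] show ?thesis using c by simp
  qed
  with c M show ?thesis by (intro exI[of _ c] exI[of _ M]) auto
qed

section \<open>Nevanlinna representation on the half plane\<close>

text \<open>In terms of the half angle the Poisson kernel of the disc becomes that of the half plane, without
  a case distinction at \<open>\<theta> = 0\<close>, the angle of the point at infinity.\<close>
lemma disc_kernel_cayley:
  fixes x y :: real
  assumes "y > 0"
  defines "w \<equiv> (Complex x y - \<i>) / (Complex x y + \<i>)"
  shows "cmod w < 1"
    "disc_kernel w \<theta> = y / ((sin (\<theta>/2) * x + cos (\<theta>/2))\<^sup>2 + (sin (\<theta>/2) * y)\<^sup>2)"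
proof -
  let ?z = "Complex x y" and ?s = "sin (\<theta>/2)" and ?k = "cos (\<theta>/2)"
  have nz: "?z + \<i> \<noteq> 0" using assms by (auto simp: complex_eq_iff)
  have n1: "(cmod (?z + \<i>))\<^sup>2 = x\<^sup>2 + (y + 1)\<^sup>2" and n2: "(cmod (?z - \<i>))\<^sup>2 = x\<^sup>2 + (y - 1)\<^sup>2"
    by (simp_all add: cmod_power2)
  have pos: "0 < x\<^sup>2 + (y + 1)\<^sup>2"
    using assms by (intro add_nonneg_pos) auto
  have w2: "(cmod w)\<^sup>2 = (x\<^sup>2 + (y - 1)\<^sup>2) / (x\<^sup>2 + (y + 1)\<^sup>2)"
    unfolding w_def norm_divide power_divide n1 n2 ..
  have 1: "1 - (cmod w)\<^sup>2 = 4 * y / (x\<^sup>2 + (y + 1)\<^sup>2)"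
    unfolding w2 using pos by (simp add: field_simps power2_eq_square)
  have "0 < 1 - (cmod w)\<^sup>2"
    unfolding 1 using assms pos by simp
  then show "cmod w < 1" by (simp add: abs_square_less_1)
  have "cis \<theta> = cis (\<theta>/2) * cis (\<theta>/2)" by (simp add: cis_mult)
  moreover have "cis (\<theta>/2) * cis (- (\<theta>/2)) = 1" by (simp add: cis_mult)
  ultimately have "cis \<theta> * (?z + \<i>) - (?z - \<i>) = cis (\<theta>/2) * (cis (\<theta>/2) * (?z + \<i>) - cis (-(\<theta>/2)) * (?z - \<i>))"
    by (simp add: algebra_simps)
  also have "cis (\<theta>/2) * (?z + \<i>) - cis (-(\<theta>/2)) * (?z - \<i>) = 2 * \<i> * Complex (?s * x + ?k) (?s * y)"
    by (simp add: complex_eq_iff algebra_simps)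
  finally have "(cmod (cis \<theta> * (?z + \<i>) - (?z - \<i>)))\<^sup>2 = 4 * ((?s * x + ?k)\<^sup>2 + (?s * y)\<^sup>2)"
    by (simp add: norm_mult power_mult_distrib cmod_power2)
  moreover have "cis \<theta> - w = (cis \<theta> * (?z + \<i>) - (?z - \<i>)) / (?z + \<i>)"
    using nz by (simp add: w_def field_simps)
  ultimately have "(cmod (cis \<theta> - w))\<^sup>2 = 4 * ((?s * x + ?k)\<^sup>2 + (?s * y)\<^sup>2) / (x\<^sup>2 + (y + 1)\<^sup>2)"
    by (simp only: norm_divide power_divide n1)
  moreover have "4 * y / N / (4 * D / N) = y / D" if "N > 0" for D N :: real
    using that by simp
  ultimately show "disc_kernel w \<theta> = y / ((?s * x + ?k)\<^sup>2 + (?s * y)\<^sup>2)"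
    unfolding disc_kernel_def 1 using pos by metis
qed

text \<open>The integral is taken in the extended nonnegative reals, so its finiteness is part of the
  statement. The set \<open>S\<close> in the proof consists of the angles of the point at infinity.\<close>
lemma nevanlinna_representation:
  assumes f: "pick_function f"
  shows "\<exists>b \<mu>. b \<ge> 0 \<and> sets \<mu> = sets borel \<and>
    (\<forall>x y. y > 0 \<longrightarrow> ennreal (julia_quotient f (Complex x y)) =
        ennreal b + (\<integral>\<^sup>+t. ennreal (1 / (pi * ((t - x)\<^sup>2 + y\<^sup>2))) \<partial>\<mu>))"
proof -
  let ?G = "\<lambda>w. f (\<i> * (1 + w) / (1 - w))"
  have im_cayley: "Im (\<i> * (1 + w) / (1 - w)) > 0" if w: "cmod w < 1" for w
  proof -
    have im_eq: "Im (\<i> * (1 + w) / (1 - w)) = (1 - (cmod w)\<^sup>2) / ((Re (1 - w))\<^sup>2 + (Im (1 - w))\<^sup>2)"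
      by (simp add: Im_divide cmod_power2) (simp add: power2_eq_square algebra_simps)
    have "w \<noteq> 1" using w by auto
    then have "0 < (Re (1 - w))\<^sup>2 + (Im (1 - w))\<^sup>2"
      by (metis complex_eq_0 diff_eq_eq add_0 not_sum_power2_lt_zero linorder_neqE_linordered_idom eq_iff_diff_eq_0)
    moreover have "0 < 1 - (cmod w)\<^sup>2"
      using w by (simp add: power_less_one_iff abs_square_less_1)
    ultimately show ?thesis
      by (subst im_eq) (rule divide_pos_pos)
  qed
  have fhol: "f holomorphic_on upper_half_plane"
    using f by (auto simp: pick_function_def analytic_imp_holomorphic)
  have "?G holomorphic_on ball 0 1"
    by (rule holomorphic_on_compose_gen[unfolded o_def, OF _ fhol])
      (auto intro!: holomorphic_intros im_cayley[simplified] simp: upper_half_plane_def)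
  moreover have "Im (?G w) \<ge> 0" if "cmod w < 1" for w
    using f im_cayley[OF that] by (simp add: pick_function_def upper_half_plane_def)
  ultimately obtain c M where c: "c \<ge> 0" and M: "real_distribution M"
    and rep: "\<And>w. cmod w < 1 \<Longrightarrow> Im (?G w) = c * (\<integral>\<theta>. disc_kernel w \<theta> \<partial>M)"
    using herglotz_disc by blast
  interpret real_distribution M by fact
  define S where "S = {\<theta>::real. sin (\<theta>/2) = 0}"
  define T where "T \<theta> = - cos (\<theta>/2) / sin (\<theta>/2)" for \<theta> :: real
  define q where "q \<theta> = (if sin (\<theta>/2) = 0 then 0 else ennreal (c * pi / (sin (\<theta>/2))\<^sup>2))" for \<theta> :: real
  define b where "b = c * measure M S"
  define \<mu> where "\<mu> = distr (density M q) borel T"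
  have [measurable]: "T \<in> borel_measurable borel" "q \<in> borel_measurable borel" "S \<in> sets borel"
    unfolding T_def q_def S_def by measurable
  have "ennreal (julia_quotient f (Complex x y)) =
        ennreal b + (\<integral>\<^sup>+t. ennreal (1 / (pi * ((t - x)\<^sup>2 + y\<^sup>2))) \<partial>\<mu>)" if y: "y > 0" for x y
  proof -
    define w where "w = (Complex x y - \<i>) / (Complex x y + \<i>)"
    have w: "cmod w < 1" and kw: "\<And>\<theta>. disc_kernel w \<theta> = y / ((sin (\<theta>/2) * x + cos (\<theta>/2))\<^sup>2 + (sin (\<theta>/2) * y)\<^sup>2)"
      using disc_kernel_cayley[OF y, of x] by (auto simp: w_def)
    have "Complex x y + \<i> \<noteq> 0" using y by (auto simp: complex_eq_iff)
    then have "\<i> * (1 + w) / (1 - w) = Complex x y"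
      by (simp add: w_def divide_simps)
    then have J: "julia_quotient f (Complex x y) = (\<integral>\<theta>. c * disc_kernel w \<theta> / y \<partial>M)"
      using rep[OF w] by (simp add: julia_quotient_def)
    have [measurable]: "disc_kernel w \<in> borel_measurable borel"
      using isCont_disc_kernel[OF w]
      by (intro borel_measurable_continuous_onI) (simp add: continuous_at_imp_continuous_on)
    have "integrable M (disc_kernel w)"
      using disc_kernel_nonneg[OF w] disc_kernel_le[OF w]
      by (intro integrable_const_bound[where B = "(1 - (cmod w)\<^sup>2) / (1 - cmod w)\<^sup>2"]) auto
    then have "ennreal (julia_quotient f (Complex x y)) = (\<integral>\<^sup>+\<theta>. ennreal (c * disc_kernel w \<theta> / y) \<partial>M)"
      unfolding J using c y disc_kernel_nonneg[OF w] by (intro nn_integral_eq_integral[symmetric]) auto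
    also have "\<dots> = (\<integral>\<^sup>+\<theta>. ennreal c * indicator S \<theta> + q \<theta> * ennreal (1 / (pi * ((T \<theta> - x)\<^sup>2 + y\<^sup>2))) \<partial>M)"
    proof (intro nn_integral_cong)
      fix \<theta>
      show "ennreal (c * disc_kernel w \<theta> / y) = ennreal c * indicator S \<theta> + q \<theta> * ennreal (1 / (pi * ((T \<theta> - x)\<^sup>2 + y\<^sup>2)))"
      proof (cases "sin (\<theta>/2) = 0")
        case True
        then have "(cos (\<theta>/2))\<^sup>2 = 1" using sin_cos_squared_add[of "\<theta>/2"] by simp
        with True y show ?thesis by (simp add: kw q_def S_def)
      next
        case False
        define s k where "s = sin (\<theta>/2)" and "k = cos (\<theta>/2)"
        have s: "s \<noteq> 0" using False by (simp add: s_def)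
        have "(s * x + k)\<^sup>2 + (s * y)\<^sup>2 = s\<^sup>2 * ((- k / s - x)\<^sup>2 + y\<^sup>2)"
          using s by (simp add: field_simps power2_eq_square)
        then have "c * disc_kernel w \<theta> / y = (c * pi / s\<^sup>2) * (1 / (pi * ((T \<theta> - x)\<^sup>2 + y\<^sup>2)))"
          using y by (simp add: kw T_def s_def[symmetric] k_def[symmetric])
        with False c show ?thesis
          by (simp add: q_def S_def ennreal_mult'[symmetric] s_def)
      qed
    qed
    also have "\<dots> = ennreal b + (\<integral>\<^sup>+\<theta>. q \<theta> * ennreal (1 / (pi * ((T \<theta> - x)\<^sup>2 + y\<^sup>2))) \<partial>M)"
      using c by (subst nn_integral_add) (auto simp: b_def nn_integral_cmult emeasure_eq_measure ennreal_mult)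
    also have "(\<integral>\<^sup>+\<theta>. q \<theta> * ennreal (1 / (pi * ((T \<theta> - x)\<^sup>2 + y\<^sup>2))) \<partial>M) = (\<integral>\<^sup>+t. ennreal (1 / (pi * ((t - x)\<^sup>2 + y\<^sup>2))) \<partial>\<mu>)"
      unfolding \<mu>_def by (simp add: nn_integral_distr nn_integral_density)
    finally show ?thesis .
  qed
  moreover have "b \<ge> 0" "sets \<mu> = sets borel"
    using c by (auto simp: b_def \<mu>_def)
  ultimately show ?thesis by blast
qed

lemma integral_inverse_1_plus_sq:
  shows integrable_inverse_1_plus_sq: "integrable lborel (\<lambda>s::real. 1 / (1 + s\<^sup>2))"
    and "(\<integral>s. 1 / (1 + (s::real)\<^sup>2) \<partial>lborel) = pi"
  using LBINT_inverse_1_plus_square integrable_inverse_1_plus_square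
  by (simp_all add: set_integrable_def interval_lebesgue_integral_def set_lebesgue_integral_def inverse_eq_divide)

section \<open>The Nevanlinna measure\<close>

lemma locally_finite_eqI_compact_support:
  fixes \<mu> \<nu> :: "real measure"
  assumes sets [simp, measurable_cong]: "sets \<mu> = sets borel" "sets \<nu> = sets borel"
    and fin: "\<And>K. compact K \<Longrightarrow> emeasure \<mu> K < \<infinity>" "\<And>K. compact K \<Longrightarrow> emeasure \<nu> K < \<infinity>"
    and eq: "\<And>\<phi>::real \<Rightarrow> real. continuous_on UNIV \<phi> \<Longrightarrow> compact (closure {x. \<phi> x \<noteq> 0}) \<Longrightarrow> (\<integral>x. \<phi> x \<partial>\<mu>) = (\<integral>x. \<phi> x \<partial>\<nu>)"
  shows "\<mu> = \<nu>"
proof -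
  \<comment> \<open>Tents that decrease to the indicator of \<open>[a, b]\<close>\<close>
  define \<phi> where "\<phi> a b n x = max 0 (min 1 (1 + real (Suc n) * min (x - a) (b - x)))" for a b x :: real and n
  have cont: "continuous_on UNIV (\<phi> a b n)" for a b n
    unfolding \<phi>_def by (intro continuous_intros)
  have meas [measurable]: "\<phi> a b n \<in> borel_measurable borel" for a b n
    using cont by (rule borel_measurable_continuous_onI)
  have supp: "\<phi> a b n x = 0" if "x \<notin> {a-1..b+1}" for a b n x
  proof -
    have "min (x - a) (b - x) \<le> -1" using that by auto
    then have "real (Suc n) * min (x - a) (b - x) \<le> real (Suc n) * (-1)"
      by (intro mult_left_mono) auto
    then show ?thesis by (auto simp: \<phi>_def)
  qed
  have range: "0 \<le> \<phi> a b n x" "\<phi> a b n x \<le> 1" for a b n x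
    by (auto simp: \<phi>_def)
  have cpt: "compact (closure {x. \<phi> a b n x \<noteq> 0})" for a b n
  proof -
    have "{x. \<phi> a b n x \<noteq> 0} \<subseteq> {a-1..b+1}" using supp by blast
    then show ?thesis
      by (meson bounded_closed_interval bounded_subset compact_closure)
  qed
  have lim: "(\<lambda>n. \<integral>x. \<phi> a b n x \<partial>M) \<longlonglongrightarrow> measure M {a..b}"
    if M: "sets M = sets borel" "\<And>K. compact K \<Longrightarrow> emeasure M K < \<infinity>" for M a b
  proof -
    note M(1)[measurable_cong]
    have "(\<lambda>n. \<integral>x. \<phi> a b n x \<partial>M) \<longlonglongrightarrow> (\<integral>x. indicator {a..b} x \<partial>M)"
    proof (rule integral_dominated_convergence[where w = "indicator {a-1..b+1}"])
      show "AE x in M. (\<lambda>n. \<phi> a b n x) \<longlonglongrightarrow> indicator {a..b} x"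
      proof (rule AE_I2)
        fix x
        show "(\<lambda>n. \<phi> a b n x) \<longlonglongrightarrow> indicator {a..b} x"
        proof (cases "x \<in> {a..b}")
          case True
          then have "\<phi> a b n x = 1" for n by (auto simp: \<phi>_def)
          with True show ?thesis by simp
        next
          case False
          then have neg: "- min (x - a) (b - x) > 0" by auto
          then obtain N where N: "1 < real N * (- min (x - a) (b - x))"
            using reals_Archimedean3 by blast
          have "\<phi> a b n x = 0" if "n \<ge> N" for n
          proof -
            have "real N * (- min (x - a) (b - x)) \<le> real (Suc n) * (- min (x - a) (b - x))"
              using that neg by (intro mult_right_mono) auto
            with N show ?thesis by (auto simp: \<phi>_def)
          qed
          then have "\<forall>\<^sub>F n in sequentially. \<phi> a b n x = 0"
            by (auto simp: eventually_sequentially)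
          with False show ?thesis by (simp add: tendsto_eventually)
        qed
      qed
      show "AE x in M. norm (\<phi> a b n x) \<le> indicator {a-1..b+1} x" for n
        using supp[of _ a b n] range[of a b n] by (intro AE_I2) (auto simp: indicator_def)
      show "integrable M (indicator {a-1..b+1} :: real \<Rightarrow> real)"
        using M by (simp add: integrable_indicator_iff)
    qed (use M in auto)
    then show ?thesis using M by simp
  qed
  have int: "emeasure \<mu> {a..b} = emeasure \<nu> {a..b}" for a b
  proof -
    have "measure \<mu> {a..b} = measure \<nu> {a..b}"
      using lim[OF sets(1) fin(1), of a b] lim[OF sets(2) fin(2), of a b]
      unfolding eq[OF cont cpt] by (rule LIMSEQ_unique)
    then show ?thesis
      using fin[of "{a..b}"] by (simp add: emeasure_eq_ennreal_measure)
  qed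
  show ?thesis
  proof (rule measure_eqI_generator_eq[where E = "range (\<lambda>(a, b). {a..b})" and \<Omega> = UNIV and A = "\<lambda>n. {- real n..real n}"])
    show "Int_stable (range (\<lambda>(a::real, b). {a..b}))"
      by (auto simp: Int_stable_def)
    have "sets (borel :: real measure) = sigma_sets UNIV (range (\<lambda>(a, b). {a..b}))"
      by (subst borel_eq_atLeastAtMost) auto
    then show "sets \<mu> = sigma_sets UNIV (range (\<lambda>(a, b). {a..b}))" "sets \<nu> = sigma_sets UNIV (range (\<lambda>(a, b). {a..b}))"
      by simp_all
    have "\<exists>n. x \<in> {- real n..real n}" for x
    proof -
      obtain n where "\<bar>x\<bar> \<le> real n" using real_arch_simple by blast
      then show ?thesis by (intro exI[of _ n]) auto
    qed
    then show "(\<Union>n. {- real n..real n}) = UNIV" by blast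
    show "emeasure \<mu> {- real n..real n} \<noteq> \<infinity>" for n
      using fin(1)[of "{- real n..real n}"] by simp
  qed (auto simp: int)
qed

text \<open>The Poisson kernels are an approximate identity; the average is written after the substitution
  \<open>x = t + y s\<close>.\<close>
lemma poisson_average_limit:
  assumes cont: "continuous_on UNIV (\<phi>::real \<Rightarrow> real)" and B: "\<And>x. \<bar>\<phi> x\<bar> \<le> B"
    and Y: "\<And>n. Y n > 0" "Y \<longlonglongrightarrow> (0::real)"
  shows "(\<lambda>n. \<integral>s. \<phi> (t + Y n * s) / (1 + s\<^sup>2) \<partial>lborel) \<longlonglongrightarrow> pi * \<phi> t"
proof -
  have [measurable]: "\<phi> \<in> borel_measurable borel"
    using cont by (rule borel_measurable_continuous_onI)
  have "B \<ge> 0" using B[of 0] by simp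
  have "(\<lambda>n. \<integral>s. \<phi> (t + Y n * s) / (1 + s\<^sup>2) \<partial>lborel) \<longlonglongrightarrow> (\<integral>s. \<phi> t * (1 / (1 + s\<^sup>2)) \<partial>lborel)"
  proof (rule integral_dominated_convergence[where w = "\<lambda>s. B * (1 / (1 + s\<^sup>2))"])
    show "AE s in lborel. (\<lambda>n. \<phi> (t + Y n * s) / (1 + s\<^sup>2)) \<longlonglongrightarrow> \<phi> t * (1 / (1 + s\<^sup>2))"
    proof (rule AE_I2)
      fix s :: real
      have "isCont \<phi> t" using cont by (simp add: continuous_on_eq_continuous_at)
      moreover have "(\<lambda>n. t + Y n * s) \<longlonglongrightarrow> t + 0 * s"
        by (intro tendsto_intros Y)
      ultimately have "(\<lambda>n. \<phi> (t + Y n * s)) \<longlonglongrightarrow> \<phi> t"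
        by (intro isCont_tendsto_compose[of t \<phi>]) auto
      then have "(\<lambda>n. \<phi> (t + Y n * s) * (1 / (1 + s\<^sup>2))) \<longlonglongrightarrow> \<phi> t * (1 / (1 + s\<^sup>2))"
        by (intro tendsto_mult tendsto_const)
      then show "(\<lambda>n. \<phi> (t + Y n * s) / (1 + s\<^sup>2)) \<longlonglongrightarrow> \<phi> t * (1 / (1 + s\<^sup>2))" by simp
    qed
    show "AE s in lborel. norm (\<phi> (t + Y n * s) / (1 + s\<^sup>2)) \<le> B * (1 / (1 + s\<^sup>2))" for n
      using B by (intro AE_I2) (simp add: divide_right_mono)
    show "integrable lborel (\<lambda>s::real. B * (1 / (1 + s\<^sup>2)))"
      by (intro integrable_mult_right integrable_inverse_1_plus_sq)
  qed auto
  then show ?thesis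
    by (simp only: integral_mult_right_zero integral_inverse_1_plus_sq) (simp add: mult.commute)
qed

text \<open>A Pick function together with the data \<open>b\<close> and \<open>\<mu>\<close> of a Nevanlinna representation of it.\<close>
locale nevanlinna_data =
  fixes f :: "complex \<Rightarrow> complex" and b :: real and \<mu> :: "real measure"
  assumes pick: "pick_function f"
    and b_nonneg: "b \<ge> 0"
    and sets_mu [simp, measurable_cong]: "sets \<mu> = sets borel"
    and ennreal_julia: "\<And>x y. y > 0 \<Longrightarrow> ennreal (julia_quotient f (Complex x y)) =
        ennreal b + (\<integral>\<^sup>+t. ennreal (1 / (pi * ((t - x)\<^sup>2 + y\<^sup>2))) \<partial>\<mu>)"
begin

lemma space_mu [simp]: "space \<mu> = UNIV"
  using sets_eq_imp_space_eq[OF sets_mu] by simp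

lemma im_nonneg: "y > 0 \<Longrightarrow> Im (f (Complex x y)) \<ge> 0"
  using pick by (simp add: pick_function_def upper_half_plane_def)

lemma julia_nonneg: "y > 0 \<Longrightarrow> julia_quotient f (Complex x y) \<ge> 0"
  using im_nonneg by (simp add: julia_quotient_def)

lemma continuous_im: "y > 0 \<Longrightarrow> continuous_on UNIV (\<lambda>x. Im (f (Complex x y)))"
proof -
  assume "y > 0"
  have "continuous_on upper_half_plane f"
    using pick unfolding pick_function_def
    by (intro holomorphic_on_imp_continuous_on analytic_imp_holomorphic) auto
  moreover have "continuous_on UNIV (\<lambda>x. Complex x y)"
    unfolding Complex_eq by (intro continuous_intros)
  ultimately have "continuous_on UNIV (\<lambda>x. f (Complex x y))"
    by (rule continuous_on_compose2) (use \<open>y > 0\<close> in \<open>auto simp: upper_half_plane_def\<close>)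
  then show ?thesis by (rule continuous_on_Im)
qed

lemma kernel_finite: "y > 0 \<Longrightarrow> (\<integral>\<^sup>+t. ennreal (1 / (pi * ((t - x)\<^sup>2 + y\<^sup>2))) \<partial>\<mu>) < \<infinity>"
  using ennreal_julia[of y x] by (metis ennreal_add_eq_top ennreal_neq_top infinity_ennreal_def less_top)

lemma kernel_integrable: "y > 0 \<Longrightarrow> integrable \<mu> (\<lambda>t. 1 / (pi * ((t - x)\<^sup>2 + y\<^sup>2)))"
  using kernel_finite[of y x] by (intro integrableI_nonneg) auto

lemma im_eq_integral:
  assumes y: "y > 0"
  shows "Im (f (Complex x y)) = y * b + (\<integral>t. y / (pi * ((t - x)\<^sup>2 + y\<^sup>2)) \<partial>\<mu>)"
proof -
  have "ennreal (julia_quotient f (Complex x y)) = ennreal b + ennreal (\<integral>t. 1 / (pi * ((t - x)\<^sup>2 + y\<^sup>2)) \<partial>\<mu>)"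
    unfolding ennreal_julia[OF y] using kernel_integrable[OF y] by (subst nn_integral_eq_integral) auto
  also have "\<dots> = ennreal (b + (\<integral>t. 1 / (pi * ((t - x)\<^sup>2 + y\<^sup>2)) \<partial>\<mu>))"
    using b_nonneg by (intro ennreal_plus[symmetric] integral_nonneg_AE) auto
  finally have "julia_quotient f (Complex x y) = b + (\<integral>t. 1 / (pi * ((t - x)\<^sup>2 + y\<^sup>2)) \<partial>\<mu>)"
    using julia_nonneg[OF y] b_nonneg by (subst (asm) ennreal_inj) (auto intro!: add_nonneg_nonneg integral_nonneg_AE)
  then have "Im (f (Complex x y)) = y * (b + (\<integral>t. 1 / (pi * ((t - x)\<^sup>2 + y\<^sup>2)) \<partial>\<mu>))"
    using y by (simp add: julia_quotient_def field_simps)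
  also have "\<dots> = y * b + (\<integral>t. y * (1 / (pi * ((t - x)\<^sup>2 + y\<^sup>2))) \<partial>\<mu>)"
    by (simp only: integral_mult_right_zero distrib_left)
  finally show ?thesis by simp
qed

lemma emeasure_compact:
  assumes "compact K"
  shows "emeasure \<mu> K < \<infinity>"
proof -
  obtain R where R: "\<And>t. t \<in> K \<Longrightarrow> \<bar>t\<bar> \<le> R"
    using compact_imp_bounded[OF assms] by (auto simp: bounded_iff)
  have [measurable]: "K \<in> sets borel" using assms by (simp add: borel_compact)
  have "emeasure \<mu> K = (\<integral>\<^sup>+t. indicator K t \<partial>\<mu>)"
    by simp
  also have "\<dots> \<le> (\<integral>\<^sup>+t. ennreal (pi * (R\<^sup>2 + 1)) * ennreal (1 / (pi * ((t - 0)\<^sup>2 + 1\<^sup>2))) \<partial>\<mu>)"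
  proof (intro nn_integral_mono)
    fix t
    have "t \<in> K \<Longrightarrow> 1 \<le> (pi * (R\<^sup>2 + 1)) * (1 / (pi * ((t - 0)\<^sup>2 + 1\<^sup>2)))"
      using power_mono[OF R, of t 2] by (simp add: field_simps add_pos_nonneg)
    then have "indicator K t \<le> (pi * (R\<^sup>2 + 1)) * (1 / (pi * ((t - 0)\<^sup>2 + 1\<^sup>2)))"
      by (cases "t \<in> K") auto
    then have "ennreal (indicator K t) \<le> ennreal ((pi * (R\<^sup>2 + 1)) * (1 / (pi * ((t - 0)\<^sup>2 + 1\<^sup>2))))"
      by (rule ennreal_leI)
    then show "indicator K t \<le> ennreal (pi * (R\<^sup>2 + 1)) * ennreal (1 / (pi * ((t - 0)\<^sup>2 + 1\<^sup>2)))"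
      by (subst (asm) ennreal_mult) (auto simp: ennreal_indicator)
  qed
  also have "\<dots> < \<infinity>"
    using kernel_finite[of 1 0] by (subst nn_integral_cmult) (auto simp: ennreal_mult_less_top)
  finally show ?thesis .
qed

sublocale mu: sigma_finite_measure \<mu>
proof
  show "\<exists>A. countable A \<and> A \<subseteq> sets \<mu> \<and> \<Union> A = space \<mu> \<and> (\<forall>a\<in>A. emeasure \<mu> a \<noteq> \<infinity>)"
  proof (intro exI[of _ "range (\<lambda>n. {- real n..real n})"] conjI)
    have "\<exists>n. x \<in> {- real n..real n}" for x
    proof -
      obtain n where "\<bar>x\<bar> \<le> real n" using real_arch_simple by blast
      then show ?thesis by (intro exI[of _ n]) auto
    qed
    then show "\<Union> (range (\<lambda>n. {- real n..real n})) = space \<mu>" by auto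
    show "\<forall>a\<in>range (\<lambda>n. {- real n..real n}). emeasure \<mu> a \<noteq> \<infinity>"
      using emeasure_compact by (auto simp: less_top)
  qed auto
qed

text \<open>By Fubini's theorem the integral of \<open>\<phi>\<close> against \<open>Im f(x + i y) dx\<close> is, up to a multiple of
  \<open>y\<close>, the \<open>\<mu>\<close>-integral of the Poisson average \<open>Q\<close> of \<open>\<phi>\<close>. These averages converge to \<open>\<phi>\<close> and are
  dominated by a multiple of \<open>1 / (1 + t\<^sup>2)\<close>, because \<open>\<phi>\<close> has compact support.\<close>
lemma im_vague_limit_sequentially:
  assumes cont: "continuous_on UNIV (\<phi>::real \<Rightarrow> real)" and supp: "\<And>x. \<phi> x \<noteq> 0 \<Longrightarrow> \<bar>x\<bar> \<le> R"
    and Y: "\<And>n. Y n > 0" "Y \<longlonglongrightarrow> (0::real)"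
  shows "(\<lambda>n. \<integral>x. Im (f (Complex x (Y n))) * \<phi> x \<partial>lborel) \<longlonglongrightarrow> (\<integral>x. \<phi> x \<partial>\<mu>)"
proof -
  have [measurable]: "\<phi> \<in> borel_measurable borel"
    using cont by (rule borel_measurable_continuous_onI)
  define r where "r = max R 1"
  have r: "r \<ge> 1" "\<And>x. \<phi> x \<noteq> 0 \<Longrightarrow> \<bar>x\<bar> \<le> r"
    using supp by (force simp: r_def)+
  have "compact (\<phi> ` {-r..r})"
    by (intro compact_continuous_image continuous_on_subset[OF cont]) auto
  then obtain B where B': "\<And>x. x \<in> {-r..r} \<Longrightarrow> \<bar>\<phi> x\<bar> \<le> B"
    using compact_imp_bounded by (fastforce simp: bounded_iff)
  have B: "\<bar>\<phi> x\<bar> \<le> B" for x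
    using B'[of x] B'[of 0] r(2)[of x] r(1) by (cases "\<phi> x = 0") (force simp: abs_le_iff)+
  have "B \<ge> 0" using B[of 0] by simp
  have int_restrict: "integrable lborel (\<lambda>x. g x * \<phi> x)" if "continuous_on UNIV g" for g :: "real \<Rightarrow> real"
  proof -
    have "set_integrable lborel {-r..r} (\<lambda>x. g x * \<phi> x)"
      by (intro borel_integrable_atLeastAtMost' continuous_intros continuous_on_subset[OF that] continuous_on_subset[OF cont]) auto
    then have "integrable lborel (\<lambda>x. indicator {-r..r} x * (g x * \<phi> x))"
      by (simp add: set_integrable_def)
    moreover have "indicator {-r..r} x * (g x * \<phi> x) = g x * \<phi> x" for x
      using r(2)[of x] by (cases "\<phi> x = 0") (auto simp: indicator_def abs_le_iff)
    ultimately show ?thesis by simp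
  qed
  have int_phi: "integrable lborel \<phi>"
    using int_restrict[of "\<lambda>_. 1"] by simp
  define p where "p y u = y / (pi * (u\<^sup>2 + y\<^sup>2))" for y u :: real
  have p_nonneg: "p y u \<ge> 0" if "y > 0" for y u using that by (simp add: p_def)
  have [measurable]: "(\<lambda>u. p y u) \<in> borel_measurable borel" for y unfolding p_def by measurable
  have p_int: "integrable \<mu> (\<lambda>t. p y (t - x))" if "y > 0" for x y
    using integrable_mult_right[OF kernel_integrable[OF that, of x], of y] by (simp add: p_def)
  define Q where "Q n t = (\<integral>x. p (Y n) (t - x) * \<phi> x \<partial>lborel)" for n t
  interpret P: pair_sigma_finite lborel \<mu> ..
  have im_eq: "Im (f (Complex x (Y n))) = Y n * b + (\<integral>t. p (Y n) (t - x) \<partial>\<mu>)" for x n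
    using im_eq_integral[OF Y(1)] by (simp add: p_def)
  have fub_int: "integrable (lborel \<Otimes>\<^sub>M \<mu>) (\<lambda>(x, t). p (Y n) (t - x) * \<phi> x)" for n
  proof (rule P.Fubini_integrable)
    have "(\<integral>t. norm (p (Y n) (t - x) * \<phi> x) \<partial>\<mu>) = \<bar>(Im (f (Complex x (Y n))) - Y n * b) * \<phi> x\<bar>" for x
    proof -
      have "(\<integral>t. p (Y n) (t - x) \<partial>\<mu>) \<ge> 0"
        using p_nonneg[OF Y(1)] by (intro integral_nonneg_AE) auto
      then show ?thesis
        unfolding im_eq using p_nonneg[OF Y(1)] by (simp add: abs_mult)
    qed
    moreover have "integrable lborel (\<lambda>x. \<bar>(Im (f (Complex x (Y n))) - Y n * b) * \<phi> x\<bar>)"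
      by (intro integrable_abs int_restrict continuous_intros continuous_im Y)
    ultimately show "integrable lborel (\<lambda>x. \<integral>t. norm (case (x, t) of (x, t) \<Rightarrow> p (Y n) (t - x) * \<phi> x) \<partial>\<mu>)"
      by simp
    show "AE x in lborel. integrable \<mu> (\<lambda>t. case (x, t) of (x, t) \<Rightarrow> p (Y n) (t - x) * \<phi> x)"
      using p_int[OF Y(1)] by (intro AE_I2) simp
  qed (simp add: p_def)
  have eq: "(\<integral>x. Im (f (Complex x (Y n))) * \<phi> x \<partial>lborel) = Y n * b * (\<integral>x. \<phi> x \<partial>lborel) + (\<integral>t. Q n t \<partial>\<mu>)" for n
  proof -
    have "(\<integral>x. Im (f (Complex x (Y n))) * \<phi> x \<partial>lborel) = (\<integral>x. Y n * b * \<phi> x + (\<integral>t. p (Y n) (t - x) * \<phi> x \<partial>\<mu>) \<partial>lborel)"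
      unfolding im_eq by (simp add: distrib_right)
    also have "\<dots> = Y n * b * (\<integral>x. \<phi> x \<partial>lborel) + (\<integral>x. (\<integral>t. p (Y n) (t - x) * \<phi> x \<partial>\<mu>) \<partial>lborel)"
      using P.integrable_fst[OF fub_int[of n]] int_phi by (subst Bochner_Integration.integral_add) auto
    also have "(\<integral>x. (\<integral>t. p (Y n) (t - x) * \<phi> x \<partial>\<mu>) \<partial>lborel) = (\<integral>t. Q n t \<partial>\<mu>)"
      unfolding Q_def using P.Fubini_integral[OF fub_int[of n]] by simp
    finally show ?thesis .
  qed
  have Q_alt: "Q n t = (\<integral>s. \<phi> (t + Y n * s) / (1 + s\<^sup>2) \<partial>lborel) / pi" for n t
  proof -
    have "Q n t = \<bar>Y n\<bar> *\<^sub>R (\<integral>s. p (Y n) (t - (t + Y n * s)) * \<phi> (t + Y n * s) \<partial>lborel)"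
      unfolding Q_def using Y(1)[of n] by (intro lborel_integral_real_affine) auto
    also have "\<dots> = (\<integral>s. Y n * (p (Y n) (t - (t + Y n * s)) * \<phi> (t + Y n * s)) \<partial>lborel)"
      using Y(1)[of n] by simp
    also have "\<dots> = (\<integral>s. \<phi> (t + Y n * s) / (1 + s\<^sup>2) / pi \<partial>lborel)"
    proof (intro Bochner_Integration.integral_cong refl)
      fix s
      have "Y n * p (Y n) (t - (t + Y n * s)) = 1 / (1 + s\<^sup>2) / pi"
      proof -
        have "t - (t + Y n * s) = - (Y n * s)" by simp
        then have "Y n * p (Y n) (t - (t + Y n * s)) = (Y n)\<^sup>2 / (pi * ((Y n)\<^sup>2 * (1 + s\<^sup>2)))"
          unfolding p_def by (simp add: power2_eq_square algebra_simps)
        then show ?thesis using Y(1)[of n] by simp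
      qed
      then show "Y n * (p (Y n) (t - (t + Y n * s)) * \<phi> (t + Y n * s)) = \<phi> (t + Y n * s) / (1 + s\<^sup>2) / pi"
        by (simp add: mult.assoc[symmetric])
    qed
    also have "\<dots> = (\<integral>s. \<phi> (t + Y n * s) / (1 + s\<^sup>2) \<partial>lborel) / pi" by (rule integral_divide_zero)
    finally show ?thesis .
  qed
  have Q_lim: "(\<lambda>n. Q n t) \<longlonglongrightarrow> \<phi> t" for t
    using tendsto_divide[OF poisson_average_limit[OF cont B Y, of t] tendsto_const[of pi]] unfolding Q_alt by simp
  have Q_le_B: "\<bar>Q n t\<bar> \<le> B" for n t
  proof -
    have "norm (\<integral>s. \<phi> (t + Y n * s) / (1 + s\<^sup>2) \<partial>lborel) \<le> (\<integral>s. B * (1 / (1 + s\<^sup>2)) \<partial>lborel)"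
    proof (rule Bochner_Integration.integral_norm_bound_integral)
      show I: "integrable lborel (\<lambda>s::real. B * (1 / (1 + s\<^sup>2)))"
        by (intro integrable_mult_right integrable_inverse_1_plus_sq)
      have le: "norm (\<phi> (t + Y n * s) / (1 + s\<^sup>2)) \<le> B * (1 / (1 + s\<^sup>2))" for s
        using B by (simp add: divide_right_mono)
      show "norm (\<phi> (t + Y n * s) / (1 + s\<^sup>2)) \<le> B * (1 / (1 + s\<^sup>2))" for s
        by (rule le)
      show "integrable lborel (\<lambda>s. \<phi> (t + Y n * s) / (1 + s\<^sup>2))"
      proof (rule Bochner_Integration.integrable_bound[OF I])
        show "AE s in lborel. norm (\<phi> (t + Y n * s) / (1 + s\<^sup>2)) \<le> norm (B * (1 / (1 + s\<^sup>2)))"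
          using order_trans[OF le abs_ge_self] by (intro AE_I2) (simp only: real_norm_def)
      qed measurable
    qed
    also have "\<dots> = B * pi"
      by (simp only: integral_mult_right_zero integral_inverse_1_plus_sq)
    finally show ?thesis by (simp add: Q_alt field_simps abs_mult)
  qed
  define A where "A = B * (16 * r + (1 + 4 * r\<^sup>2))"
  obtain N where N: "\<And>n. n \<ge> N \<Longrightarrow> Y n \<le> 1"
    using order_tendstoD(2)[OF Y(2), of 1] unfolding eventually_sequentially
    by (metis less_imp_le zero_less_one)
  have Q_bound: "\<bar>Q n t\<bar> \<le> A * (1 / (t\<^sup>2 + 1\<^sup>2))" if "n \<ge> N" for n t
  proof (cases "\<bar>t\<bar> \<le> 2 * r")
    case True
    then have "t\<^sup>2 \<le> 4 * r\<^sup>2" using power_mono[OF True, of 2] by simp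
    then have "B * (t\<^sup>2 + 1) \<le> A"
      unfolding A_def using \<open>B \<ge> 0\<close> r by (intro mult_left_mono) auto
    then have "B \<le> A * (1 / (t\<^sup>2 + 1\<^sup>2))"
      by (simp add: field_simps add_pos_nonneg)
    with Q_le_B[of n t] show ?thesis by simp
  next
    case False
    then have t: "\<bar>t\<bar> > 2 * r" by simp
    have bound: "norm (p (Y n) (t - x) * \<phi> x) \<le> indicator {-r..r} x * (4 / t\<^sup>2 * B)" for x
    proof (cases "x \<in> {-r..r}")
      case False
      then have "\<phi> x = 0" using r(2)[of x] by (cases "\<phi> x = 0") (auto simp: abs_le_iff)
      with False show ?thesis by simp
    next
      case True
      have "\<bar>t\<bar> / 2 \<le> \<bar>t - x\<bar>" using True t by (auto simp: abs_if split: if_splits)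
      from power_mono[OF this, of 2] have "t\<^sup>2 / 4 \<le> (t - x)\<^sup>2" by (simp add: power_divide)
      moreover have "Y n / (pi * ((t - x)\<^sup>2 + (Y n)\<^sup>2)) \<le> 1 / (t\<^sup>2 / 4)"
      proof (intro frac_le)
        have "t\<^sup>2 / 4 \<le> 1 * ((t - x)\<^sup>2 + (Y n)\<^sup>2)" using \<open>t\<^sup>2 / 4 \<le> (t - x)\<^sup>2\<close> by (simp add: add_increasing2)
        also have "\<dots> \<le> pi * ((t - x)\<^sup>2 + (Y n)\<^sup>2)" using pi_gt3 by (intro mult_right_mono) auto
        finally show "t\<^sup>2 / 4 \<le> pi * ((t - x)\<^sup>2 + (Y n)\<^sup>2)" .
        show "0 < t\<^sup>2 / 4" using t r by auto
      qed (use N[OF \<open>n \<ge> N\<close>] in auto)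
      ultimately have "p (Y n) (t - x) * \<bar>\<phi> x\<bar> \<le> 4 / t\<^sup>2 * B"
        using B[of x] by (intro mult_mono) (auto simp: p_def)
      with True p_nonneg[OF Y(1)[of n], of "t - x"] show ?thesis by (simp add: abs_mult)
    qed
    have "norm (Q n t) \<le> (\<integral>x. indicator {-r..r} x * (4 / t\<^sup>2 * B) \<partial>lborel)"
      unfolding Q_def
    proof (rule Bochner_Integration.integral_norm_bound_integral)
      show I: "integrable lborel (\<lambda>x. indicator {-r..r} x * (4 / t\<^sup>2 * B))"
        by (intro integrable_mult_left integrable_real_indicator) (use r in auto)
      show "integrable lborel (\<lambda>x. p (Y n) (t - x) * \<phi> x)"
      proof (rule Bochner_Integration.integrable_bound[OF I])
        show "AE x in lborel. norm (p (Y n) (t - x) * \<phi> x) \<le> norm (indicator {-r..r} x * (4 / t\<^sup>2 * B))"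
          using order_trans[OF bound abs_ge_self] by (intro AE_I2) (simp only: real_norm_def)
      qed measurable
    qed (use bound in auto)
    also have "\<dots> = 2 * r * (4 / t\<^sup>2 * B)" using r by simp
    also have "\<dots> \<le> A * (1 / (t\<^sup>2 + 1\<^sup>2))"
    proof -
      have "1 \<le> t\<^sup>2" using t r power_mono[of 1 "\<bar>t\<bar>" 2] by simp
      moreover have "1 / u \<le> 2 / (u + 1)" if "1 \<le> u" for u :: real
        using that by (simp add: field_simps)
      ultimately have "1 / t\<^sup>2 \<le> 2 / (t\<^sup>2 + 1)" by blast
      then have "(8 * r * B) * (1 / t\<^sup>2) \<le> (8 * r * B) * (2 / (t\<^sup>2 + 1))"
        using r \<open>B \<ge> 0\<close> by (intro mult_left_mono) auto
      also have "\<dots> = (16 * r * B) * (1 / (t\<^sup>2 + 1))" by simp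
      also have "\<dots> \<le> A * (1 / (t\<^sup>2 + 1))"
        unfolding A_def using \<open>B \<ge> 0\<close> by (intro mult_right_mono) (auto simp: algebra_simps)
      finally show ?thesis by (simp add: field_simps)
    qed
    finally show ?thesis by simp
  qed
  have "(\<lambda>n. \<integral>t. Q (n + N) t \<partial>\<mu>) \<longlonglongrightarrow> (\<integral>t. \<phi> t \<partial>\<mu>)"
  proof (rule integral_dominated_convergence[where w = "\<lambda>t. A * (1 / (t\<^sup>2 + 1\<^sup>2))"])
    show "integrable \<mu> (\<lambda>t. A * (1 / (t\<^sup>2 + 1\<^sup>2)))"
      using integrable_mult_right[OF kernel_integrable[of 1 0], of "A * pi"] by simp
    show "(\<lambda>t. Q (n + N) t) \<in> borel_measurable \<mu>" for n
      unfolding Q_def by measurable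
    show "AE t in \<mu>. (\<lambda>n. Q (n + N) t) \<longlonglongrightarrow> \<phi> t"
      by (intro AE_I2 LIMSEQ_ignore_initial_segment Q_lim)
    show "AE t in \<mu>. norm (Q (n + N) t) \<le> A * (1 / (t\<^sup>2 + 1\<^sup>2))" for n
      using Q_bound by (intro AE_I2) simp
  qed auto
  then have "(\<lambda>n. \<integral>t. Q n t \<partial>\<mu>) \<longlonglongrightarrow> (\<integral>t. \<phi> t \<partial>\<mu>)"
    by (rule LIMSEQ_offset)
  then have "(\<lambda>n. Y n * b * (\<integral>x. \<phi> x \<partial>lborel) + (\<integral>t. Q n t \<partial>\<mu>)) \<longlonglongrightarrow> 0 * b * (\<integral>x. \<phi> x \<partial>lborel) + (\<integral>t. \<phi> t \<partial>\<mu>)"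
    by (intro tendsto_intros Y)
  then show ?thesis by (simp add: eq)
qed

lemma im_weak_limit:
  "weak_limit (\<lambda>y. density lborel (\<lambda>x. ennreal (Im (f (Complex x y))))) \<mu> (at_right 0)"
  unfolding weak_limit_def
proof (intro allI impI, elim conjE)
  fix \<phi> :: "real \<Rightarrow> real" assume cont: "continuous_on UNIV \<phi>" and cpt: "compact (closure {x. \<phi> x \<noteq> 0})"
  have [measurable]: "\<phi> \<in> borel_measurable borel"
    using cont by (rule borel_measurable_continuous_onI)
  obtain R where "\<And>x. x \<in> closure {x. \<phi> x \<noteq> 0} \<Longrightarrow> \<bar>x\<bar> \<le> R"
    using compact_imp_bounded[OF cpt] by (auto simp: bounded_iff)
  then have R: "\<bar>x\<bar> \<le> R" if "\<phi> x \<noteq> 0" for x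
    using that closure_subset[of "{x. \<phi> x \<noteq> 0}"] by auto
  have "((\<lambda>y. \<integral>x. Im (f (Complex x y)) * \<phi> x \<partial>lborel) \<longlongrightarrow> (\<integral>x. \<phi> x \<partial>\<mu>)) (at_right 0)"
    unfolding tendsto_at_iff_sequentially o_def
    using im_vague_limit_sequentially[OF cont R] by auto
  moreover have "\<forall>\<^sub>F y in at_right 0. (\<integral>x. Im (f (Complex x y)) * \<phi> x \<partial>lborel) = (\<integral>x. \<phi> x \<partial>density lborel (\<lambda>x. ennreal (Im (f (Complex x y)))))"
    using eventually_at_right_less
  proof eventually_elim
    case (elim y)
    have [measurable]: "(\<lambda>x. Im (f (Complex x y))) \<in> borel_measurable borel"
      by (rule borel_measurable_continuous_onI[OF continuous_im[OF elim]])
    show ?case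
      using im_nonneg[OF elim] by (subst integral_density) auto
  qed
  ultimately show "((\<lambda>y. \<integral>x. \<phi> x \<partial>density lborel (\<lambda>x. ennreal (Im (f (Complex x y))))) \<longlongrightarrow> (\<integral>x. \<phi> x \<partial>\<mu>)) (at_right 0)"
    by (rule Lim_transform_eventually)
qed

lemma nevanlinna_measure_eq: "nevanlinna_measure f = \<mu>"
  unfolding nevanlinna_measure_def
proof (rule the_equality)
  show "sets \<mu> = sets borel \<and> (\<forall>K. compact K \<longrightarrow> emeasure \<mu> K < \<infinity>) \<and>
    weak_limit (\<lambda>y. density lborel (\<lambda>x. ennreal (Im (f (Complex x y))))) \<mu> (at_right 0)"
    using emeasure_compact im_weak_limit by auto
next
  fix \<nu> :: "real measure"
  assume \<nu>: "sets \<nu> = sets borel \<and> (\<forall>K. compact K \<longrightarrow> emeasure \<nu> K < \<infinity>) \<and>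
    weak_limit (\<lambda>y. density lborel (\<lambda>x. ennreal (Im (f (Complex x y))))) \<nu> (at_right 0)"
  show "\<nu> = \<mu>"
  proof (rule locally_finite_eqI_compact_support)
    fix \<phi> :: "real \<Rightarrow> real" assume "continuous_on UNIV \<phi>" "compact (closure {x. \<phi> x \<noteq> 0})"
    then show "(\<integral>x. \<phi> x \<partial>\<nu>) = (\<integral>x. \<phi> x \<partial>\<mu>)"
      using \<nu> im_weak_limit unfolding weak_limit_def
      by (intro tendsto_unique[OF trivial_limit_at_right_real[of 0],
        of "\<lambda>y. \<integral>x. \<phi> x \<partial>density lborel (\<lambda>x. ennreal (Im (f (Complex x y))))"]) blast+
  qed (use \<nu> emeasure_compact in auto)
qed

end

section \<open>The Stieltjes measure of a gauge function\<close>

text \<open>The standing assumptions on the monotone function \<open>\<gamma>\<close>.\<close>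
locale gauge =
  fixes \<gamma> :: "real \<Rightarrow> real"
  assumes mono_gamma: "mono_on {0..} \<gamma>"
    and nonneg: "\<And>t. t \<ge> 0 \<Longrightarrow> \<gamma> t \<ge> 0"
    and pos: "\<And>t. t > 0 \<Longrightarrow> \<gamma> t > 0"
    and bigo: "\<gamma> \<in> O[at_right 0](\<lambda>t. t\<^sup>2)"
begin

lemma gamma_mono: "0 \<le> s \<Longrightarrow> s \<le> t \<Longrightarrow> \<gamma> s \<le> \<gamma> t"
  using mono_gamma by (auto simp: mono_on_def)

lemma quadratic_bound: "\<exists>K>0. \<exists>e>0. \<forall>t. 0 < t \<and> t < e \<longrightarrow> \<gamma> t \<le> K * t\<^sup>2"
proof -
  obtain K where K: "K > 0" "\<forall>\<^sub>F t in at_right 0. norm (\<gamma> t) \<le> K * norm (t\<^sup>2)"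
    using bigo by (rule landau_o.bigE)
  then obtain e where "e > 0" "\<forall>t>0. t < e \<longrightarrow> norm (\<gamma> t) \<le> K * norm (t\<^sup>2)"
    unfolding eventually_at_right_field by auto
  with K show ?thesis by (intro exI[of _ K] exI[of _ e] conjI) (auto simp: abs_le_iff)
qed

lemma tendsto_gamma_0: "(\<gamma> \<longlongrightarrow> 0) (at_right 0)"
proof -
  have "((\<lambda>t::real. t\<^sup>2) \<longlongrightarrow> 0\<^sup>2) (at_right 0)"
    by (intro tendsto_intros)
  then have "(\<lambda>t::real. t\<^sup>2) \<in> o[at_right 0](\<lambda>_. 1)"
    by (intro smalloI_tendsto) auto
  from landau_o.big_small_trans[OF bigo this] show ?thesis
    by (drule_tac smalloD_tendsto) auto
qed

lemma gamma_0: "\<gamma> 0 = 0"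
proof (rule antisym)
  have "\<forall>\<^sub>F t in at_right 0. \<gamma> 0 \<le> \<gamma> t"
    using eventually_at_right_less by eventually_elim (auto intro: gamma_mono)
  then show "\<gamma> 0 \<le> 0"
    by (rule tendsto_lowerbound[OF tendsto_gamma_0]) simp
qed (simp add: nonneg)

text \<open>The right- and left-continuous versions of \<open>\<gamma>\<close>, and the measure \<open>d\<gamma>\<close>.\<close>
abbreviation "R \<equiv> right_value \<gamma>"
abbreviation "L \<equiv> left_value \<gamma>"
abbreviation "dgamma \<equiv> distributional_derivative \<gamma>"

lemma mono_max: "s \<le> t \<Longrightarrow> \<gamma> (max 0 s) \<le> \<gamma> (max 0 t)"
  by (intro gamma_mono) auto

lemma tendsto_R: "((\<lambda>s. \<gamma> (max 0 s)) \<longlongrightarrow> R t) (at_right t)"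
proof -
  have "((\<lambda>s. \<gamma> (max 0 s)) \<longlongrightarrow> Inf ((\<lambda>s. \<gamma> (max 0 s)) ` ({t<..} \<inter> UNIV))) (at t within ({t<..} \<inter> UNIV))"
    by (rule Lim_right_bound[where K = 0]) (auto intro!: mono_max nonneg)
  then show ?thesis
    unfolding right_value_def by (simp add: tendsto_Lim)
qed

lemma tendsto_L: "((\<lambda>s. \<gamma> (max 0 s)) \<longlongrightarrow> L t) (at_left t)"
proof -
  have "((\<lambda>s. \<gamma> (max 0 s)) \<longlongrightarrow> Sup ((\<lambda>s. \<gamma> (max 0 s)) ` ({..<t} \<inter> UNIV))) (at t within ({..<t} \<inter> UNIV))"
    by (rule Lim_left_bound[where K = "\<gamma> (max 0 t)"]) (auto intro!: mono_max)
  then show ?thesis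
    unfolding left_value_def by (simp add: tendsto_Lim)
qed

lemma R_le: "t < s \<Longrightarrow> R t \<le> \<gamma> (max 0 s)"
  by (rule tendsto_upperbound[OF tendsto_R])
    (auto intro!: mono_max simp: eventually_at_right_field)

lemma le_R: "\<gamma> (max 0 t) \<le> R t"
  by (rule tendsto_lowerbound[OF tendsto_R])
    (auto intro!: mono_max exI[of _ "t + 1"] simp: eventually_at_right_field)

lemma L_le: "L t \<le> \<gamma> (max 0 t)"
  by (rule tendsto_upperbound[OF tendsto_L])
    (auto intro!: mono_max exI[of _ "t - 1"] simp: eventually_at_left_field)

lemma le_L: "s < t \<Longrightarrow> \<gamma> (max 0 s) \<le> L t"
  by (rule tendsto_lowerbound[OF tendsto_L])
    (auto intro!: mono_max exI[of _ s] simp: eventually_at_left_field)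

lemma R_mono: "s \<le> t \<Longrightarrow> R s \<le> R t"
  using R_le[of s t] le_R[of t] by (cases "s = t") auto

lemma R_le_L: "s < t \<Longrightarrow> R s \<le> L t"
  using R_le[of s "(s + t) / 2"] le_L[of "(s + t) / 2" t] by auto

lemma L_mono: "s \<le> t \<Longrightarrow> L s \<le> L t"
  using L_le[of s] le_L[of s t] by (cases "s = t") auto

lemma R_pos: "t > 0 \<Longrightarrow> R t > 0"
  using le_R[of t] pos[of t] by simp

lemma L_pos: "t > 0 \<Longrightarrow> L t > 0"
  using le_L[of "t / 2" t] pos[of "t / 2"] by simp

lemma R_nonneg: "R t \<ge> 0"
  using le_R[of t] nonneg[of "max 0 t"] by simp

lemma L_nonneg: "L t \<ge> 0"
  using le_L[of "t - 1" t] nonneg[of "max 0 (t - 1)"] by simp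

lemma R_right_continuous: "continuous (at_right a) R"
  unfolding continuous_within
proof (rule tendsto_sandwich)
  show "\<forall>\<^sub>F s in at_right a. R a \<le> R s"
    using eventually_at_right_less by eventually_elim (auto intro: R_mono)
  have "\<forall>\<^sub>F s in at_right a. a < s" by (rule eventually_at_right_less)
  then show "\<forall>\<^sub>F s in at_right a. R s \<le> \<gamma> (max 0 (a + 2 * (s - a)))"
    by eventually_elim (auto intro!: R_le)
  have "filterlim (\<lambda>s. a + 2 * (s - a)) (at_right a) (at_right a)"
    unfolding filterlim_at
  proof
    show "\<forall>\<^sub>F s in at_right a. a + 2 * (s - a) \<in> {a<..} \<and> a + 2 * (s - a) \<noteq> a"
      using eventually_at_right_less by eventually_elim auto
    have "((\<lambda>s. a + 2 * (s - a)) \<longlongrightarrow> a + 2 * (a - a)) (at_right a)"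
      by (intro tendsto_intros)
    then show "((\<lambda>s. a + 2 * (s - a)) \<longlongrightarrow> a) (at_right a)" by simp
  qed
  from filterlim_compose[OF tendsto_R this]
  show "((\<lambda>s. \<gamma> (max 0 (a + 2 * (s - a)))) \<longlongrightarrow> R a) (at_right a)" .
qed simp

lemma R_tendsto_L: "(R \<longlongrightarrow> L t) (at_left t)"
proof (rule tendsto_sandwich[OF _ _ tendsto_L tendsto_const])
  show "\<forall>\<^sub>F s in at_left t. \<gamma> (max 0 s) \<le> R s"
    by (intro always_eventually allI le_R)
  have "\<forall>\<^sub>F s in at_left t. s < t"
    unfolding eventually_at_left_field by (auto intro: exI[of _ "t - 1"])
  then show "\<forall>\<^sub>F s in at_left t. R s \<le> L t"
    by eventually_elim (rule R_le_L)
qed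

lemma borel_R [measurable]: "R \<in> borel_measurable borel"
  by (rule borel_measurable_mono) (auto simp: mono_def R_mono)

lemma borel_L [measurable]: "L \<in> borel_measurable borel"
  by (rule borel_measurable_mono) (auto simp: mono_def L_mono)

lemma borel_gamma_max [measurable]: "(\<lambda>t. \<gamma> (max 0 t)) \<in> borel_measurable borel"
  by (rule borel_measurable_mono) (auto simp: mono_def mono_max)

lemma sets_dgamma [simp, measurable_cong]: "sets dgamma = sets borel"
  by (simp add: distributional_derivative_def)

lemma space_dgamma [simp]: "space dgamma = UNIV"
  by (simp add: distributional_derivative_def)

lemma emeasure_dgamma: "a \<le> b \<Longrightarrow> emeasure dgamma {a<..b} = ennreal (R b - R a)"
  unfolding distributional_derivative_def
  by (rule emeasure_interval_measure_Ioc) (auto intro: R_mono R_right_continuous)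

sublocale dgamma: sigma_finite_measure dgamma
  unfolding distributional_derivative_def
  by (rule sigma_finite_interval_measure) (auto intro: R_mono R_right_continuous)

lemma stieltjes_square_eq: "stieltjes_square \<gamma> t = L t * R t"
  by (simp add: stieltjes_square_def)

lemma borel_stieltjes_square [measurable]: "stieltjes_square \<gamma> \<in> borel_measurable borel"
  unfolding stieltjes_square_def[abs_def] by measurable

lemma stieltjes_square_nonneg: "stieltjes_square \<gamma> t \<ge> 0"
  by (simp add: stieltjes_square_eq L_nonneg R_nonneg)

lemma stieltjes_square_ge:
  assumes "0 \<le> s" "s < t"
  shows "(\<gamma> s)\<^sup>2 \<le> stieltjes_square \<gamma> t"
  unfolding stieltjes_square_eq power2_eq_square
  using le_L[of s t] le_R[of t] gamma_mono[of s t] nonneg[of s] assms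
  by (intro mult_mono) (auto simp: L_nonneg)

text \<open>This is \<open>d\<gamma> / \<gamma>\<^sup>2 = d(- 1 / \<gamma>)\<close>, jumps included. For a partition of \<open>(a, b]\<close> with points \<open>p i\<close>
  the increments \<open>1 / R (p i) - 1 / R (p (i + 1))\<close> telescope, and each of them is the integral of the
  constant \<open>1 / (R (p i) * R (p (i + 1)))\<close> over \<open>(p i, p (i + 1)]\<close>. As the mesh tends to \<open>0\<close>, the
  resulting step functions \<open>F n\<close> converge to \<open>1 / (L * R)\<close>, since the left ends approach a point \<open>t\<close>
  strictly from below and the right ends approach it from \<open>t\<close> on.\<close>
lemma integral_inverse_stieltjes_square:
  assumes a: "0 < a" and ab: "a < b"
  shows "(\<integral>\<^sup>+t\<in>{a<..b}. ennreal (1 / stieltjes_square \<gamma> t) \<partial>dgamma) = ennreal (1 / R a - 1 / R b)"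
proof -
  define h where "h n = (b - a) / real (Suc n)" for n
  define p where "p n i = a + real i * h n" for n i
  have h: "h n > 0" for n using ab by (simp add: h_def)
  have p_mono: "i \<le> j \<Longrightarrow> p n i \<le> p n j" for i j n
    using h[of n] by (simp add: p_def mult_right_mono)
  have p0: "p n 0 = a" and p1: "p n (Suc n) = b" for n
    by (simp_all add: p_def h_def)
  have p_pos: "p n i > 0" for n i
    using a h[of n] by (simp add: p_def add_pos_nonneg)
  have Ra: "R a > 0" using a by (rule R_pos)
  define c where "c n i = 1 / (R (p n i) * R (p n (Suc i)))" for n i
  define F where "F n t = (\<Sum>i<Suc n. indicator {p n i<..p n (Suc i)} t * c n i)" for n t
  have F_eq: "\<exists>i. t - h n \<le> p n i \<and> p n i < t \<and> t \<le> p n (Suc i) \<and> p n (Suc i) < t + h n \<and> F n t = c n i"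
    if t: "t \<in> {a<..b}" for n t
  proof -
    define k where "k = nat (\<lceil>(t - a) / h n\<rceil> - 1)"
    have "0 < (t - a) / h n" using t h[of n] by simp
    then have k: "of_int \<lceil>(t - a) / h n\<rceil> = real (Suc k)"
      unfolding k_def by linarith
    have "(t - a) / h n \<le> (b - a) / h n" using t h[of n] by (intro divide_right_mono) auto
    also have "\<dots> = real (Suc n)" using ab by (simp add: h_def)
    finally have "\<lceil>(t - a) / h n\<rceil> \<le> int (Suc n)" by (simp add: ceiling_le_iff)
    then have kn: "k < Suc n" unfolding k_def by linarith
    have "(t - a) / h n \<le> real (Suc k)" "real k < (t - a) / h n"
      using ceiling_correct[of "(t - a) / h n"] unfolding k by auto
    then have k1: "t \<le> p n (Suc k)" "p n k < t"
      using h[of n] by (auto simp: p_def field_simps)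
    have ind: "indicator {p n i<..p n (Suc i)} t = (if i = k then 1 else 0 :: real)" for i
    proof (cases i k rule: linorder_cases)
      case less
      then have "p n (Suc i) \<le> p n k" by (intro p_mono) auto
      with less k1 show ?thesis by (auto simp: indicator_def)
    next
      case greater
      then have "p n (Suc k) \<le> p n i" by (intro p_mono) auto
      with greater k1 show ?thesis by (auto simp: indicator_def)
    qed (use k1 in \<open>auto simp: indicator_def\<close>)
    have "F n t = (\<Sum>i<Suc n. if i = k then c n i else 0)"
      unfolding F_def ind by (intro sum.cong) auto
    also have "\<dots> = c n k" using kn by simp
    finally have "F n t = c n k" .
    moreover have "p n (Suc k) = p n k + h n" by (simp add: p_def algebra_simps)
    ultimately show ?thesis using k1 by (intro exI[of _ k]) auto
  qed
  have F_zero: "F n t = 0" if "t \<notin> {a<..b}" for n t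
  proof -
    have "indicator {p n i<..p n (Suc i)} t = (0::real)" if "i < Suc n" for i
      using p_mono[of 0 i n] p_mono[of "Suc i" "Suc n" n] \<open>t \<notin> {a<..b}\<close> that p0 p1
      by (auto simp: indicator_def)
    then show ?thesis unfolding F_def by (intro sum.neutral) auto
  qed
  have c_le: "c n i \<le> 1 / (R a * R a)" and c_nonneg: "0 \<le> c n i" for n i
  proof -
    have le: "R a \<le> R (p n j)" for j using p_mono[of 0 j n] p0 by (intro R_mono) auto
    then show "c n i \<le> 1 / (R a * R a)"
      unfolding c_def using Ra le by (intro frac_le mult_mono) (auto simp: R_nonneg)
  qed (simp add: c_def R_nonneg)
  have fin: "emeasure dgamma {x<..y} < \<infinity>" for x y
    by (cases "x \<le> y") (auto simp: emeasure_dgamma)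
  have int_ind: "integrable dgamma (\<lambda>t. indicator {x<..y} t * u)" for x y u :: real
    using fin[of x y] by (intro integrable_mult_left) (simp add: integrable_indicator_iff)
  have meas: "measure dgamma {p n i<..p n (Suc i)} = R (p n (Suc i)) - R (p n i)" for n i
    using p_mono[of i "Suc i" n] by (simp add: measure_def emeasure_dgamma R_mono)
  have F_int: "(\<integral>t. F n t \<partial>dgamma) = 1 / R a - 1 / R b" for n
  proof -
    have "(\<integral>t. F n t \<partial>dgamma) = (\<Sum>i<Suc n. (\<integral>t. indicator {p n i<..p n (Suc i)} t * c n i \<partial>dgamma))"
      unfolding F_def by (intro Bochner_Integration.integral_sum int_ind)
    also have "\<dots> = (\<Sum>i<Suc n. 1 / R (p n i) - 1 / R (p n (Suc i)))"
    proof (intro sum.cong refl)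
      fix i
      have inv: "(v - u) * (1 / (u * v)) = 1 / u - 1 / v" if "u > 0" "v > 0" for u v :: real
        using that by (simp add: field_simps)
      have "(\<integral>t. indicator {p n i<..p n (Suc i)} t * c n i \<partial>dgamma) = (R (p n (Suc i)) - R (p n i)) * c n i"
        by (simp add: meas)
      also have "\<dots> = 1 / R (p n i) - 1 / R (p n (Suc i))"
        unfolding c_def by (intro inv R_pos p_pos)
      finally show "(\<integral>t. indicator {p n i<..p n (Suc i)} t * c n i \<partial>dgamma) = 1 / R (p n i) - 1 / R (p n (Suc i))" .
    qed
    also have "\<dots> = 1 / R a - 1 / R b"
      using sum_lessThan_telescope'[of "\<lambda>i. 1 / R (p n i)" "Suc n"] by (simp only: p0 p1)
    finally show ?thesis .
  qed
  have h_lim: "h \<longlonglongrightarrow> 0"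
    unfolding h_def by (intro LIMSEQ_Suc[OF lim_const_over_n])
  let ?G = "\<lambda>t. indicator {a<..b} t * (1 / stieltjes_square \<gamma> t)"
  have lim: "(\<lambda>n. F n t) \<longlonglongrightarrow> ?G t" for t
  proof (cases "t \<in> {a<..b}")
    case True
    then have "t > 0" using a by auto
    obtain i where i: "\<And>n. t - h n \<le> p n (i n)" "\<And>n. p n (i n) < t" "\<And>n. t \<le> p n (Suc (i n))"
        "\<And>n. p n (Suc (i n)) < t + h n" "\<And>n. F n t = c n (i n)"
      using F_eq[OF True] by metis
    have lt: "filterlim (\<lambda>n. t - h n) (at_left t) sequentially"
      unfolding filterlim_at using h tendsto_diff[OF tendsto_const[of t] h_lim] by (auto simp: less_le)
    have rt: "filterlim (\<lambda>n. t + h n) (at_right t) sequentially"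
      unfolding filterlim_at using h tendsto_add[OF tendsto_const[of t] h_lim] by (auto simp: less_le)
    have "(\<lambda>n. R (p n (i n))) \<longlonglongrightarrow> L t"
      using i by (intro tendsto_sandwich[OF _ _ filterlim_compose[OF R_tendsto_L lt] tendsto_const])
        (auto intro!: always_eventually R_mono R_le_L)
    moreover have "(R \<longlongrightarrow> R t) (at_right t)"
      using R_right_continuous by (simp add: continuous_within)
    then have "(\<lambda>n. R (p n (Suc (i n)))) \<longlonglongrightarrow> R t"
      using i by (intro tendsto_sandwich[OF _ _ tendsto_const filterlim_compose[OF _ rt]])
        (auto intro!: always_eventually R_mono less_imp_le[OF i(4)])
    ultimately have "(\<lambda>n. c n (i n)) \<longlonglongrightarrow> 1 / (L t * R t)"
      unfolding c_def using R_pos[OF \<open>t > 0\<close>] L_pos[OF \<open>t > 0\<close>] by (intro tendsto_intros) auto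
    with True show ?thesis by (simp add: i stieltjes_square_eq)
  next
    case False
    then show ?thesis by (simp add: F_zero)
  qed
  have bound: "norm (F n t) \<le> indicator {a<..b} t * (1 / (R a * R a))" for n t
  proof (cases "t \<in> {a<..b}")
    case True
    then obtain i where "F n t = c n i" using F_eq by blast
    with True show ?thesis using c_le c_nonneg by simp
  qed (simp add: F_zero)
  have F_meas: "F n \<in> borel_measurable dgamma" for n
    unfolding F_def by measurable
  have "(\<lambda>n. \<integral>t. F n t \<partial>dgamma) \<longlonglongrightarrow> (\<integral>t. ?G t \<partial>dgamma)"
    by (rule integral_dominated_convergence[OF _ F_meas int_ind AE_I2[OF lim] AE_I2[OF bound]]) measurable
  then have "(\<integral>t. ?G t \<partial>dgamma) = 1 / R a - 1 / R b"
    unfolding F_int by (simp add: LIMSEQ_const_iff)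
  moreover have "integrable dgamma ?G"
    by (rule integrable_dominated_convergence[OF _ F_meas int_ind AE_I2[OF lim] AE_I2[OF bound]]) measurable
  ultimately have "(\<integral>\<^sup>+t. ennreal (?G t) \<partial>dgamma) = ennreal (1 / R a - 1 / R b)"
    by (subst nn_integral_eq_integral) (auto simp: stieltjes_square_nonneg)
  moreover have "ennreal (1 / stieltjes_square \<gamma> t) * indicator {a<..b} t = ennreal (?G t)" for t
    by (auto simp: indicator_def)
  ultimately show ?thesis by simp
qed

lemma integral_inverse_stieltjes_square_le:
  assumes "0 < a"
  shows "(\<integral>\<^sup>+t\<in>{a<..b}. ennreal (1 / stieltjes_square \<gamma> t) \<partial>dgamma) \<le> ennreal (1 / \<gamma> a)"
proof (cases "a < b")
  case True
  have "1 / R a \<le> 1 / \<gamma> a"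
    using le_R[of a] pos[OF assms] assms by (intro divide_left_mono) (auto intro: R_pos)
  then have "1 / R a - 1 / R b \<le> 1 / \<gamma> a"
    using R_nonneg[of b] by (simp add: diff_le_eq add_increasing2)
  then show ?thesis
    unfolding integral_inverse_stieltjes_square[OF assms True] by (rule ennreal_leI)
qed simp

lemma inverse_gamma_le_integral:
  assumes "0 < a" "a < b" "a < c"
  shows "ennreal (1 / \<gamma> c) \<le> ennreal (1 / \<gamma> b) + (\<integral>\<^sup>+t\<in>{a<..b}. ennreal (1 / stieltjes_square \<gamma> t) \<partial>dgamma)"
proof -
  have "1 / \<gamma> c \<le> 1 / R a"
    using R_le[of a c] pos[of c] assms by (intro divide_left_mono) (auto intro!: mult_pos_pos R_pos)
  moreover have "1 / R b \<le> 1 / \<gamma> b"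
    using le_R[of b] pos[of b] assms by (intro divide_left_mono) (auto intro: R_pos)
  moreover have "1 / R b \<le> 1 / R a"
    using assms by (intro divide_left_mono R_mono mult_pos_pos R_pos) auto
  ultimately have "1 / \<gamma> c \<le> 1 / \<gamma> b + (1 / R a - 1 / R b)" "0 \<le> 1 / R a - 1 / R b"
    by linarith+
  then have "ennreal (1 / \<gamma> c) \<le> ennreal (1 / \<gamma> b) + ennreal (1 / R a - 1 / R b)"
    using ennreal_leI assms nonneg[of b] by (metis ennreal_plus divide_nonneg_nonneg less_imp_le less_trans zero_le_one)
  then show ?thesis
    unfolding integral_inverse_stieltjes_square[OF assms(1,2)] .
qed

end

section \<open>Bounds for the Julia quotient\<close>

lemma sets_borel_ball [measurable]: "ball (x::real) r \<in> sets borel"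
  by simp

lemma nn_integral_poisson_kernel:
  assumes y: "y > 0"
  shows "(\<integral>\<^sup>+x. ennreal (1 / (pi * ((t - x)\<^sup>2 + y\<^sup>2))) \<partial>lborel) = ennreal (1 / y)"
proof -
  have "(\<integral>\<^sup>+x. ennreal (1 / (pi * ((t - x)\<^sup>2 + y\<^sup>2))) \<partial>lborel)
      = \<bar>y\<bar> * (\<integral>\<^sup>+s. ennreal (1 / (pi * ((t - (t + y * s))\<^sup>2 + y\<^sup>2))) \<partial>lborel)"
    using y by (intro nn_integral_real_affine) auto
  also have "\<dots> = (\<integral>\<^sup>+s. ennreal y * ennreal (1 / (pi * ((t - (t + y * s))\<^sup>2 + y\<^sup>2))) \<partial>lborel)"
    using y by (subst nn_integral_cmult) auto
  also have "\<dots> = (\<integral>\<^sup>+s. ennreal (1 / (pi * y) * (1 / (1 + s\<^sup>2))) \<partial>lborel)"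
  proof (intro nn_integral_cong)
    fix s
    have "pi * ((t - (t + y * s))\<^sup>2 + y\<^sup>2) = y * (pi * y * (1 + s\<^sup>2))"
      by (simp add: power2_eq_square algebra_simps)
    then have "y * (1 / (pi * ((t - (t + y * s))\<^sup>2 + y\<^sup>2))) = 1 / (pi * y) * (1 / (1 + s\<^sup>2))"
      using y by simp
    then show "ennreal y * ennreal (1 / (pi * ((t - (t + y * s))\<^sup>2 + y\<^sup>2))) = ennreal (1 / (pi * y) * (1 / (1 + s\<^sup>2)))"
      using y by (simp only: ennreal_mult'[symmetric] less_imp_le)
  qed
  also have "\<dots> = ennreal (\<integral>s. 1 / (pi * y) * (1 / (1 + s\<^sup>2)) \<partial>lborel)"
    using y by (intro nn_integral_eq_integral integrable_mult_right integrable_inverse_1_plus_sq AE_I2) auto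
  also have "(\<integral>s. 1 / (pi * y) * (1 / (1 + s\<^sup>2)) \<partial>lborel) = 1 / y"
    by (simp only: integral_mult_right_zero integral_inverse_1_plus_sq) simp
  finally show ?thesis .
qed

text \<open>Points outside of \<open>ball \<tau> (2 * d)\<close> are at least half as far from \<open>x\<close> as from \<open>\<tau>\<close>.\<close>
lemma kernel_split:
  assumes y: "y > 0" and x: "\<bar>x - \<tau>\<bar> \<le> d" and t: "t \<noteq> \<tau>"
  shows "1 / (pi * ((t - x)\<^sup>2 + y\<^sup>2)) \<le> indicator (ball \<tau> (2 * d)) t * (1 / (pi * ((t - x)\<^sup>2 + y\<^sup>2))) + 4 * (1 / (t - \<tau>)\<^sup>2)"
proof (cases "t \<in> ball \<tau> (2 * d)")
  case False
  then have "2 * d \<le> \<bar>t - \<tau>\<bar>" by (simp add: dist_real_def abs_minus_commute)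
  then have "\<bar>t - \<tau>\<bar> / 2 \<le> \<bar>t - x\<bar>" using x by (auto simp: abs_if split: if_splits)
  from power_mono[OF this, of 2] have "(t - \<tau>)\<^sup>2 / 4 \<le> (t - x)\<^sup>2" by (simp add: power_divide)
  then have "(t - \<tau>)\<^sup>2 / 4 \<le> 1 * ((t - x)\<^sup>2 + y\<^sup>2)" by (simp add: add_increasing2)
  also have "\<dots> \<le> pi * ((t - x)\<^sup>2 + y\<^sup>2)" using pi_gt3 by (intro mult_right_mono) auto
  finally have "1 / (pi * ((t - x)\<^sup>2 + y\<^sup>2)) \<le> 1 / ((t - \<tau>)\<^sup>2 / 4)"
    using t y by (intro divide_left_mono) (auto intro!: mult_pos_pos add_nonneg_pos)
  with False show ?thesis by simp
qed simp

context nevanlinna_data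
begin

lemma julia_antimono:
  assumes "0 < y" "y \<le> y'"
  shows "julia_quotient f (Complex x y') \<le> julia_quotient f (Complex x y)"
proof -
  have "(\<integral>\<^sup>+t. ennreal (1 / (pi * ((t - x)\<^sup>2 + y'\<^sup>2))) \<partial>\<mu>) \<le> (\<integral>\<^sup>+t. ennreal (1 / (pi * ((t - x)\<^sup>2 + y\<^sup>2))) \<partial>\<mu>)"
    using assms by (intro nn_integral_mono ennreal_leI divide_left_mono mult_left_mono add_left_mono power_mono)
      (auto intro!: mult_pos_pos add_nonneg_pos)
  then have "ennreal (julia_quotient f (Complex x y')) \<le> ennreal (julia_quotient f (Complex x y))"
    using assms by (simp add: ennreal_julia add_left_mono)
  then show ?thesis
    using julia_nonneg[of y x] assms by (simp add: ennreal_le_iff)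
qed

lemma continuous_julia: "y > 0 \<Longrightarrow> continuous_on UNIV (\<lambda>x. julia_quotient f (Complex x y))"
  using continuous_im[of y] by (auto simp: julia_quotient_def intro!: continuous_intros)

lemma ennreal_amortized_julia:
  assumes "d > 0" "l d > 0"
  shows "ennreal (2 * d * amortized_julia f l \<tau> d)
    = (\<integral>\<^sup>+x\<in>{\<tau>-d..\<tau>+d}. ennreal (julia_quotient f (Complex x (l d))) \<partial>lborel)"
    and amortized_julia_nonneg: "amortized_julia f l \<tau> d \<ge> 0"
proof -
  let ?J = "\<lambda>x. julia_quotient f (Complex x (l d))"
  have int: "set_integrable lborel {\<tau>-d..\<tau>+d} ?J"
    by (intro borel_integrable_atLeastAtMost' continuous_on_subset[OF continuous_julia[OF assms(2)]]) simp
  have eq: "2 * d * amortized_julia f l \<tau> d = (LINT x:{\<tau>-d..\<tau>+d}|lborel. ?J x)"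
    using set_borel_integral_eq_integral(2)[OF int] assms by (simp add: amortized_julia_def)
  have nn: "0 \<le> indicator {\<tau>-d..\<tau>+d} x *\<^sub>R ?J x" for x
    using julia_nonneg[OF assms(2)] by (simp add: indicator_def)
  have "ennreal (2 * d * amortized_julia f l \<tau> d) = (\<integral>\<^sup>+x. ennreal (indicator {\<tau>-d..\<tau>+d} x *\<^sub>R ?J x) \<partial>lborel)"
    unfolding eq set_lebesgue_integral_def using int nn
    by (intro nn_integral_eq_integral[symmetric]) (auto simp: set_integrable_def)
  also have "\<dots> = (\<integral>\<^sup>+x\<in>{\<tau>-d..\<tau>+d}. ennreal (?J x) \<partial>lborel)"
    by (intro nn_integral_cong) (auto simp: indicator_def)
  finally show "ennreal (2 * d * amortized_julia f l \<tau> d)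
    = (\<integral>\<^sup>+x\<in>{\<tau>-d..\<tau>+d}. ennreal (?J x) \<partial>lborel)" .
  have "0 \<le> 2 * d * amortized_julia f l \<tau> d"
    unfolding eq set_lebesgue_integral_def using nn by (intro integral_nonneg_AE) auto
  then show "amortized_julia f l \<tau> d \<ge> 0"
    using assms by (simp add: zero_le_mult_iff)
qed

lemma amortized_julia_le:
  assumes d: "d > 0" and l: "l d > 0"
    and B: "\<And>x. \<bar>x - \<tau>\<bar> \<le> d \<Longrightarrow> x \<noteq> \<tau> \<Longrightarrow> julia_quotient f (Complex x (l d)) \<le> B"
  shows "amortized_julia f l \<tau> d \<le> B"
proof -
  have "B \<ge> 0"
    using B[of "\<tau> + d"] julia_nonneg[OF l, of "\<tau> + d"] d by auto
  have "ennreal (2 * d * amortized_julia f l \<tau> d) \<le> (\<integral>\<^sup>+x. ennreal B * indicator {\<tau>-d..\<tau>+d} x \<partial>lborel)"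
    unfolding ennreal_amortized_julia(1)[where l = l, OF d l]
  proof (intro nn_integral_mono_AE)
    show "AE x in lborel. ennreal (julia_quotient f (Complex x (l d))) * indicator {\<tau>-d..\<tau>+d} x \<le> ennreal B * indicator {\<tau>-d..\<tau>+d} x"
      using AE_lborel_singleton[of \<tau>]
      by eventually_elim (auto simp: indicator_def intro!: ennreal_leI B)
  qed
  also have "\<dots> = ennreal (2 * d * B)"
    using d \<open>B \<ge> 0\<close> by (simp add: nn_integral_cmult_indicator ennreal_mult'[symmetric] mult.commute)
  finally show ?thesis
    using d \<open>B \<ge> 0\<close> by (simp add: ennreal_le_iff)
qed

lemma emeasure_ball: "emeasure \<mu> (ball \<tau> d) < \<infinity>"
  using emeasure_mono[of "ball \<tau> d" "cball \<tau> d" \<mu>] emeasure_compact[of "cball \<tau> d"]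
  by (auto simp: ball_subset_cball)

lemma emeasure_ball_eq: "emeasure \<mu> (ball \<tau> d) = ennreal (measure \<mu> (ball \<tau> d))"
  using emeasure_ball[of \<tau> d] by (simp add: emeasure_eq_ennreal_measure)

text \<open>If \<open>t\<close> has distance less than \<open>d\<close> from \<open>\<tau>\<close> and \<open>l d \<le> d\<close>, then \<open>[\<tau> - d, \<tau> + d]\<close> contains an interval
  of length \<open>l d\<close> that has \<open>t\<close> as an endpoint, and on it the kernel at height \<open>l d\<close> is at least
  \<open>1 / (2 * pi * (l d)\<^sup>2)\<close>.\<close>
lemma ball_mass_le_amortized_julia:
  assumes d: "d > 0" and l: "0 < l d" "l d \<le> d" and B: "amortized_julia f l \<tau> d \<le> B"
  shows "measure \<mu> (ball \<tau> d) \<le> 4 * pi * B * d * l d"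
proof -
  let ?y = "l d"
  have "ennreal (measure \<mu> (ball \<tau> d) * (1 / (2 * pi * ?y))) = (\<integral>\<^sup>+t. ennreal (1 / (2 * pi * ?y)) * indicator (ball \<tau> d) t \<partial>\<mu>)"
    using l by (subst nn_integral_cmult_indicator) (auto simp: emeasure_ball_eq ennreal_mult'[symmetric] mult.commute)
  also have "\<dots> \<le> (\<integral>\<^sup>+t. (\<integral>\<^sup>+x. ennreal (1 / (pi * ((t - x)\<^sup>2 + ?y\<^sup>2))) * indicator {\<tau>-d..\<tau>+d} x \<partial>lborel) \<partial>\<mu>)"
  proof (intro nn_integral_mono)
    fix t
    show "ennreal (1 / (2 * pi * ?y)) * indicator (ball \<tau> d) t
      \<le> (\<integral>\<^sup>+x. ennreal (1 / (pi * ((t - x)\<^sup>2 + ?y\<^sup>2))) * indicator {\<tau>-d..\<tau>+d} x \<partial>lborel)"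
    proof (cases "t \<in> ball \<tau> d")
      case True
      then have t: "\<bar>t - \<tau>\<bar> < d" by (simp add: dist_real_def abs_minus_commute)
      define a where "a = (if t \<le> \<tau> then t else t - ?y)"
      have a: "{a..a + ?y} \<subseteq> {\<tau>-d..\<tau>+d}" "{a..a + ?y} \<subseteq> {t - ?y..t + ?y}"
        using t l by (auto simp: a_def)
      have "1 / (2 * pi * ?y) = 1 / (pi * (?y\<^sup>2 + ?y\<^sup>2)) * ?y"
        using l by (simp add: power2_eq_square)
      then have "ennreal (1 / (2 * pi * ?y)) = ennreal (1 / (pi * (?y\<^sup>2 + ?y\<^sup>2))) * ennreal ?y"
        using l by (subst ennreal_mult[symmetric]) auto
      also have "\<dots> = (\<integral>\<^sup>+x. ennreal (1 / (pi * (?y\<^sup>2 + ?y\<^sup>2))) * indicator {a..a + ?y} x \<partial>lborel)"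
        using l by (subst nn_integral_cmult_indicator) auto
      also have "\<dots> \<le> (\<integral>\<^sup>+x. ennreal (1 / (pi * ((t - x)\<^sup>2 + ?y\<^sup>2))) * indicator {\<tau>-d..\<tau>+d} x \<partial>lborel)"
      proof (intro nn_integral_mono)
        fix x
        show "ennreal (1 / (pi * (?y\<^sup>2 + ?y\<^sup>2))) * indicator {a..a + ?y} x
          \<le> ennreal (1 / (pi * ((t - x)\<^sup>2 + ?y\<^sup>2))) * indicator {\<tau>-d..\<tau>+d} x"
        proof (cases "x \<in> {a..a + ?y}")
          case x: True
          then have "\<bar>t - x\<bar> \<le> ?y" using a(2) by (auto simp: abs_le_iff)
          from power_mono[OF this, of 2] have "(t - x)\<^sup>2 \<le> ?y\<^sup>2" by simp
          then have "1 / (pi * (?y\<^sup>2 + ?y\<^sup>2)) \<le> 1 / (pi * ((t - x)\<^sup>2 + ?y\<^sup>2))"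
            using l by (intro divide_left_mono mult_left_mono) (auto intro!: mult_pos_pos add_nonneg_pos)
          with x a(1) show ?thesis by (auto simp: indicator_def intro!: ennreal_leI)
        qed simp
      qed
      finally show ?thesis using True by simp
    qed simp
  qed
  also have "\<dots> = (\<integral>\<^sup>+x. (\<integral>\<^sup>+t. ennreal (1 / (pi * ((t - x)\<^sup>2 + ?y\<^sup>2))) * indicator {\<tau>-d..\<tau>+d} x \<partial>\<mu>) \<partial>lborel)"
    using pair_sigma_finite.Fubini'[of lborel \<mu> "\<lambda>x t. ennreal (1 / (pi * ((t - x)\<^sup>2 + ?y\<^sup>2))) * indicator {\<tau>-d..\<tau>+d} x"]
    by (simp add: pair_sigma_finite_def sigma_finite_lborel mu.sigma_finite_measure_axioms)
  also have "\<dots> \<le> (\<integral>\<^sup>+x\<in>{\<tau>-d..\<tau>+d}. ennreal (julia_quotient f (Complex x ?y)) \<partial>lborel)"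
    using l by (intro nn_integral_mono) (auto simp: ennreal_julia nn_integral_multc mult_right_mono)
  also have "\<dots> = ennreal (2 * d * amortized_julia f l \<tau> d)"
    by (rule ennreal_amortized_julia(1)[where l = l, OF d l(1), symmetric])
  finally have "measure \<mu> (ball \<tau> d) * (1 / (2 * pi * ?y)) \<le> 2 * d * amortized_julia f l \<tau> d"
    using d amortized_julia_nonneg[where l = l, OF d l(1)] by (simp add: ennreal_le_iff)
  also have "\<dots> \<le> 2 * d * B"
    using d B by simp
  finally show ?thesis using l by (simp add: field_simps)
qed

lemma julia_le:
  assumes null: "emeasure \<mu> {\<tau>} = 0" and q: "q \<ge> 0" "(\<integral>\<^sup>+t. ennreal (1 / (t - \<tau>)\<^sup>2) \<partial>\<mu>) \<le> ennreal q"
    and y: "y > 0" and x: "\<bar>x - \<tau>\<bar> \<le> d"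
  shows "julia_quotient f (Complex x y) \<le> b + measure \<mu> (ball \<tau> (2 * d)) / y\<^sup>2 + 4 * q"
proof -
  have AE: "AE t in \<mu>. t \<noteq> \<tau>"
    using null by (intro AE_I[of _ _ "{\<tau>}"]) auto
  have "(\<integral>\<^sup>+t. ennreal (1 / (pi * ((t - x)\<^sup>2 + y\<^sup>2))) \<partial>\<mu>)
    \<le> (\<integral>\<^sup>+t. ennreal (1 / y\<^sup>2) * indicator (ball \<tau> (2 * d)) t + ennreal 4 * ennreal (1 / (t - \<tau>)\<^sup>2) \<partial>\<mu>)"
  proof (rule nn_integral_mono_AE)
    show "AE t in \<mu>. ennreal (1 / (pi * ((t - x)\<^sup>2 + y\<^sup>2))) \<le> ennreal (1 / y\<^sup>2) * indicator (ball \<tau> (2 * d)) t + ennreal 4 * ennreal (1 / (t - \<tau>)\<^sup>2)"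
      using AE
    proof eventually_elim
      case (elim t)
      have "1 * y\<^sup>2 \<le> pi * ((t - x)\<^sup>2 + y\<^sup>2)"
        using pi_gt3 by (intro mult_mono) auto
      then have "1 / (pi * ((t - x)\<^sup>2 + y\<^sup>2)) \<le> 1 / y\<^sup>2"
        using y by (intro divide_left_mono) (auto intro!: mult_pos_pos add_nonneg_pos)
      then have "1 / (pi * ((t - x)\<^sup>2 + y\<^sup>2)) \<le> 1 / y\<^sup>2 * indicator (ball \<tau> (2 * d)) t + 4 * (1 / (t - \<tau>)\<^sup>2)"
      proof (cases "t \<in> ball \<tau> (2 * d)")
        case True
        have "0 \<le> 4 * (1 / (t - \<tau>)\<^sup>2)" by simp
        with \<open>1 / (pi * ((t - x)\<^sup>2 + y\<^sup>2)) \<le> 1 / y\<^sup>2\<close> show ?thesis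
          unfolding indicator_simps(1)[OF True] by linarith
      next
        case False
        from kernel_split[OF y x elim] show ?thesis
          unfolding indicator_simps(2)[OF False] by linarith
      qed
      then have "ennreal (1 / (pi * ((t - x)\<^sup>2 + y\<^sup>2))) \<le> ennreal (1 / y\<^sup>2 * indicator (ball \<tau> (2 * d)) t + 4 * (1 / (t - \<tau>)\<^sup>2))"
        by (rule ennreal_leI)
      also have "\<dots> = ennreal (1 / y\<^sup>2) * indicator (ball \<tau> (2 * d)) t + ennreal 4 * ennreal (1 / (t - \<tau>)\<^sup>2)"
        by (cases "t \<in> ball \<tau> (2 * d)")
          (simp_all only: indicator_simps mult_1_right mult_zero_right add_0 ennreal_mult' ennreal_plus
            zero_le_divide_1_iff zero_le_mult_iff zero_le_power2 zero_le_numeral simp_thms)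
      finally show ?case .
    qed
  qed
  also have "\<dots> = ennreal (1 / y\<^sup>2) * emeasure \<mu> (ball \<tau> (2 * d)) + ennreal 4 * (\<integral>\<^sup>+t. ennreal (1 / (t - \<tau>)\<^sup>2) \<partial>\<mu>)"
    by (subst nn_integral_add) (auto simp: nn_integral_cmult nn_integral_cmult_indicator)
  also have "\<dots> \<le> ennreal (1 / y\<^sup>2) * emeasure \<mu> (ball \<tau> (2 * d)) + ennreal 4 * ennreal q"
    by (intro add_left_mono mult_left_mono q) simp
  also have "\<dots> = ennreal (measure \<mu> (ball \<tau> (2 * d)) / y\<^sup>2 + 4 * q)"
    using q(1) by (simp add: emeasure_ball_eq ennreal_mult'[symmetric] ennreal_plus[symmetric] del: ennreal_plus ennreal_numeral)
  finally have "ennreal (julia_quotient f (Complex x y)) \<le> ennreal b + ennreal (measure \<mu> (ball \<tau> (2 * d)) / y\<^sup>2 + 4 * q)"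
    unfolding ennreal_julia[OF y] by (rule add_left_mono)
  also have "\<dots> = ennreal (b + (measure \<mu> (ball \<tau> (2 * d)) / y\<^sup>2 + 4 * q))"
    using b_nonneg q(1) by (intro ennreal_plus[symmetric]) auto
  finally show ?thesis
    using b_nonneg q(1) by (subst (asm) ennreal_le_iff) auto
qed

lemma amortized_julia_le_ball_mass:
  assumes null: "emeasure \<mu> {\<tau>} = 0" and q: "q \<ge> 0" "(\<integral>\<^sup>+t. ennreal (1 / (t - \<tau>)\<^sup>2) \<partial>\<mu>) \<le> ennreal q"
    and d: "d > 0" and l: "l d > 0"
  shows "amortized_julia f l \<tau> d \<le> b + measure \<mu> (ball \<tau> (2 * d)) / (2 * d * l d) + 4 * q"
proof -
  let ?y = "l d" and ?I = "{\<tau>-d..\<tau>+d}" and ?m = "measure \<mu> (ball \<tau> (2 * d))"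
  let ?k = "\<lambda>x t. ennreal (1 / (pi * ((t - x)\<^sup>2 + ?y\<^sup>2)))"
  have AE: "AE t in \<mu>. t \<noteq> \<tau>"
    using null by (intro AE_I[of _ _ "{\<tau>}"]) auto
  have pw: "(\<integral>\<^sup>+t. ?k x t \<partial>\<mu>) \<le> (\<integral>\<^sup>+t. indicator (ball \<tau> (2 * d)) t * ?k x t \<partial>\<mu>) + ennreal (4 * q)"
    if x: "x \<in> ?I" for x
  proof -
    have x: "\<bar>x - \<tau>\<bar> \<le> d" using x by (auto simp: abs_le_iff)
    have "(\<integral>\<^sup>+t. ?k x t \<partial>\<mu>) \<le> (\<integral>\<^sup>+t. indicator (ball \<tau> (2 * d)) t * ?k x t + ennreal 4 * ennreal (1 / (t - \<tau>)\<^sup>2) \<partial>\<mu>)"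
    proof (rule nn_integral_mono_AE)
      show "AE t in \<mu>. ?k x t \<le> indicator (ball \<tau> (2 * d)) t * ?k x t + ennreal 4 * ennreal (1 / (t - \<tau>)\<^sup>2)"
        using AE
      proof eventually_elim
        case (elim t)
        have "?k x t \<le> ennreal (indicator (ball \<tau> (2 * d)) t * (1 / (pi * ((t - x)\<^sup>2 + ?y\<^sup>2))) + 4 * (1 / (t - \<tau>)\<^sup>2))"
          by (rule ennreal_leI[OF kernel_split[OF l x elim]])
        also have "\<dots> = indicator (ball \<tau> (2 * d)) t * ?k x t + ennreal 4 * ennreal (1 / (t - \<tau>)\<^sup>2)"
          by (cases "t \<in> ball \<tau> (2 * d)")
            (simp_all only: indicator_simps mult_1 mult_zero_left add_0 ennreal_mult' ennreal_plus
              zero_le_divide_1_iff zero_le_mult_iff zero_le_power2 sum_power2_ge_zero pi_ge_zero zero_le_numeral simp_thms)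
        finally show ?case .
      qed
    qed
    also have "\<dots> = (\<integral>\<^sup>+t. indicator (ball \<tau> (2 * d)) t * ?k x t \<partial>\<mu>) + ennreal 4 * (\<integral>\<^sup>+t. ennreal (1 / (t - \<tau>)\<^sup>2) \<partial>\<mu>)"
      by (subst nn_integral_add) (auto simp: nn_integral_cmult)
    also have "\<dots> \<le> (\<integral>\<^sup>+t. indicator (ball \<tau> (2 * d)) t * ?k x t \<partial>\<mu>) + ennreal 4 * ennreal q"
      by (intro add_left_mono mult_left_mono q) simp
    finally show ?thesis using q by (simp add: ennreal_mult' del: ennreal_numeral)
  qed
  have "ennreal (2 * d * amortized_julia f l \<tau> d) = (\<integral>\<^sup>+x\<in>?I. ennreal (julia_quotient f (Complex x ?y)) \<partial>lborel)"
    by (rule ennreal_amortized_julia(1)[where l = l, OF d l])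
  also have "\<dots> \<le> (\<integral>\<^sup>+x. ennreal (b + 4 * q) * indicator ?I x + (\<integral>\<^sup>+t. indicator (ball \<tau> (2 * d)) t * ?k x t \<partial>\<mu>) \<partial>lborel)"
  proof (intro nn_integral_mono)
    fix x
    show "ennreal (julia_quotient f (Complex x ?y)) * indicator ?I x
      \<le> ennreal (b + 4 * q) * indicator ?I x + (\<integral>\<^sup>+t. indicator (ball \<tau> (2 * d)) t * ?k x t \<partial>\<mu>)"
    proof (cases "x \<in> ?I")
      case True
      have "ennreal (julia_quotient f (Complex x ?y)) \<le> ennreal b + ((\<integral>\<^sup>+t. indicator (ball \<tau> (2 * d)) t * ?k x t \<partial>\<mu>) + ennreal (4 * q))"
        unfolding ennreal_julia[OF l] by (intro add_left_mono pw True)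
      also have "\<dots> = ennreal (b + 4 * q) + (\<integral>\<^sup>+t. indicator (ball \<tau> (2 * d)) t * ?k x t \<partial>\<mu>)"
        using b_nonneg q by (simp add: ennreal_plus add_ac)
      finally show ?thesis using True by simp
    qed simp
  qed
  also have "\<dots> = ennreal (b + 4 * q) * ennreal (2 * d) + (\<integral>\<^sup>+x. (\<integral>\<^sup>+t. indicator (ball \<tau> (2 * d)) t * ?k x t \<partial>\<mu>) \<partial>lborel)"
    using d by (subst nn_integral_add) (auto simp: nn_integral_cmult_indicator)
  also have "(\<integral>\<^sup>+x. (\<integral>\<^sup>+t. indicator (ball \<tau> (2 * d)) t * ?k x t \<partial>\<mu>) \<partial>lborel)
      = (\<integral>\<^sup>+t. (\<integral>\<^sup>+x. indicator (ball \<tau> (2 * d)) t * ?k x t \<partial>lborel) \<partial>\<mu>)"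
    using pair_sigma_finite.Fubini'[of lborel \<mu> "\<lambda>x t. indicator (ball \<tau> (2 * d)) t * ?k x t"]
    by (simp add: pair_sigma_finite_def sigma_finite_lborel mu.sigma_finite_measure_axioms)
  also have "\<dots> = (\<integral>\<^sup>+t. ennreal (1 / ?y) * indicator (ball \<tau> (2 * d)) t \<partial>\<mu>)"
    by (intro nn_integral_cong) (simp add: nn_integral_cmult nn_integral_poisson_kernel[OF l] mult.commute)
  also have "\<dots> = ennreal (?m / ?y)"
    using l by (simp add: nn_integral_cmult_indicator emeasure_ball_eq ennreal_mult'[symmetric])
  also have "ennreal (b + 4 * q) * ennreal (2 * d) + ennreal (?m / ?y) = ennreal (2 * d * (b + ?m / (2 * d * ?y) + 4 * q))"
    using d l q b_nonneg
    by (simp add: ennreal_mult'[symmetric] ennreal_plus[symmetric] del: ennreal_plus) (simp add: field_simps)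
  finally have "2 * d * amortized_julia f l \<tau> d \<le> 2 * d * (b + ?m / (2 * d * ?y) + 4 * q)"
    using d l q b_nonneg by (subst (asm) ennreal_le_iff) (auto intro!: mult_nonneg_nonneg add_nonneg_nonneg)
  then show ?thesis using d by simp
qed

end

section \<open>Consequences of regularity\<close>

lemma one_divide_ennreal: "0 < p \<Longrightarrow> 1 / ennreal p = ennreal (1 / p)"
  using divide_ennreal[of 1 p] by simp

text \<open>A gauge function, a Pick function with its Nevanlinna data, and a boundary point.\<close>
locale regularity = gauge \<gamma> + nevanlinna_data f b \<mu> for \<gamma> f b \<mu> +
  fixes \<tau> :: real
begin

lemma dist_tau: "t \<in> ball \<tau> r \<longleftrightarrow> \<bar>t - \<tau>\<bar> < r"
  by (simp add: dist_real_def abs_minus_commute)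

lemma borel_gamma_abs [measurable]:
  assumes "C > 0"
  shows "(\<lambda>t. \<gamma> (C * \<bar>t - \<tau>\<bar>)) \<in> borel_measurable borel"
proof -
  have "(\<lambda>t. \<gamma> (max 0 (C * \<bar>t - \<tau>\<bar>))) \<in> borel_measurable borel"
    by measurable
  with assms show ?thesis by simp
qed

lemma gamma_regular_iff:
  "gamma_regular \<gamma> f \<tau> \<longleftrightarrow>
    (\<exists>C>0. \<exists>\<delta>>0. (\<integral>\<^sup>+t\<in>ball \<tau> \<delta>. (1 / ennreal (\<gamma> (C * \<bar>t - \<tau>\<bar>))) \<partial>\<mu>) < \<infinity>)"
  unfolding gamma_regular_def nevanlinna_measure_eq
proof (intro iffI; elim exE conjE)
  fix C U assume C: "0 < C" and U: "open U" "\<tau> \<in> U"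
    and fin: "(\<integral>\<^sup>+t\<in>U. (1 / ennreal (\<gamma> (C * \<bar>t - \<tau>\<bar>))) \<partial>\<mu>) < \<infinity>"
  obtain \<delta> where \<delta>: "\<delta> > 0" "ball \<tau> \<delta> \<subseteq> U"
    using U by (meson open_contains_ball)
  have "(\<integral>\<^sup>+t\<in>ball \<tau> \<delta>. (1 / ennreal (\<gamma> (C * \<bar>t - \<tau>\<bar>))) \<partial>\<mu>) \<le> (\<integral>\<^sup>+t\<in>U. (1 / ennreal (\<gamma> (C * \<bar>t - \<tau>\<bar>))) \<partial>\<mu>)"
    using \<delta> by (intro nn_integral_mono mult_left_mono) (auto simp: indicator_def)
  with fin C \<delta> show "\<exists>C>0. \<exists>\<delta>>0. (\<integral>\<^sup>+t\<in>ball \<tau> \<delta>. (1 / ennreal (\<gamma> (C * \<bar>t - \<tau>\<bar>))) \<partial>\<mu>) < \<infinity>"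
    by (auto intro: le_less_trans)
next
  fix C \<delta> :: real assume "0 < C" "0 < \<delta>" "(\<integral>\<^sup>+t\<in>ball \<tau> \<delta>. (1 / ennreal (\<gamma> (C * \<bar>t - \<tau>\<bar>))) \<partial>\<mu>) < \<infinity>"
  then show "\<exists>C>0. \<exists>U. open U \<and> \<tau> \<in> U \<and> (\<integral>\<^sup>+t\<in>U. (1 / ennreal (\<gamma> (C * \<bar>t - \<tau>\<bar>))) \<partial>\<mu>) < \<infinity>"
    by (intro exI[of _ C] conjI exI[of _ "ball \<tau> \<delta>"]) auto
qed

context
  fixes C \<delta> :: real
  assumes C: "C > 0" and \<delta>: "\<delta> > 0"
    and fin: "(\<integral>\<^sup>+t\<in>ball \<tau> \<delta>. (1 / ennreal (\<gamma> (C * \<bar>t - \<tau>\<bar>))) \<partial>\<mu>) < \<infinity>"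
begin

text \<open>The point \<open>\<tau>\<close> carries no mass, because the integrand is \<open>1 / \<gamma> 0 = \<infinity>\<close> there.\<close>
lemma regular_null: "emeasure \<mu> {\<tau>} = 0"
proof (rule ccontr)
  assume "emeasure \<mu> {\<tau>} \<noteq> 0"
  then have "\<top> = \<top> * emeasure \<mu> {\<tau>}"
    by (simp add: ennreal_top_mult)
  also have "\<dots> = (\<integral>\<^sup>+t. \<top> * indicator {\<tau>} t \<partial>\<mu>)"
    by (subst nn_integral_cmult_indicator) auto
  also have "\<dots> \<le> (\<integral>\<^sup>+t\<in>ball \<tau> \<delta>. (1 / ennreal (\<gamma> (C * \<bar>t - \<tau>\<bar>))) \<partial>\<mu>)"
    using \<delta> by (intro nn_integral_mono) (auto simp: indicator_def gamma_0)
  finally show False using fin by (simp add: top_unique)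
qed

lemma regular_mass:
  "\<exists>I\<ge>0. \<forall>d. 0 < d \<and> d \<le> \<delta> \<longrightarrow> measure \<mu> (ball \<tau> d) \<le> I * \<gamma> (C * d)"
proof (intro exI conjI allI impI)
  let ?I = "\<integral>\<^sup>+t\<in>ball \<tau> \<delta>. (1 / ennreal (\<gamma> (C * \<bar>t - \<tau>\<bar>))) \<partial>\<mu>"
  show "0 \<le> enn2real ?I" by simp
  fix d assume d: "0 < d \<and> d \<le> \<delta>"
  have g: "\<gamma> (C * d) > 0" using C d by (intro pos) auto
  note [measurable] = borel_gamma_abs[OF C]
  have "emeasure \<mu> (ball \<tau> d) = (\<integral>\<^sup>+t. indicator (ball \<tau> d) t \<partial>\<mu>)" by simp
  also have "\<dots> \<le> (\<integral>\<^sup>+t. ennreal (\<gamma> (C * d)) * ((1 / ennreal (\<gamma> (C * \<bar>t - \<tau>\<bar>))) * indicator (ball \<tau> \<delta>) t) \<partial>\<mu>)"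
  proof (intro nn_integral_mono)
    fix t
    show "indicator (ball \<tau> d) t \<le> ennreal (\<gamma> (C * d)) * ((1 / ennreal (\<gamma> (C * \<bar>t - \<tau>\<bar>))) * indicator (ball \<tau> \<delta>) t)"
    proof (cases "t \<in> ball \<tau> d")
      case True
      then have t: "\<bar>t - \<tau>\<bar> < d" "t \<in> ball \<tau> \<delta>" using d by (auto simp: dist_tau simp del: mem_ball)
      show ?thesis
      proof (cases "t = \<tau>")
        case True
        with d \<delta> g show ?thesis by (simp add: gamma_0 ennreal_mult_top)
      next
        case False
        then have p: "\<gamma> (C * \<bar>t - \<tau>\<bar>) > 0" using C by (intro pos) auto
        have "\<gamma> (C * \<bar>t - \<tau>\<bar>) \<le> \<gamma> (C * d)"
          using C t by (intro gamma_mono mult_left_mono) auto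
        then have "1 \<le> \<gamma> (C * d) * (1 / \<gamma> (C * \<bar>t - \<tau>\<bar>))" using p by simp
        then have "ennreal 1 \<le> ennreal (\<gamma> (C * d) * (1 / \<gamma> (C * \<bar>t - \<tau>\<bar>)))" by (rule ennreal_leI)
        also have "\<dots> = ennreal (\<gamma> (C * d)) * (1 / ennreal (\<gamma> (C * \<bar>t - \<tau>\<bar>)))"
          unfolding one_divide_ennreal[OF p] using p g by (intro ennreal_mult) auto
        finally show ?thesis using t True by simp
      qed
    qed simp
  qed
  also have "\<dots> = ennreal (\<gamma> (C * d)) * ?I"
    by (subst nn_integral_cmult) auto
  also have "\<dots> = ennreal (\<gamma> (C * d)) * ennreal (enn2real ?I)"
    using fin by simp
  finally have "ennreal (measure \<mu> (ball \<tau> d)) \<le> ennreal (enn2real ?I * \<gamma> (C * d))"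
    using g by (simp add: emeasure_ball_eq ennreal_mult'[symmetric] mult.commute)
  then show "measure \<mu> (ball \<tau> d) \<le> enn2real ?I * \<gamma> (C * d)"
    using g by (simp add: ennreal_le_iff)
qed

text \<open>Near \<open>\<tau>\<close> this uses \<open>\<gamma>(t) = O(t\<^sup>2)\<close>, away from \<open>\<tau>\<close> a comparison with the Poisson kernel at
  \<open>\<tau> + i\<close>. The integrand vanishes at \<open>\<tau>\<close>, where the division is by zero.\<close>
lemma regular_moment: "\<exists>q\<ge>0. (\<integral>\<^sup>+t. ennreal (1 / (t - \<tau>)\<^sup>2) \<partial>\<mu>) \<le> ennreal q"
proof -
  let ?I = "\<integral>\<^sup>+t\<in>ball \<tau> \<delta>. (1 / ennreal (\<gamma> (C * \<bar>t - \<tau>\<bar>))) \<partial>\<mu>"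
  obtain K e where K: "K > 0" and e: "e > 0" and Ke: "\<And>t. 0 < t \<Longrightarrow> t < e \<Longrightarrow> \<gamma> t \<le> K * t\<^sup>2"
    using quadratic_bound by blast
  define \<rho> where "\<rho> = min \<delta> (e / C)"
  have \<rho>: "\<rho> > 0" "\<rho> \<le> \<delta>" "C * \<rho> \<le> e"
    using \<delta> e C by (auto simp: \<rho>_def min_def field_simps)
  define A where "A = pi * (1 + 1 / \<rho>\<^sup>2)"
  have A: "A > 0" using \<rho> by (simp add: A_def add_pos_nonneg)
  note [measurable] = borel_gamma_abs[OF C]
  have "(\<integral>\<^sup>+t. ennreal (1 / (t - \<tau>)\<^sup>2) \<partial>\<mu>) \<le> (\<integral>\<^sup>+t. ennreal (K * C\<^sup>2) * ((1 / ennreal (\<gamma> (C * \<bar>t - \<tau>\<bar>))) * indicator (ball \<tau> \<delta>) t)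
      + ennreal A * ennreal (1 / (pi * ((t - \<tau>)\<^sup>2 + 1\<^sup>2))) \<partial>\<mu>)"
  proof (intro nn_integral_mono)
    fix t
    consider "t = \<tau>" | "t \<noteq> \<tau>" "\<bar>t - \<tau>\<bar> < \<rho>" | "\<bar>t - \<tau>\<bar> \<ge> \<rho>" by linarith
    then show "ennreal (1 / (t - \<tau>)\<^sup>2) \<le> ennreal (K * C\<^sup>2) * ((1 / ennreal (\<gamma> (C * \<bar>t - \<tau>\<bar>))) * indicator (ball \<tau> \<delta>) t)
      + ennreal A * ennreal (1 / (pi * ((t - \<tau>)\<^sup>2 + 1\<^sup>2)))"
    proof cases
      case 2
      have p: "\<gamma> (C * \<bar>t - \<tau>\<bar>) > 0" using C 2 by (intro pos) auto
      have "C * \<bar>t - \<tau>\<bar> < C * \<rho>" using C 2 by simp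
      also note \<open>C * \<rho> \<le> e\<close>
      finally have "\<gamma> (C * \<bar>t - \<tau>\<bar>) \<le> K * (C * \<bar>t - \<tau>\<bar>)\<^sup>2"
        by (intro Ke) (use C 2 in simp_all)
      then have "\<gamma> (C * \<bar>t - \<tau>\<bar>) \<le> K * C\<^sup>2 * (t - \<tau>)\<^sup>2" by (simp add: power_mult_distrib)
      then have "1 / (t - \<tau>)\<^sup>2 \<le> K * C\<^sup>2 * (1 / \<gamma> (C * \<bar>t - \<tau>\<bar>))"
        using p 2 by (simp add: field_simps)
      then have "ennreal (1 / (t - \<tau>)\<^sup>2) \<le> ennreal (K * C\<^sup>2 * (1 / \<gamma> (C * \<bar>t - \<tau>\<bar>)))" by (rule ennreal_leI)
      also have "\<dots> = ennreal (K * C\<^sup>2) * (1 / ennreal (\<gamma> (C * \<bar>t - \<tau>\<bar>)))"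
        unfolding one_divide_ennreal[OF p] using p K by (intro ennreal_mult) auto
      also have "\<dots> = ennreal (K * C\<^sup>2) * ((1 / ennreal (\<gamma> (C * \<bar>t - \<tau>\<bar>))) * indicator (ball \<tau> \<delta>) t)"
        using 2 \<rho> by (simp add: dist_tau indicator_def del: mem_ball)
      finally show ?thesis by (rule order_trans) simp
    next
      case 3
      then have t0: "t \<noteq> \<tau>" using \<rho> by auto
      from power_mono[OF 3, of 2] \<rho> have "\<rho>\<^sup>2 \<le> (t - \<tau>)\<^sup>2" by simp
      moreover have "0 < \<rho>\<^sup>2" using \<rho> by simp
      ultimately have "u + 1 \<le> (1 + 1 / \<rho>\<^sup>2) * u" if "u = (t - \<tau>)\<^sup>2" for u
        using that by (simp add: field_simps)
      then have "(t - \<tau>)\<^sup>2 + 1 \<le> (1 + 1 / \<rho>\<^sup>2) * (t - \<tau>)\<^sup>2" by blast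
      moreover have "1 / u \<le> pi * v * (1 / (pi * (u + 1)))" if "u > 0" "u + 1 \<le> v * u" for u v :: real
      proof -
        have eq: "pi * v * (1 / (pi * (u + 1))) = v / (u + 1)" by simp
        show ?thesis unfolding eq using that by (simp add: field_simps)
      qed
      ultimately have "1 / (t - \<tau>)\<^sup>2 \<le> A * (1 / (pi * ((t - \<tau>)\<^sup>2 + 1\<^sup>2)))"
        unfolding A_def using t0 by (simp only: power_one) (metis zero_less_power2 eq_iff_diff_eq_0)
      then have "ennreal (1 / (t - \<tau>)\<^sup>2) \<le> ennreal A * ennreal (1 / (pi * ((t - \<tau>)\<^sup>2 + 1\<^sup>2)))"
        using A by (subst ennreal_mult[symmetric]) (auto intro: ennreal_leI)
      then show ?thesis by (rule order_trans) simp
    qed simp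
  qed
  also have "\<dots> = ennreal (K * C\<^sup>2) * ?I + ennreal A * (\<integral>\<^sup>+t. ennreal (1 / (pi * ((t - \<tau>)\<^sup>2 + 1\<^sup>2))) \<partial>\<mu>)"
    by (subst nn_integral_add) (auto simp: nn_integral_cmult)
  also have "\<dots> < \<infinity>"
    using fin kernel_finite[of 1 \<tau>] by (auto simp: ennreal_mult_less_top)
  finally have "(\<integral>\<^sup>+t. ennreal (1 / (t - \<tau>)\<^sup>2) \<partial>\<mu>) < \<infinity>" .
  then show ?thesis
    by (intro exI[of _ "enn2real (\<integral>\<^sup>+t. ennreal (1 / (t - \<tau>)\<^sup>2) \<partial>\<mu>)"]) auto
qed

text \<open>The criterion through which regularity yields bounded amortized quotients.\<close>
lemma regular_amortized_julia_bounded: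
  assumes "\<forall>\<^sub>F d in at_right 0. l d > 0 \<and> measure \<mu> (ball \<tau> (2 * d)) \<le> K * d * l d"
  shows "amortized_julia_bounded f l \<tau>"
proof -
  obtain q where q: "q \<ge> 0" "(\<integral>\<^sup>+t. ennreal (1 / (t - \<tau>)\<^sup>2) \<partial>\<mu>) \<le> ennreal q"
    using regular_moment by blast
  have "\<forall>\<^sub>F d in at_right 0. l d > 0 \<and> \<bar>amortized_julia f l \<tau> d\<bar> \<le> b + K / 2 + 4 * q"
    using assms eventually_at_right_less[of 0]
  proof eventually_elim
    case (elim d)
    have "measure \<mu> (ball \<tau> (2 * d)) / (2 * d * l d) \<le> (K * d * l d) / (2 * d * l d)"
      using elim by (intro divide_right_mono) auto
    also have "\<dots> = K / 2" using elim by simp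
    finally show ?case
      using amortized_julia_le_ball_mass[OF regular_null q, where l = l, of d]
        amortized_julia_nonneg[where l = l, of d \<tau>] elim by auto
  qed
  then show ?thesis unfolding amortized_julia_bounded_def by blast
qed

lemma regular_ball_mass_small: "((\<lambda>d. measure \<mu> (ball \<tau> (2 * d)) / d\<^sup>2) \<longlongrightarrow> 0) (at_right 0)"
proof -
  obtain q where q: "(\<integral>\<^sup>+t. ennreal (1 / (t - \<tau>)\<^sup>2) \<partial>\<mu>) \<le> ennreal q"
    using regular_moment by blast
  have int: "integrable \<mu> (\<lambda>t. 1 / (t - \<tau>)\<^sup>2)"
    using q by (intro integrableI_nonneg) (auto intro: le_less_trans)
  have lim: "((\<lambda>d. \<integral>t. indicator (ball \<tau> (2 * d)) t * (1 / (t - \<tau>)\<^sup>2) \<partial>\<mu>) \<longlongrightarrow> 0) (at_right 0)"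
    unfolding tendsto_at_iff_sequentially
  proof (intro allI impI)
    fix X :: "nat \<Rightarrow> real" assume X: "\<forall>i. X i \<in> {0<..} - {0}" "X \<longlonglongrightarrow> 0"
    have "(\<lambda>n. \<integral>t. indicator (ball \<tau> (2 * X n)) t * (1 / (t - \<tau>)\<^sup>2) \<partial>\<mu>) \<longlonglongrightarrow> (\<integral>t. 0 \<partial>\<mu>)"
    proof (rule integral_dominated_convergence[OF _ _ int])
      show "AE t in \<mu>. (\<lambda>n. indicator (ball \<tau> (2 * X n)) t * (1 / (t - \<tau>)\<^sup>2)) \<longlonglongrightarrow> 0"
      proof (rule AE_I2)
        fix t
        show "(\<lambda>n. indicator (ball \<tau> (2 * X n)) t * (1 / (t - \<tau>)\<^sup>2)) \<longlonglongrightarrow> 0"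
        proof (cases "t = \<tau>")
          case False
          then have "0 < \<bar>t - \<tau>\<bar> / 2" by simp
          with X(2) have "\<forall>\<^sub>F n in sequentially. X n < \<bar>t - \<tau>\<bar> / 2"
            by (rule order_tendstoD)
          then have "\<forall>\<^sub>F n in sequentially. indicator (ball \<tau> (2 * X n)) t * (1 / (t - \<tau>)\<^sup>2) = 0"
            by eventually_elim (auto simp: indicator_def dist_tau simp del: mem_ball)
          then show ?thesis by (rule tendsto_eventually)
        qed simp
      qed
      show "AE t in \<mu>. norm (indicator (ball \<tau> (2 * X n)) t * (1 / (t - \<tau>)\<^sup>2)) \<le> 1 / (t - \<tau>)\<^sup>2" for n
        by (intro AE_I2) (auto simp: indicator_def)
    qed auto
    then show "((\<lambda>d. \<integral>t. indicator (ball \<tau> (2 * d)) t * (1 / (t - \<tau>)\<^sup>2) \<partial>\<mu>) \<circ> X) \<longlonglongrightarrow> 0"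
      by (simp add: o_def)
  qed
  have AE: "AE t in \<mu>. t \<noteq> \<tau>"
    using regular_null by (intro AE_I[of _ _ "{\<tau>}"]) auto
  show ?thesis
  proof (rule tendsto_sandwich[OF _ _ tendsto_const])
    show "\<forall>\<^sub>F d in at_right 0. measure \<mu> (ball \<tau> (2 * d)) / d\<^sup>2 \<le> 4 * (\<integral>t. indicator (ball \<tau> (2 * d)) t * (1 / (t - \<tau>)\<^sup>2) \<partial>\<mu>)"
      using eventually_at_right_less[of 0]
    proof eventually_elim
      case (elim d)
      have fin: "integrable \<mu> (indicator (ball \<tau> (2 * d)) :: real \<Rightarrow> real)"
        using emeasure_ball by (intro integrable_real_indicator) auto
      have "measure \<mu> (ball \<tau> (2 * d)) / d\<^sup>2 = (\<integral>t. indicator (ball \<tau> (2 * d)) t * (1 / d\<^sup>2) \<partial>\<mu>)"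
        by simp
      also have "\<dots> \<le> (\<integral>t. 4 * (indicator (ball \<tau> (2 * d)) t * (1 / (t - \<tau>)\<^sup>2)) \<partial>\<mu>)"
      proof (rule integral_mono_AE)
        show "integrable \<mu> (\<lambda>t. indicator (ball \<tau> (2 * d)) t * (1 / d\<^sup>2))"
          using fin by (rule integrable_mult_left)
        show "integrable \<mu> (\<lambda>t. 4 * (indicator (ball \<tau> (2 * d)) t * (1 / (t - \<tau>)\<^sup>2)))"
          using integrable_mult_indicator[OF _ int, of "ball \<tau> (2 * d)"] by (intro integrable_mult_right) simp
        show "AE t in \<mu>. indicator (ball \<tau> (2 * d)) t * (1 / d\<^sup>2) \<le> 4 * (indicator (ball \<tau> (2 * d)) t * (1 / (t - \<tau>)\<^sup>2))"
          using AE
        proof eventually_elim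
          case t: (elim t)
          show ?case
          proof (cases "t \<in> ball \<tau> (2 * d)")
            case True
            then have "\<bar>t - \<tau>\<bar> \<le> 2 * d" by (simp add: dist_tau del: mem_ball)
            from power_mono[OF this, of 2] have "(t - \<tau>)\<^sup>2 \<le> 4 * d\<^sup>2" by simp
            then have "1 / d\<^sup>2 \<le> 4 / (t - \<tau>)\<^sup>2" using elim t by (simp add: field_simps)
            with True show ?thesis by simp
          qed simp
        qed
      qed
      also have "\<dots> = 4 * (\<integral>t. indicator (ball \<tau> (2 * d)) t * (1 / (t - \<tau>)\<^sup>2) \<partial>\<mu>)"
        by (rule integral_mult_right_zero)
      finally show ?case .
    qed
    show "((\<lambda>d. 4 * (\<integral>t. indicator (ball \<tau> (2 * d)) t * (1 / (t - \<tau>)\<^sup>2) \<partial>\<mu>)) \<longlongrightarrow> 0) (at_right 0)"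
      using tendsto_mult[OF tendsto_const[of 4] lim] by simp
  qed auto
qed

end

end

section \<open>Auguries\<close>

context gauge
begin

text \<open>Measurability is recorded as well, since an augury itself need not be measurable.\<close>
lemma augury_nn_integral:
  assumes "gamma_augury \<gamma> l"
  shows "\<exists>C>0. (\<lambda>t. ennreal (t * l (C * t) / stieltjes_square \<gamma> t) * indicator {0..<1} t) \<in> borel_measurable dgamma
    \<and> (\<integral>\<^sup>+t\<in>{0..<1}. ennreal (t * l (C * t) / stieltjes_square \<gamma> t) \<partial>dgamma) < \<infinity>"
proof -
  obtain C where C: "C > 0" and int: "set_integrable dgamma {0..<1} (\<lambda>t. t * l (C * t) / stieltjes_square \<gamma> t)"
    using assms by (auto simp: gamma_augury_def)
  have "(\<integral>\<^sup>+t. ennreal (norm (indicator {0..<1} t *\<^sub>R (t * l (C * t) / stieltjes_square \<gamma> t))) \<partial>dgamma) < \<infinity>"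
    using int unfolding set_integrable_def integrable_iff_bounded by simp
  moreover have "(\<integral>\<^sup>+t\<in>{0..<1}. ennreal (t * l (C * t) / stieltjes_square \<gamma> t) \<partial>dgamma)
      \<le> (\<integral>\<^sup>+t. ennreal (norm (indicator {0..<1} t *\<^sub>R (t * l (C * t) / stieltjes_square \<gamma> t))) \<partial>dgamma)"
    by (intro nn_integral_mono) (auto simp: indicator_def simp del: abs_mult abs_divide intro!: ennreal_leI)
  ultimately have "(\<integral>\<^sup>+t\<in>{0..<1}. ennreal (t * l (C * t) / stieltjes_square \<gamma> t) \<partial>dgamma) < \<infinity>"
    by (rule le_less_trans[rotated])
  moreover have "(\<lambda>t. ennreal (indicator {0..<1} t *\<^sub>R (t * l (C * t) / stieltjes_square \<gamma> t))) \<in> borel_measurable dgamma"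
    using int unfolding set_integrable_def integrable_iff_bounded by (intro measurable_compose[OF _ measurable_ennreal]) simp
  moreover have "ennreal (indicator {0..<1} t *\<^sub>R (t * l (C * t) / stieltjes_square \<gamma> t))
      = ennreal (t * l (C * t) / stieltjes_square \<gamma> t) * indicator {0..<1} t" for t
    by (simp add: indicator_def)
  ultimately show ?thesis using C by auto
qed

lemma augury_scale_argument:
  assumes l: "gamma_augury \<gamma> l" and c: "c > 0"
  shows "gamma_augury \<gamma> (\<lambda>t. l (c * t))"
proof -
  have lo: "l \<in> o[at_right 0](\<lambda>t. t)" and nn: "\<forall>t\<ge>0. l t \<ge> 0"
    using l by (auto simp: gamma_augury_def)
  obtain C where C: "C > 0" and int: "set_integrable dgamma {0..<1} (\<lambda>t. t * l (C * t) / stieltjes_square \<gamma> t)"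
    using l by (auto simp: gamma_augury_def)
  have "filterlim (\<lambda>t. c * t) (at_right 0) (at_right (0::real))"
    unfolding filterlim_at
  proof
    show "\<forall>\<^sub>F t in at_right 0. c * t \<in> {0<..} \<and> c * t \<noteq> 0"
      using eventually_at_right_less[of "0::real"] by eventually_elim (use c in auto)
    have "((\<lambda>t. c * t) \<longlongrightarrow> c * 0) (at_right 0)" by (intro tendsto_intros)
    then show "((\<lambda>t. c * t) \<longlongrightarrow> 0) (at_right 0)" by simp
  qed
  from landau_o.small.compose[OF lo this] have "(\<lambda>t. l (c * t)) \<in> o[at_right 0](\<lambda>t. c * t)" .
  then have "(\<lambda>t. l (c * t)) \<in> o[at_right 0](\<lambda>t. t)"
    using c by simp
  moreover have "set_integrable dgamma {0..<1} (\<lambda>t. t * l (c * (C / c * t)) / stieltjes_square \<gamma> t)"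
    using int c by simp
  ultimately show ?thesis
    unfolding gamma_augury_def using nn c C by (intro conjI exI[of _ "C / c"]) auto
qed

lemma augury_scale:
  assumes l: "gamma_augury \<gamma> l" and c: "c \<ge> 0"
  shows "gamma_augury \<gamma> (\<lambda>t. c * l t)"
proof -
  obtain C where C: "C > 0" and int: "set_integrable dgamma {0..<1} (\<lambda>t. t * l (C * t) / stieltjes_square \<gamma> t)"
    using l by (auto simp: gamma_augury_def)
  have "set_integrable dgamma {0..<1} (\<lambda>t. c * (t * l (C * t) / stieltjes_square \<gamma> t))"
    using int by (rule set_integrable_mult_right)
  then have "set_integrable dgamma {0..<1} (\<lambda>t. t * (c * l (C * t)) / stieltjes_square \<gamma> t)"
    by (simp add: mult.left_commute)
  with l c C show ?thesis
    unfolding gamma_augury_def by (auto intro!: landau_o.small.mult_in_1 exI[of _ C])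
qed

text \<open>If \<open>sqrt \<gamma>\<close> is an augury, then \<open>\<gamma>\<close> decays rapidly. With the integral of
  \<open>t sqrt(\<gamma>(C t)) d\<gamma>(t) / \<gamma>(t)\<^sup>2\<close> bounded by \<open>A\<close>, its part over \<open>(a, 1/2]\<close> is at least
  \<open>a sqrt(\<gamma>(C a)) (1 / R a - 1 / R (1/2))\<close>, and for small \<open>a\<close> the last factor is at least
  \<open>1 / (2 R a)\<close>. Applied to \<open>a = s / 2\<close>, this bounds \<open>\<gamma>(c s)\<close> by a multiple of \<open>\<gamma>(s)\<^sup>2 / s\<^sup>2\<close>.\<close>
lemma sqrt_augury_decay:
  assumes "gamma_augury \<gamma> (\<lambda>t. sqrt (\<gamma> t))"
  shows "\<exists>c P e. 0 < c \<and> c < 1 \<and> 0 < P \<and> 0 < e \<and> (\<forall>s. 0 < s \<and> s < e \<longrightarrow> \<gamma> (c * s) \<le> P * (\<gamma> s)\<^sup>2 / s\<^sup>2)"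
proof -
  obtain C where C: "C > 0" and fin: "(\<integral>\<^sup>+t\<in>{0..<1}. ennreal (t * sqrt (\<gamma> (C * t)) / stieltjes_square \<gamma> t) \<partial>dgamma) < \<infinity>"
    using augury_nn_integral[OF assms] by blast
  define A where "A = enn2real (\<integral>\<^sup>+t\<in>{0..<1}. ennreal (t * sqrt (\<gamma> (C * t)) / stieltjes_square \<gamma> t) \<partial>dgamma)"
  have A: "A \<ge> 0" "(\<integral>\<^sup>+t\<in>{0..<1}. ennreal (t * sqrt (\<gamma> (C * t)) / stieltjes_square \<gamma> t) \<partial>dgamma) = ennreal A"
    using fin by (auto simp: A_def)
  have Rh: "R (1/2) > 0" by (rule R_pos) simp
  then have "\<forall>\<^sub>F t in at_right 0. \<gamma> t < R (1/2) / 2"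
    by (intro order_tendstoD(2)[OF tendsto_gamma_0]) simp
  then obtain e0 where e0: "e0 > 0" "\<And>t. 0 < t \<Longrightarrow> t < e0 \<Longrightarrow> \<gamma> t < R (1/2) / 2"
    unfolding eventually_at_right_field by auto
  define c where "c = min (C / 2) (1/2)"
  have c: "0 < c" "c < 1" "c \<le> C / 2" using C by (auto simp: c_def)
  have main: "\<gamma> (c * s) \<le> (4 * A)\<^sup>2 * (\<gamma> s)\<^sup>2 / s\<^sup>2" if s: "0 < s" "s < min e0 1" for s
  proof -
    let ?a = "s / 2"
    let ?w = "?a * sqrt (\<gamma> (C * ?a))"
    have a: "0 < ?a" "?a < 1/2" using s by auto
    have w: "?w \<ge> 0" using a C by (intro mult_nonneg_nonneg real_sqrt_ge_zero nonneg) auto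
    have Ra: "R ?a > 0" "R ?a \<le> \<gamma> s" using a R_pos R_le[of ?a s] s by auto
    have "R ?a * 2 \<le> R (1/2)" using Ra e0(2)[of s] s by auto
    then have "1 / R (1/2) \<le> 1 / (R ?a * 2)"
      using Ra Rh by (intro divide_left_mono) auto
    moreover have "1 / (2 * \<gamma> s) \<le> 1 / (R ?a * 2)"
      using Ra pos[of s] s by (intro divide_left_mono) auto
    ultimately have "1 / (2 * \<gamma> s) \<le> 1 / R ?a - 1 / R (1/2)"
      by simp
    then have "ennreal ?w * ennreal (1 / (2 * \<gamma> s)) \<le> ennreal ?w * (\<integral>\<^sup>+t\<in>{?a<..1/2}. ennreal (1 / stieltjes_square \<gamma> t) \<partial>dgamma)"
      unfolding integral_inverse_stieltjes_square[OF a] by (intro mult_left_mono ennreal_leI) auto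
    also have "\<dots> = (\<integral>\<^sup>+t. ennreal ?w * (ennreal (1 / stieltjes_square \<gamma> t) * indicator {?a<..1/2} t) \<partial>dgamma)"
      by (subst nn_integral_cmult) auto
    also have "\<dots> \<le> (\<integral>\<^sup>+t\<in>{0..<1}. ennreal (t * sqrt (\<gamma> (C * t)) / stieltjes_square \<gamma> t) \<partial>dgamma)"
    proof (intro nn_integral_mono)
      fix t
      show "ennreal ?w * (ennreal (1 / stieltjes_square \<gamma> t) * indicator {?a<..1/2} t)
        \<le> ennreal (t * sqrt (\<gamma> (C * t)) / stieltjes_square \<gamma> t) * indicator {0..<1} t"
      proof (cases "t \<in> {?a<..1/2}")
        case True
        have "?w \<le> t * sqrt (\<gamma> (C * t))"
          using True a C by (intro mult_mono real_sqrt_le_mono gamma_mono mult_left_mono real_sqrt_ge_zero nonneg) auto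
        then have "?w * (1 / stieltjes_square \<gamma> t) \<le> t * sqrt (\<gamma> (C * t)) * (1 / stieltjes_square \<gamma> t)"
          using stieltjes_square_nonneg by (intro mult_right_mono) auto
        then have "ennreal ?w * ennreal (1 / stieltjes_square \<gamma> t) \<le> ennreal (t * sqrt (\<gamma> (C * t)) / stieltjes_square \<gamma> t)"
          using w by (subst ennreal_mult'[symmetric]) (auto intro!: ennreal_leI)
        with True a show ?thesis by simp
      qed simp
    qed
    also note A(2)
    finally have "?w * (1 / (2 * \<gamma> s)) \<le> A"
      using w A(1) pos[of s] s by (simp add: ennreal_mult'[symmetric] ennreal_le_iff)
    then have "s * sqrt (\<gamma> (C * ?a)) \<le> 4 * A * \<gamma> s"
      using pos[of s] s by (simp add: field_simps)
    then have "(s * sqrt (\<gamma> (C * ?a)))\<^sup>2 \<le> (4 * A * \<gamma> s)\<^sup>2"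
      using s C by (intro power_mono mult_nonneg_nonneg real_sqrt_ge_zero nonneg) auto
    then have "s\<^sup>2 * \<gamma> (C * ?a) \<le> (4 * A)\<^sup>2 * (\<gamma> s)\<^sup>2"
      using nonneg[of "C * ?a"] s C by (simp add: power_mult_distrib)
    moreover have "c * s \<le> C / 2 * s" using c s by (intro mult_right_mono) auto
    then have "\<gamma> (c * s) \<le> \<gamma> (C * ?a)"
      using c s by (intro gamma_mono) auto
    then have "s\<^sup>2 * \<gamma> (c * s) \<le> s\<^sup>2 * \<gamma> (C * ?a)" by (intro mult_left_mono) auto
    ultimately have "s\<^sup>2 * \<gamma> (c * s) \<le> (4 * A)\<^sup>2 * (\<gamma> s)\<^sup>2" by linarith
    then show ?thesis using s by (simp add: field_simps)
  qed
  have "\<gamma> (c * s) \<le> ((4 * A)\<^sup>2 + 1) * (\<gamma> s)\<^sup>2 / s\<^sup>2" if "0 < s" "s < min e0 1" for s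
  proof -
    have "(4 * A)\<^sup>2 * (\<gamma> s)\<^sup>2 / s\<^sup>2 \<le> ((4 * A)\<^sup>2 + 1) * (\<gamma> s)\<^sup>2 / s\<^sup>2"
      by (intro divide_right_mono mult_right_mono) auto
    with main[OF that] show ?thesis by linarith
  qed
  moreover have "0 < (4 * A)\<^sup>2 + 1" by (simp add: add_nonneg_pos)
  moreover have "0 < min e0 1" using e0 by simp
  ultimately show ?thesis using c by blast
qed

text \<open>As \<open>\<gamma>(s) = o(s\<^sup>2)\<close>, the previous bound implies \<open>\<gamma>(c s) \<le> c\<^sup>3 \<gamma>(s)\<close> for small \<open>s\<close>, and iterating this
  gives cubic decay.\<close>
lemma sqrt_augury_cubic:
  assumes "gamma_augury \<gamma> (\<lambda>t. sqrt (\<gamma> t))"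
    and c: "0 < c" "c < 1" and P: "0 < P" and e: "0 < e"
    and decay: "\<And>s. 0 < s \<Longrightarrow> s < e \<Longrightarrow> \<gamma> (c * s) \<le> P * (\<gamma> s)\<^sup>2 / s\<^sup>2"
  shows "\<exists>M>0. \<exists>e'>0. \<forall>s. 0 < s \<and> s < e' \<longrightarrow> \<gamma> s \<le> M * s ^ 3"
proof -
  have "(\<lambda>t. sqrt (\<gamma> t)) \<in> o[at_right 0](\<lambda>t. t)"
    using assms(1) by (simp add: gamma_augury_def)
  moreover have "0 < sqrt (c ^ 3 / P)" using c P by simp
  ultimately have "\<forall>\<^sub>F t in at_right 0. norm (sqrt (\<gamma> t)) \<le> sqrt (c ^ 3 / P) * norm t"
    by (rule landau_o.smallD)
  then obtain e1 where e1: "e1 > 0" "\<And>t. 0 < t \<Longrightarrow> t < e1 \<Longrightarrow> norm (sqrt (\<gamma> t)) \<le> sqrt (c ^ 3 / P) * norm t"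
    unfolding eventually_at_right_field by auto
  define e2 where "e2 = min e e1 / 2"
  have e2: "0 < e2" "e2 < e" "e2 < e1" using e e1 by (auto simp: e2_def)
  have step: "\<gamma> (c * s) \<le> c ^ 3 * \<gamma> s" if s: "0 < s" "s \<le> e2" for s
  proof -
    have "(norm (sqrt (\<gamma> s)))\<^sup>2 \<le> (sqrt (c ^ 3 / P) * norm s)\<^sup>2"
      using e1(2)[of s] s e2 by (intro power_mono) auto
    then have le: "\<gamma> s \<le> c ^ 3 / P * s\<^sup>2"
      using nonneg[of s] s c P by (simp add: power_mult_distrib)
    have "\<gamma> (c * s) \<le> P * (\<gamma> s)\<^sup>2 / s\<^sup>2" using s e2 by (intro decay) auto
    also have "\<dots> = P / s\<^sup>2 * \<gamma> s * \<gamma> s" by (simp add: power2_eq_square)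
    also have "\<dots> \<le> P / s\<^sup>2 * \<gamma> s * (c ^ 3 / P * s\<^sup>2)"
      using le s P nonneg[of s] by (intro mult_left_mono) auto
    also have "\<dots> = c ^ 3 * \<gamma> s" using s P by simp
    finally show ?thesis .
  qed
  have iter: "\<gamma> (c ^ n * e2) \<le> (c ^ n) ^ 3 * \<gamma> e2" for n
  proof (induction n)
    case (Suc n)
    have "c ^ n * e2 \<le> 1 * e2" using c e2 by (intro mult_right_mono power_le_one) auto
    then have "\<gamma> (c * (c ^ n * e2)) \<le> c ^ 3 * \<gamma> (c ^ n * e2)"
      using c e2 by (intro step) auto
    also have "\<dots> \<le> c ^ 3 * ((c ^ n) ^ 3 * \<gamma> e2)"
      using Suc c by (intro mult_left_mono) auto
    finally show ?case by (simp add: power_mult_distrib mult.assoc)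
  qed simp
  define M where "M = \<gamma> e2 / (c * e2) ^ 3"
  have "\<gamma> s \<le> M * s ^ 3" if s: "0 < s" "s < e2" for s
  proof -
    define n where "n = (LEAST n. c ^ n * e2 < s)"
    have "0 < s / e2" using s e2 by simp
    then obtain m where "c ^ m < s / e2" using real_arch_pow_inv c by blast
    then have "c ^ m * e2 < s" using e2 by (simp add: field_simps)
    then have n: "c ^ n * e2 < s" unfolding n_def by (rule LeastI)
    have "n \<noteq> 0"
    proof
      assume "n = 0"
      with n s show False by simp
    qed
    then obtain k where k: "n = Suc k" by (cases n) auto
    then have "\<not> c ^ k * e2 < s" using not_less_Least[of k "\<lambda>n. c ^ n * e2 < s"] by (simp add: n_def)
    then have "\<gamma> s \<le> \<gamma> (c ^ k * e2)" using s by (intro gamma_mono) auto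
    also have "\<dots> \<le> (c ^ k) ^ 3 * \<gamma> e2" by (rule iter)
    also have "\<dots> \<le> (s / (c * e2)) ^ 3 * \<gamma> e2"
    proof (intro mult_right_mono power_mono)
      have "c * e2 * c ^ k \<le> s" using n by (simp add: k mult_ac)
      then show "c ^ k \<le> s / (c * e2)" using c e2 by (simp add: field_simps)
    qed (use c e2 nonneg in auto)
    also have "\<dots> = M * s ^ 3" by (simp add: M_def power_divide)
    finally show ?thesis .
  qed
  moreover have "M > 0" using c e2 pos[of e2] by (simp add: M_def)
  ultimately show ?thesis using e2(1) by blast
qed

text \<open>Two steps of the decay bound gain the factor \<open>(\<gamma>(s) / s\<^sup>3)\<^sup>2\<close>, which is bounded.\<close>
lemma sqrt_augury_square_decay:
  assumes "gamma_augury \<gamma> (\<lambda>t. sqrt (\<gamma> t))"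
  shows "\<exists>c>0. \<exists>K>0. \<exists>e>0. \<forall>s. 0 < s \<and> s < e \<longrightarrow> \<gamma> (c * s) \<le> K * (\<gamma> s)\<^sup>2"
proof -
  obtain c P e where c: "0 < c" "c < 1" and P: "0 < P" and e: "0 < e"
    and decay: "\<And>s. 0 < s \<Longrightarrow> s < e \<Longrightarrow> \<gamma> (c * s) \<le> P * (\<gamma> s)\<^sup>2 / s\<^sup>2"
    using sqrt_augury_decay[OF assms] by blast
  obtain M e' where M: "M > 0" and e': "e' > 0" and cub: "\<And>s. 0 < s \<Longrightarrow> s < e' \<Longrightarrow> \<gamma> s \<le> M * s ^ 3"
    using sqrt_augury_cubic[OF assms c P e decay] by blast
  have "\<gamma> (c\<^sup>2 * s) \<le> (P ^ 3 * M\<^sup>2 / c\<^sup>2) * (\<gamma> s)\<^sup>2" if s: "0 < s" "s < min e e'" for s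
  proof -
    have "c * s < 1 * s" using c s by (intro mult_strict_right_mono) auto
    then have "c * s < e" using s by linarith
    moreover have "0 < c * s" using s c by simp
    ultimately have cs: "0 < c * s" "c * s < e" by auto
    have "\<gamma> (c\<^sup>2 * s) \<le> P * (\<gamma> (c * s))\<^sup>2 / (c * s)\<^sup>2"
      using decay[OF cs] by (simp add: power2_eq_square mult.assoc)
    also have "\<dots> \<le> P * (P * (\<gamma> s)\<^sup>2 / s\<^sup>2)\<^sup>2 / (c * s)\<^sup>2"
      using decay[of s] s P nonneg[of "c * s"] cs
      by (intro divide_right_mono mult_left_mono power_mono) auto
    also have "\<dots> = (P ^ 3 / c\<^sup>2 * (\<gamma> s)\<^sup>2) * (\<gamma> s / s ^ 3)\<^sup>2"
      using s c by (simp add: field_simps power2_eq_square power3_eq_cube)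
    also have "\<dots> \<le> (P ^ 3 / c\<^sup>2 * (\<gamma> s)\<^sup>2) * M\<^sup>2"
      using cub[of s] s P nonneg[of s] by (intro mult_left_mono power_mono) (auto simp: field_simps)
    finally show ?thesis by (simp add: mult_ac)
  qed
  moreover have "0 < P ^ 3 * M\<^sup>2 / c\<^sup>2" "0 < c\<^sup>2" "0 < min e e'" using P M c e e' by auto
  ultimately show ?thesis by blast
qed

end

section \<open>Characterisations of regularity\<close>

context regularity
begin

text \<open>Up to a bounded term and the choice of a one-sided limit, the inner integral on the right is
  \<open>1 / \<gamma>(|t - \<tau>| / A)\<close> for \<open>t\<close> close to \<open>\<tau>\<close>; on the left stands the mass
  near \<open>\<tau>\<close> integrated against \<open>d\<gamma> / \<gamma>\<^sup>2\<close>.\<close>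
lemma tonelli_ball:
  assumes A: "A > 0" and B [measurable]: "B \<in> sets borel"
  shows "(\<integral>\<^sup>+u. emeasure \<mu> (ball \<tau> (A * u) \<inter> B) * (ennreal (1 / stieltjes_square \<gamma> u) * indicator {0<..\<delta>} u) \<partial>dgamma)
    = (\<integral>\<^sup>+t. (\<integral>\<^sup>+u\<in>{\<bar>t - \<tau>\<bar> / A<..\<delta>}. ennreal (1 / stieltjes_square \<gamma> u) \<partial>dgamma) * indicator B t \<partial>\<mu>)"
proof -
  let ?g = "\<lambda>t u. of_bool (\<bar>t - \<tau>\<bar> < A * u) * indicator B t * (ennreal (1 / stieltjes_square \<gamma> u) * indicator {0<..\<delta>} u)"
  have "(\<integral>\<^sup>+u. emeasure \<mu> (ball \<tau> (A * u) \<inter> B) * (ennreal (1 / stieltjes_square \<gamma> u) * indicator {0<..\<delta>} u) \<partial>dgamma)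
    = (\<integral>\<^sup>+u. (\<integral>\<^sup>+t. ?g t u \<partial>\<mu>) \<partial>dgamma)"
  proof (intro nn_integral_cong)
    fix u
    have "emeasure \<mu> (ball \<tau> (A * u) \<inter> B) = (\<integral>\<^sup>+t. indicator (ball \<tau> (A * u) \<inter> B) t \<partial>\<mu>)"
      by (subst nn_integral_indicator) auto
    also have "\<dots> = (\<integral>\<^sup>+t. of_bool (\<bar>t - \<tau>\<bar> < A * u) * indicator B t \<partial>\<mu>)"
      by (intro nn_integral_cong) (auto simp: indicator_def dist_tau simp del: mem_ball)
    finally show "emeasure \<mu> (ball \<tau> (A * u) \<inter> B) * (ennreal (1 / stieltjes_square \<gamma> u) * indicator {0<..\<delta>} u) = (\<integral>\<^sup>+t. ?g t u \<partial>\<mu>)"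
      by (subst nn_integral_multc) auto
  qed
  also have "\<dots> = (\<integral>\<^sup>+t. (\<integral>\<^sup>+u. ?g t u \<partial>dgamma) \<partial>\<mu>)"
    by (rule pair_sigma_finite.Fubini'[of \<mu> dgamma])
      (auto simp: pair_sigma_finite_def dgamma.sigma_finite_measure_axioms mu.sigma_finite_measure_axioms)
  also have "\<dots> = (\<integral>\<^sup>+t. (\<integral>\<^sup>+u\<in>{\<bar>t - \<tau>\<bar> / A<..\<delta>}. ennreal (1 / stieltjes_square \<gamma> u) \<partial>dgamma) * indicator B t \<partial>\<mu>)"
  proof (intro nn_integral_cong)
    fix t
    have "?g t u = (ennreal (1 / stieltjes_square \<gamma> u) * indicator {\<bar>t - \<tau>\<bar> / A<..\<delta>} u) * indicator B t" for u
    proof -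
      have "\<bar>t - \<tau>\<bar> < A * u \<longleftrightarrow> \<bar>t - \<tau>\<bar> / A < u" using A by (simp add: field_simps)
      moreover have "0 \<le> \<bar>t - \<tau>\<bar> / A" using A by simp
      ultimately show ?thesis by (auto simp: indicator_def)
    qed
    then show "(\<integral>\<^sup>+u. ?g t u \<partial>dgamma) = (\<integral>\<^sup>+u\<in>{\<bar>t - \<tau>\<bar> / A<..\<delta>}. ennreal (1 / stieltjes_square \<gamma> u) \<partial>dgamma) * indicator B t"
      by (simp add: nn_integral_multc)
  qed
  finally show ?thesis .
qed

lemma regular_imp_augury:
  assumes "gamma_regular \<gamma> f \<tau>"
  shows "\<exists>l. gamma_augury \<gamma> l \<and> amortized_julia_bounded f l \<tau>"
proof -
  obtain C \<delta> where C: "C > 0" and \<delta>: "\<delta> > 0"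
    and fin: "(\<integral>\<^sup>+t\<in>ball \<tau> \<delta>. (1 / ennreal (\<gamma> (C * \<bar>t - \<tau>\<bar>))) \<partial>\<mu>) < \<infinity>"
    using assms gamma_regular_iff by auto
  \<comment> \<open>The mass is cut off at distance \<open>\<delta>\<close>, so that only the region where \<open>1 / \<gamma>\<close> is integrable
    enters. The second summand of \<open>l\<close> ensures positivity, and \<open>max 0\<close> makes \<open>l\<close> measurable on the
    whole line.\<close>
  define m where "m d = measure \<mu> (ball \<tau> (2 * d) \<inter> ball \<tau> \<delta>)" for d
  define l where "l d = m d / d + d * (\<gamma> (max 0 (C * d)))\<^sup>2" for d
  have em: "emeasure \<mu> (ball \<tau> (2 * d) \<inter> ball \<tau> \<delta>) = ennreal (m d)" for d
  proof -
    have "emeasure \<mu> (ball \<tau> (2 * d) \<inter> ball \<tau> \<delta>) \<le> emeasure \<mu> (ball \<tau> \<delta>)" by (intro emeasure_mono) auto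
    then show ?thesis
      unfolding m_def using emeasure_ball[of \<tau> \<delta>] by (intro emeasure_eq_ennreal_measure) (auto simp: top_unique)
  qed
  have m_nonneg: "m d \<ge> 0" for d by (simp add: m_def)
  have m_mono: "mono m"
  proof (rule monoI)
    fix x y :: real assume "x \<le> y"
    then have "ball \<tau> (2 * x) \<subseteq> ball \<tau> (2 * y)" by (intro subset_ball) simp
    then have "emeasure \<mu> (ball \<tau> (2 * x) \<inter> ball \<tau> \<delta>) \<le> emeasure \<mu> (ball \<tau> (2 * y) \<inter> ball \<tau> \<delta>)"
      by (intro emeasure_mono) auto
    then show "m x \<le> m y" unfolding em using m_nonneg by (simp add: ennreal_le_iff)
  qed
  have [measurable]: "m \<in> borel_measurable borel" using m_mono by (rule borel_measurable_mono)
  have [measurable]: "l \<in> borel_measurable borel" unfolding l_def by measurable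
  have l_nonneg: "l d \<ge> 0" if "d \<ge> 0" for d using that m_nonneg by (simp add: l_def)
  have null: "AE t in \<mu>. t \<noteq> \<tau>"
    using regular_null[OF C \<delta> fin] by (intro AE_I[of _ _ "{\<tau>}"]) auto
  \<comment> \<open>With this constant, \<open>2 * (a * u) = u / C\<close> and \<open>C * (a * t) = t / 2\<close>.\<close>
  define a where "a = 1 / (2 * C)"
  have a: "a > 0" using C by (simp add: a_def)
  have main: "(\<integral>\<^sup>+u. ennreal (m (a * u)) * (ennreal (1 / stieltjes_square \<gamma> u) * indicator {0<..1} u) \<partial>dgamma) < \<infinity>"
  proof -
    have "(\<integral>\<^sup>+u. ennreal (m (a * u)) * (ennreal (1 / stieltjes_square \<gamma> u) * indicator {0<..1} u) \<partial>dgamma)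
      = (\<integral>\<^sup>+u. emeasure \<mu> (ball \<tau> (1 / C * u) \<inter> ball \<tau> \<delta>) * (ennreal (1 / stieltjes_square \<gamma> u) * indicator {0<..1} u) \<partial>dgamma)"
      by (intro nn_integral_cong) (simp add: em[symmetric] a_def)
    also have "\<dots> = (\<integral>\<^sup>+t. (\<integral>\<^sup>+u\<in>{\<bar>t - \<tau>\<bar> / (1 / C)<..1}. ennreal (1 / stieltjes_square \<gamma> u) \<partial>dgamma) * indicator (ball \<tau> \<delta>) t \<partial>\<mu>)"
      using C by (intro tonelli_ball) auto
    also have "\<dots> \<le> (\<integral>\<^sup>+t\<in>ball \<tau> \<delta>. (1 / ennreal (\<gamma> (C * \<bar>t - \<tau>\<bar>))) \<partial>\<mu>)"
    proof (rule nn_integral_mono_AE)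
      show "AE t in \<mu>. (\<integral>\<^sup>+u\<in>{\<bar>t - \<tau>\<bar> / (1 / C)<..1}. ennreal (1 / stieltjes_square \<gamma> u) \<partial>dgamma) * indicator (ball \<tau> \<delta>) t
        \<le> (1 / ennreal (\<gamma> (C * \<bar>t - \<tau>\<bar>))) * indicator (ball \<tau> \<delta>) t"
        using null
      proof eventually_elim
        case (elim t)
        then have p: "C * \<bar>t - \<tau>\<bar> > 0" using C by simp
        have "(\<integral>\<^sup>+u\<in>{\<bar>t - \<tau>\<bar> / (1 / C)<..1}. ennreal (1 / stieltjes_square \<gamma> u) \<partial>dgamma) \<le> 1 / ennreal (\<gamma> (C * \<bar>t - \<tau>\<bar>))"
          using integral_inverse_stieltjes_square_le[OF p, of 1] unfolding one_divide_ennreal[OF pos[OF p]]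
          by (simp add: mult.commute)
        then show ?case by (rule mult_right_mono) simp
      qed
    qed
    finally show ?thesis using fin by (auto intro: le_less_trans)
  qed
  have "gamma_augury \<gamma> l"
    unfolding gamma_augury_def
  proof (intro conjI exI[of _ a])
    show "\<forall>t\<ge>0. 0 \<le> l t" using l_nonneg by simp
    have "((\<lambda>d. measure \<mu> (ball \<tau> (2 * d)) / d\<^sup>2 + (\<gamma> (C * d))\<^sup>2) \<longlongrightarrow> 0 + 0\<^sup>2) (at_right 0)"
    proof (intro tendsto_intros regular_ball_mass_small[OF C \<delta> fin])
      have "filterlim (\<lambda>t. C * t) (at_right 0) (at_right (0::real))"
        unfolding filterlim_at
      proof
        show "\<forall>\<^sub>F t in at_right 0. C * t \<in> {0<..} \<and> C * t \<noteq> 0"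
          using eventually_at_right_less[of "0::real"] by eventually_elim (use C in auto)
        have "((\<lambda>t. C * t) \<longlongrightarrow> C * 0) (at_right 0)" by (intro tendsto_intros)
        then show "((\<lambda>t. C * t) \<longlongrightarrow> 0) (at_right 0)" by simp
      qed
      from filterlim_compose[OF tendsto_gamma_0 this] show "((\<lambda>d. \<gamma> (C * d)) \<longlongrightarrow> 0) (at_right 0)" .
    qed
    then have up: "((\<lambda>d. measure \<mu> (ball \<tau> (2 * d)) / d\<^sup>2 + (\<gamma> (C * d))\<^sup>2) \<longlongrightarrow> 0) (at_right 0)" by simp
    have "((\<lambda>d. l d / d) \<longlongrightarrow> 0) (at_right 0)"
    proof (rule tendsto_sandwich[OF _ _ tendsto_const up])
      show "\<forall>\<^sub>F d in at_right 0. 0 \<le> l d / d"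
        using eventually_at_right_less[of 0] by eventually_elim (auto simp: l_nonneg)
      show "\<forall>\<^sub>F d in at_right 0. l d / d \<le> measure \<mu> (ball \<tau> (2 * d)) / d\<^sup>2 + (\<gamma> (C * d))\<^sup>2"
        using eventually_at_right_less[of 0]
      proof eventually_elim
        case (elim d)
        have "m d \<le> measure \<mu> (ball \<tau> (2 * d))"
          unfolding m_def using emeasure_ball[of \<tau> "2 * d"] by (intro measure_mono_fmeasurable) (auto simp: fmeasurable_def)
        then have "m d / d\<^sup>2 \<le> measure \<mu> (ball \<tau> (2 * d)) / d\<^sup>2" by (intro divide_right_mono) auto
        moreover have "l d / d = m d / d\<^sup>2 + (\<gamma> (C * d))\<^sup>2"
          using elim C by (simp add: l_def power2_eq_square add_divide_distrib)
        ultimately show ?case by simp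
      qed
    qed
    then show "l \<in> o[at_right 0](\<lambda>t. t)"
      by (rule smalloI_tendsto) (use eventually_at_right_less[of "0::real"] in \<open>auto elim!: eventually_mono\<close>)
    show "a > 0" by (rule a)
    show "set_integrable dgamma {0..<1} (\<lambda>t. t * l (a * t) / stieltjes_square \<gamma> t)"
      unfolding set_integrable_def
    proof (rule integrableI_nonneg)
      show "AE t in dgamma. 0 \<le> indicator {0..<1} t *\<^sub>R (t * l (a * t) / stieltjes_square \<gamma> t)"
        using a by (intro AE_I2) (auto simp: indicator_def intro!: divide_nonneg_nonneg mult_nonneg_nonneg l_nonneg stieltjes_square_nonneg)
      have "(\<integral>\<^sup>+t. ennreal (indicator {0..<1} t *\<^sub>R (t * l (a * t) / stieltjes_square \<gamma> t)) \<partial>dgamma)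
        \<le> (\<integral>\<^sup>+t. ennreal (1 / a) * (ennreal (m (a * t)) * (ennreal (1 / stieltjes_square \<gamma> t) * indicator {0<..1} t))
              + ennreal a * indicator {0<..1} t \<partial>dgamma)"
      proof (intro nn_integral_mono)
        fix t
        show "ennreal (indicator {0..<1} t *\<^sub>R (t * l (a * t) / stieltjes_square \<gamma> t))
          \<le> ennreal (1 / a) * (ennreal (m (a * t)) * (ennreal (1 / stieltjes_square \<gamma> t) * indicator {0<..1} t)) + ennreal a * indicator {0<..1} t"
        proof (cases "0 < t \<and> t < 1")
          case True
          then have t: "0 < t" "t < 1" by auto
          let ?s = "stieltjes_square \<gamma> t"
          have s: "?s > 0" using L_pos[OF t(1)] R_pos[OF t(1)] by (simp add: stieltjes_square_eq)
          have C2: "C * (a * t) = t / 2" using C by (simp add: a_def)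
          have "(\<gamma> (t / 2))\<^sup>2 \<le> ?s" using t by (intro stieltjes_square_ge) auto
          then have "(\<gamma> (t / 2))\<^sup>2 / ?s \<le> 1" using s by simp
          then have "(a * t\<^sup>2) * ((\<gamma> (t / 2))\<^sup>2 / ?s) \<le> (a * t\<^sup>2) * 1"
            using a by (intro mult_left_mono) auto
          also have "\<dots> \<le> a * 1"
            using a t by (simp add: power_le_one)
          finally have le: "(a * t\<^sup>2) * ((\<gamma> (t / 2))\<^sup>2 / ?s) \<le> a" by simp
          have split: "t * (u / (a * t) + a * t * g) / s = 1 / a * (u * (1 / s)) + (a * t\<^sup>2) * (g / s)"
            if "s > 0" for u g s
            using t a that by (simp add: field_simps power2_eq_square)
          have "t * l (a * t) / ?s = 1 / a * (m (a * t) * (1 / ?s)) + (a * t\<^sup>2) * ((\<gamma> (t / 2))\<^sup>2 / ?s)"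
            unfolding l_def C2 split[OF s, symmetric] using t by simp
          also have "\<dots> \<le> 1 / a * (m (a * t) * (1 / ?s)) + a"
            using le by simp
          finally have "ennreal (t * l (a * t) / ?s) \<le> ennreal (1 / a * (m (a * t) * (1 / ?s)) + a)"
            by (rule ennreal_leI)
          also have "\<dots> = ennreal (1 / a) * (ennreal (m (a * t)) * ennreal (1 / ?s)) + ennreal a"
            using a s m_nonneg by (simp only: ennreal_plus ennreal_mult' zero_le_divide_1_iff zero_le_mult_iff less_imp_le simp_thms)
          finally show ?thesis using t by simp
        next
          case False
          then show ?thesis by (cases "t = 0") (auto simp: indicator_def)
        qed
      qed
      also have "\<dots> = ennreal (1 / a) * (\<integral>\<^sup>+t. ennreal (m (a * t)) * (ennreal (1 / stieltjes_square \<gamma> t) * indicator {0<..1} t) \<partial>dgamma)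
          + ennreal a * emeasure dgamma {0<..1}"
        by (subst nn_integral_add) (auto simp: nn_integral_cmult nn_integral_cmult_indicator)
      also have "\<dots> < \<infinity>"
        using main by (auto simp: ennreal_mult_less_top emeasure_dgamma)
      finally show "(\<integral>\<^sup>+t. ennreal (indicator {0..<1} t *\<^sub>R (t * l (a * t) / stieltjes_square \<gamma> t)) \<partial>dgamma) < \<infinity>" .
    qed measurable
  qed
  moreover have "amortized_julia_bounded f l \<tau>"
  proof (rule regular_amortized_julia_bounded[OF C \<delta> fin, where K = 1])
    have "\<forall>\<^sub>F d in at_right 0. d < \<delta> / 2"
      using \<delta> by (intro eventually_at_rightI[of 0 "\<delta> / 2"]) auto
    then show "\<forall>\<^sub>F d in at_right 0. 0 < l d \<and> measure \<mu> (ball \<tau> (2 * d)) \<le> 1 * d * l d"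
      using eventually_at_right_less[of 0]
    proof eventually_elim
      case (elim d)
      have "ball \<tau> (2 * d) \<subseteq> ball \<tau> \<delta>" using elim by (intro subset_ball) simp
      then have "measure \<mu> (ball \<tau> (2 * d)) = m d" by (simp add: m_def Int_absorb2)
      moreover have g: "(\<gamma> (max 0 (C * d)))\<^sup>2 > 0" using pos[of "C * d"] elim C by simp
      then have "m d \<le> d * l d" using elim by (simp add: l_def algebra_simps)
      moreover have "l d > 0" unfolding l_def using elim m_nonneg g by (intro add_nonneg_pos) auto
      ultimately show ?case by simp
    qed
  qed
  ultimately show ?thesis by blast
qed

text \<open>Bounded amortized quotients bound the mass near \<open>\<tau>\<close> by a multiple of \<open>d * l d\<close>, and the augury
  makes this integrable against \<open>d\<gamma> / \<gamma>\<^sup>2\<close>.\<close>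
lemma augury_imp_regular:
  assumes aug: "gamma_augury \<gamma> l" and bdd: "amortized_julia_bounded f l \<tau>"
  shows "gamma_regular \<gamma> f \<tau>"
proof -
  obtain A where A: "A > 0"
    and meas: "(\<lambda>t. ennreal (t * l (A * t) / stieltjes_square \<gamma> t) * indicator {0..<1} t) \<in> borel_measurable dgamma"
    and fin: "(\<integral>\<^sup>+t\<in>{0..<1}. ennreal (t * l (A * t) / stieltjes_square \<gamma> t) \<partial>dgamma) < \<infinity>"
    using augury_nn_integral[OF aug] by blast
  obtain B where B: "\<forall>\<^sub>F d in at_right 0. l d > 0 \<and> \<bar>amortized_julia f l \<tau> d\<bar> \<le> B"
    using bdd by (auto simp: amortized_julia_bounded_def)
  have "l \<in> o[at_right 0](\<lambda>t. t)" using aug by (simp add: gamma_augury_def)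
  then have "\<forall>\<^sub>F d in at_right 0. norm (l d) \<le> 1 * norm d"
    by (rule landau_o.smallD) simp
  with B have "\<forall>\<^sub>F d in at_right 0. 0 < l d \<and> l d \<le> d \<and> amortized_julia f l \<tau> d \<le> B"
    using eventually_at_right_less[of 0] by eventually_elim auto
  then have "\<forall>\<^sub>F d in at_right 0. l d > 0 \<and> measure \<mu> (ball \<tau> d) \<le> 4 * pi * B * d * l d"
    using eventually_at_right_less[of 0] by eventually_elim (auto intro: ball_mass_le_amortized_julia)
  then obtain \<eta> where \<eta>: "\<eta> > 0"
    and l_pos: "\<And>d. 0 < d \<Longrightarrow> d < \<eta> \<Longrightarrow> l d > 0"
    and mass: "\<And>d. 0 < d \<Longrightarrow> d < \<eta> \<Longrightarrow> measure \<mu> (ball \<tau> d) \<le> 4 * pi * B * d * l d"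
    unfolding eventually_at_right_field by blast
  define K where "K = 4 * pi * \<bar>B\<bar>"
  have K: "K \<ge> 0" by (simp add: K_def)
  have mass': "measure \<mu> (ball \<tau> d) \<le> K * d * l d" if "0 < d" "d < \<eta>" for d
  proof -
    have "4 * pi * B * (d * l d) \<le> K * (d * l d)"
      unfolding K_def using that l_pos[OF that] by (intro mult_right_mono mult_left_mono) auto
    with mass[OF that] show ?thesis by (simp add: mult.assoc)
  qed
  define \<delta> where "\<delta> = min (1/2) (\<eta> / (2 * A))"
  have \<delta>: "0 < \<delta>" "\<delta> < 1" "A * \<delta> < \<eta>"
  proof -
    have "A * \<delta> \<le> A * (\<eta> / (2 * A))" using A by (intro mult_left_mono) (auto simp: \<delta>_def)
    also have "\<dots> = \<eta> / 2" using A by simp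
    finally show "A * \<delta> < \<eta>" using \<eta> by simp
  qed (use A \<eta> in \<open>auto simp: \<delta>_def\<close>)
  have null: "emeasure \<mu> {\<tau>} = 0"
  proof -
    have l_lim: "((\<lambda>d. l d / d) \<longlongrightarrow> 0) (at_right 0)"
      using \<open>l \<in> o[at_right 0](\<lambda>t. t)\<close> by (rule smalloD_tendsto)
    have "((\<lambda>d. K * (d * d * (l d / d))) \<longlongrightarrow> K * (0 * 0 * 0)) (at_right 0)"
      by (intro tendsto_intros l_lim)
    then have lim: "((\<lambda>d. K * (d * d * (l d / d))) \<longlongrightarrow> 0) (at_right 0)" by simp
    have "\<forall>\<^sub>F d in at_right 0. d < \<eta>"
      using \<eta> by (intro eventually_at_rightI[of 0 \<eta>]) auto
    then have "\<forall>\<^sub>F d in at_right 0. measure \<mu> {\<tau>} \<le> K * (d * d * (l d / d))"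
      using eventually_at_right_less[of 0]
    proof eventually_elim
      case (elim d)
      have "measure \<mu> {\<tau>} \<le> measure \<mu> (ball \<tau> d)"
        using emeasure_ball[of \<tau> d] elim by (intro measure_mono_fmeasurable) (auto simp: fmeasurable_def)
      also have "\<dots> \<le> K * d * l d" by (intro mass' elim)
      also have "\<dots> = K * (d * d * (l d / d))" using elim by simp
      finally show ?case .
    qed
    then have "measure \<mu> {\<tau>} \<le> 0"
      by (rule tendsto_lowerbound[OF lim]) simp
    moreover have "emeasure \<mu> {\<tau>} < \<infinity>" by (rule emeasure_compact) simp
    ultimately show ?thesis
      by (simp add: emeasure_eq_ennreal_measure less_top[symmetric] measure_le_0_iff)
  qed
  have AE: "AE t in \<mu>. t \<noteq> \<tau>"
    using null by (intro AE_I[of _ _ "{\<tau>}"]) auto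
  \<comment> \<open>The factor \<open>2\<close> in \<open>2 / A\<close> leaves room between \<open>\<gamma>\<close> and its right-continuous version.\<close>
  let ?\<rho> = "A * \<delta>"
  have "(\<integral>\<^sup>+t\<in>ball \<tau> ?\<rho>. (1 / ennreal (\<gamma> (2 / A * \<bar>t - \<tau>\<bar>))) \<partial>\<mu>)
    \<le> (\<integral>\<^sup>+t. ennreal (1 / \<gamma> \<delta>) * indicator (ball \<tau> ?\<rho>) t
        + (\<integral>\<^sup>+u\<in>{\<bar>t - \<tau>\<bar> / A<..\<delta>}. ennreal (1 / stieltjes_square \<gamma> u) \<partial>dgamma) * indicator UNIV t \<partial>\<mu>)"
  proof (rule nn_integral_mono_AE)
    show "AE t in \<mu>. (1 / ennreal (\<gamma> (2 / A * \<bar>t - \<tau>\<bar>))) * indicator (ball \<tau> ?\<rho>) t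
      \<le> ennreal (1 / \<gamma> \<delta>) * indicator (ball \<tau> ?\<rho>) t
        + (\<integral>\<^sup>+u\<in>{\<bar>t - \<tau>\<bar> / A<..\<delta>}. ennreal (1 / stieltjes_square \<gamma> u) \<partial>dgamma) * indicator UNIV t"
      using AE
    proof eventually_elim
      case (elim t)
      show ?case
      proof (cases "t \<in> ball \<tau> ?\<rho>")
        case True
        then have "\<bar>t - \<tau>\<bar> < A * \<delta>" by (simp add: dist_tau del: mem_ball)
        then have a: "0 < \<bar>t - \<tau>\<bar> / A" "\<bar>t - \<tau>\<bar> / A < \<delta>" "\<bar>t - \<tau>\<bar> / A < 2 / A * \<bar>t - \<tau>\<bar>"
          using A elim by (auto simp: field_simps)
        from a(1,3) have p: "\<gamma> (2 / A * \<bar>t - \<tau>\<bar>) > 0" by (intro pos) linarith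
        show ?thesis
          using inverse_gamma_le_integral[OF a] True unfolding one_divide_ennreal[OF p] by simp
      qed simp
    qed
  qed
  also have "\<dots> = ennreal (1 / \<gamma> \<delta>) * emeasure \<mu> (ball \<tau> ?\<rho>)
      + (\<integral>\<^sup>+t. (\<integral>\<^sup>+u\<in>{\<bar>t - \<tau>\<bar> / A<..\<delta>}. ennreal (1 / stieltjes_square \<gamma> u) \<partial>dgamma) * indicator UNIV t \<partial>\<mu>)"
  proof (subst nn_integral_add)
    have "(\<lambda>t. \<integral>\<^sup>+u. ennreal (1 / stieltjes_square \<gamma> u) * of_bool (\<bar>t - \<tau>\<bar> / A < u \<and> u \<le> \<delta>) \<partial>dgamma) \<in> borel_measurable borel"
      by measurable
    then show "(\<lambda>t. (\<integral>\<^sup>+u\<in>{\<bar>t - \<tau>\<bar> / A<..\<delta>}. ennreal (1 / stieltjes_square \<gamma> u) \<partial>dgamma) * indicator UNIV t) \<in> borel_measurable \<mu>"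
      by (simp add: indicator_def of_bool_def)
  qed (auto simp: nn_integral_cmult_indicator)
  also have "(\<integral>\<^sup>+t. (\<integral>\<^sup>+u\<in>{\<bar>t - \<tau>\<bar> / A<..\<delta>}. ennreal (1 / stieltjes_square \<gamma> u) \<partial>dgamma) * indicator UNIV t \<partial>\<mu>)
      = (\<integral>\<^sup>+u. emeasure \<mu> (ball \<tau> (A * u) \<inter> UNIV) * (ennreal (1 / stieltjes_square \<gamma> u) * indicator {0<..\<delta>} u) \<partial>dgamma)"
    by (rule tonelli_ball[symmetric, OF A]) simp
  also have "\<dots> \<le> (\<integral>\<^sup>+t. ennreal (K * A) * (ennreal (t * l (A * t) / stieltjes_square \<gamma> t) * indicator {0..<1} t) \<partial>dgamma)"
  proof (intro nn_integral_mono)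
    fix u
    show "emeasure \<mu> (ball \<tau> (A * u) \<inter> UNIV) * (ennreal (1 / stieltjes_square \<gamma> u) * indicator {0<..\<delta>} u)
      \<le> ennreal (K * A) * (ennreal (u * l (A * u) / stieltjes_square \<gamma> u) * indicator {0..<1} u)"
    proof (cases "u \<in> {0<..\<delta>}")
      case True
      then have u: "0 < A * u" "A * u < \<eta>"
      proof -
        have "A * u \<le> A * \<delta>" using True A by (intro mult_left_mono) auto
        then show "A * u < \<eta>" using \<delta>(3) by linarith
      qed (use True A in auto)
      have "measure \<mu> (ball \<tau> (A * u)) * (1 / stieltjes_square \<gamma> u) \<le> K * (A * u) * l (A * u) * (1 / stieltjes_square \<gamma> u)"
        using mass'[OF u] stieltjes_square_nonneg by (intro mult_right_mono) auto
      also have "\<dots> = K * A * (u * l (A * u) / stieltjes_square \<gamma> u)" by simp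
      finally have "ennreal (measure \<mu> (ball \<tau> (A * u)) * (1 / stieltjes_square \<gamma> u)) \<le> ennreal (K * A * (u * l (A * u) / stieltjes_square \<gamma> u))"
        by (rule ennreal_leI)
      then show ?thesis
        using True \<delta> K A by (simp add: emeasure_ball_eq ennreal_mult'[symmetric])
    qed simp
  qed
  also have "\<dots> = ennreal (K * A) * (\<integral>\<^sup>+t\<in>{0..<1}. ennreal (t * l (A * t) / stieltjes_square \<gamma> t) \<partial>dgamma)"
    using meas by (rule nn_integral_cmult)
  finally have "(\<integral>\<^sup>+t\<in>ball \<tau> ?\<rho>. (1 / ennreal (\<gamma> (2 / A * \<bar>t - \<tau>\<bar>))) \<partial>\<mu>)
    \<le> ennreal (1 / \<gamma> \<delta>) * emeasure \<mu> (ball \<tau> ?\<rho>)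
      + ennreal (K * A) * (\<integral>\<^sup>+t\<in>{0..<1}. ennreal (t * l (A * t) / stieltjes_square \<gamma> t) \<partial>dgamma)"
    by (simp add: add_left_mono)
  also have "\<dots> < \<infinity>"
    using fin emeasure_ball[of \<tau> ?\<rho>] by (auto simp: ennreal_mult_less_top)
  finally show ?thesis
    unfolding gamma_regular_iff using A \<delta> by (intro exI[of _ "2 / A"] conjI exI[of _ ?\<rho>]) auto
qed

lemma regular_iff_augury:
  "gamma_regular \<gamma> f \<tau> \<longleftrightarrow> (\<exists>l. gamma_augury \<gamma> l \<and> amortized_julia_bounded f l \<tau>)"
  using regular_imp_augury augury_imp_regular by blast

lemma regular_iff_ratio_augury:
  assumes "gamma_augury \<gamma> (\<lambda>t. \<gamma> t / t)"
  shows "gamma_regular \<gamma> f \<tau> \<longleftrightarrow> (\<exists>C>0. amortized_julia_bounded f (\<lambda>t. \<gamma> (C * t) / (C * t)) \<tau>)"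
proof
  assume "gamma_regular \<gamma> f \<tau>"
  then obtain C \<delta> where C: "C > 0" and \<delta>: "\<delta> > 0"
    and fin: "(\<integral>\<^sup>+t\<in>ball \<tau> \<delta>. (1 / ennreal (\<gamma> (C * \<bar>t - \<tau>\<bar>))) \<partial>\<mu>) < \<infinity>"
    using gamma_regular_iff by auto
  obtain I where I: "I \<ge> 0" "\<And>d. 0 < d \<Longrightarrow> d \<le> \<delta> \<Longrightarrow> measure \<mu> (ball \<tau> d) \<le> I * \<gamma> (C * d)"
    using regular_mass[OF C \<delta> fin] by blast
  have "amortized_julia_bounded f (\<lambda>t. \<gamma> (2 * C * t) / (2 * C * t)) \<tau>"
  proof (rule regular_amortized_julia_bounded[OF C \<delta> fin, where K = "2 * C * I"])
    have "\<forall>\<^sub>F d in at_right 0. d < \<delta> / 2"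
      using \<delta> by (intro eventually_at_rightI[of 0 "\<delta> / 2"]) auto
    then show "\<forall>\<^sub>F d in at_right 0. 0 < \<gamma> (2 * C * d) / (2 * C * d) \<and>
        measure \<mu> (ball \<tau> (2 * d)) \<le> 2 * C * I * d * (\<gamma> (2 * C * d) / (2 * C * d))"
      using eventually_at_right_less[of 0]
    proof eventually_elim
      case (elim d)
      have eq: "C * (2 * d) = 2 * C * d" by simp
      have "measure \<mu> (ball \<tau> (2 * d)) \<le> I * \<gamma> (2 * C * d)"
        using I(2)[of "2 * d"] elim unfolding eq by simp
      moreover have "2 * C * I * d * (\<gamma> (2 * C * d) / (2 * C * d)) = I * \<gamma> (2 * C * d)"
        using elim C by simp
      moreover have "\<gamma> (2 * C * d) > 0" using elim C by (intro pos) simp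
      ultimately show ?case using elim C by simp
    qed
  qed
  then show "\<exists>C>0. amortized_julia_bounded f (\<lambda>t. \<gamma> (C * t) / (C * t)) \<tau>"
    using C by (intro exI[of _ "2 * C"]) auto
next
  assume "\<exists>C>0. amortized_julia_bounded f (\<lambda>t. \<gamma> (C * t) / (C * t)) \<tau>"
  then show "gamma_regular \<gamma> f \<tau>"
    using augury_imp_regular augury_scale_argument[OF assms] by blast
qed

lemma regular_iff_stolz:
  assumes aug: "gamma_augury \<gamma> (\<lambda>t. sqrt (\<gamma> t))"
  shows "gamma_regular \<gamma> f \<tau> \<longleftrightarrow>
    (\<exists>C>0. \<exists>D>0. julia_bounded_on f (stolz_region (\<lambda>t. sqrt (D * \<gamma> (C * t))) \<tau>) \<tau>)"
proof
  assume "gamma_regular \<gamma> f \<tau>"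
  then obtain C \<delta> where C: "C > 0" and \<delta>: "\<delta> > 0"
    and fin: "(\<integral>\<^sup>+t\<in>ball \<tau> \<delta>. (1 / ennreal (\<gamma> (C * \<bar>t - \<tau>\<bar>))) \<partial>\<mu>) < \<infinity>"
    using gamma_regular_iff by auto
  obtain I where I: "I \<ge> 0" "\<And>d. 0 < d \<Longrightarrow> d \<le> \<delta> \<Longrightarrow> measure \<mu> (ball \<tau> d) \<le> I * \<gamma> (C * d)"
    using regular_mass[OF C \<delta> fin] by blast
  obtain q where q: "q \<ge> 0" "(\<integral>\<^sup>+t. ennreal (1 / (t - \<tau>)\<^sup>2) \<partial>\<mu>) \<le> ennreal q"
    using regular_moment[OF C \<delta> fin] by blast
  have "\<bar>julia_quotient f z\<bar> \<le> b + I + 4 * q"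
    if z: "z \<in> stolz_region (\<lambda>t. sqrt (1 * \<gamma> (2 * C * t))) \<tau> \<inter> ball (complex_of_real \<tau>) (\<delta> / 2)" for z
  proof -
    let ?x = "Re z" and ?y = "Im z"
    obtain c where y: "?y > 0" and c: "c > 0" "?y \<ge> sqrt (\<gamma> (2 * C * c))" "\<bar>?x - \<tau>\<bar> \<le> c"
      using z by (auto simp: stolz_region_def upper_half_plane_def)
    have "(sqrt (\<gamma> (2 * C * c)))\<^sup>2 \<le> ?y\<^sup>2"
      using c C by (intro power_mono real_sqrt_ge_zero nonneg) auto
    then have g: "\<gamma> (2 * C * c) \<le> ?y\<^sup>2" using nonneg[of "2 * C * c"] c C by simp
    have "\<bar>?x - \<tau>\<bar> < \<delta> / 2"
      using z abs_Re_le_cmod[of "z - of_real \<tau>"] by (auto simp: dist_norm norm_minus_commute)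
    moreover have "\<gamma> (C * (2 * \<bar>?x - \<tau>\<bar>)) \<le> \<gamma> (2 * C * c)"
      using c C by (intro gamma_mono) (auto simp: mult_ac)
    ultimately have "measure \<mu> (ball \<tau> (2 * \<bar>?x - \<tau>\<bar>)) \<le> I * \<gamma> (2 * C * c)"
      using I(2)[of "2 * \<bar>?x - \<tau>\<bar>"] I(1) nonneg[of "2 * C * c"] c C
      by (cases "?x = \<tau>") (auto intro: order_trans mult_left_mono)
    also have "\<dots> \<le> I * ?y\<^sup>2" using g I(1) by (rule mult_left_mono)
    finally have "measure \<mu> (ball \<tau> (2 * \<bar>?x - \<tau>\<bar>)) / ?y\<^sup>2 \<le> I" using y by (simp add: field_simps)
    then have "julia_quotient f (Complex ?x ?y) \<le> b + I + 4 * q"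
      using julia_le[OF regular_null[OF C \<delta> fin] q y, of ?x "\<bar>?x - \<tau>\<bar>"] by simp
    then show ?thesis using julia_nonneg[OF y, of ?x] by simp
  qed
  then have "bounded (julia_quotient f ` (stolz_region (\<lambda>t. sqrt (1 * \<gamma> (2 * C * t))) \<tau> \<inter> ball (complex_of_real \<tau>) (\<delta> / 2)))"
    by (intro boundedI[of _ "b + I + 4 * q"]) auto
  then have "julia_bounded_on f (stolz_region (\<lambda>t. sqrt (1 * \<gamma> (2 * C * t))) \<tau>) \<tau>"
    unfolding julia_bounded_on_def using \<delta> by (intro exI[of _ "ball (complex_of_real \<tau>) (\<delta> / 2)"]) auto
  then show "\<exists>C>0. \<exists>D>0. julia_bounded_on f (stolz_region (\<lambda>t. sqrt (D * \<gamma> (C * t))) \<tau>) \<tau>"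
    using C by (intro exI[of _ "2 * C"] exI[of _ 1] conjI) auto
next
  assume "\<exists>C>0. \<exists>D>0. julia_bounded_on f (stolz_region (\<lambda>t. sqrt (D * \<gamma> (C * t))) \<tau>) \<tau>"
  then obtain C D U where C: "C > 0" and D: "D > 0" and U: "open U" "complex_of_real \<tau> \<in> U"
    and bdd: "bounded (julia_quotient f ` (stolz_region (\<lambda>t. sqrt (D * \<gamma> (C * t))) \<tau> \<inter> U))"
    by (auto simp: julia_bounded_on_def)
  obtain B where B: "\<And>z. z \<in> stolz_region (\<lambda>t. sqrt (D * \<gamma> (C * t))) \<tau> \<Longrightarrow> z \<in> U \<Longrightarrow> \<bar>julia_quotient f z\<bar> \<le> B"
    using bdd unfolding bounded_iff by auto
  obtain r where r: "r > 0" "ball (complex_of_real \<tau>) r \<subseteq> U"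
    using U by (meson open_contains_ball)
  let ?l = "\<lambda>t. sqrt (D * \<gamma> (C * t))"
  have aug': "gamma_augury \<gamma> ?l"
    using augury_scale[OF augury_scale_argument[OF aug C], of "sqrt D"] D by (simp add: real_sqrt_mult)
  then have "\<forall>\<^sub>F d in at_right 0. norm (?l d) \<le> 1 * norm d"
    unfolding gamma_augury_def by (intro landau_o.smallD) auto
  moreover have "\<forall>\<^sub>F d in at_right 0. d < r / 2"
    using r by (intro eventually_at_rightI[of 0 "r / 2"]) auto
  ultimately have "\<forall>\<^sub>F d in at_right 0. ?l d > 0 \<and> \<bar>amortized_julia f ?l \<tau> d\<bar> \<le> B"
    using eventually_at_right_less[of 0]
  proof eventually_elim
    case (elim d)
    have ld: "?l d > 0" using pos[of "C * d"] C D elim by simp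
    have "julia_quotient f (Complex x (?l d)) \<le> B" if "\<bar>x - \<tau>\<bar> \<le> d" for x
    proof -
      have "cmod (Complex x (?l d) - of_real \<tau>) \<le> \<bar>x - \<tau>\<bar> + \<bar>?l d\<bar>"
        using cmod_le[of "Complex x (?l d) - of_real \<tau>"] by simp
      also have "\<dots> < r" using that elim by auto
      finally have "Complex x (?l d) \<in> U" using r by (auto simp: dist_norm norm_minus_commute)
      moreover have "Complex x (?l d) \<in> stolz_region ?l \<tau>"
        unfolding stolz_region_def upper_half_plane_def using ld that elim by auto
      ultimately show ?thesis using B by fastforce
    qed
    then have "amortized_julia f ?l \<tau> d \<le> B"
      using elim ld by (intro amortized_julia_le) auto
    then show ?case using ld amortized_julia_nonneg[where l = ?l, OF _ ld, of \<tau>] elim by auto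
  qed
  then have "amortized_julia_bounded f ?l \<tau>"
    unfolding amortized_julia_bounded_def by blast
  with aug' show "gamma_regular \<gamma> f \<tau>" by (rule augury_imp_regular)
qed

text \<open>The converse direction compares heights: \<open>D * \<gamma> (C * |t|) \<le> sqrt (\<gamma> (C * d))\<close> for \<open>|t| \<le> d\<close> and small
  \<open>d\<close>, and the Julia quotient decreases in the height. The excluded point \<open>t = 0\<close> is a null set.\<close>
lemma regular_iff_curve:
  assumes aug: "gamma_augury \<gamma> (\<lambda>t. sqrt (\<gamma> t))"
  shows "gamma_regular \<gamma> f \<tau> \<longleftrightarrow>
    (\<exists>C>0. \<exists>D>0. Limsup (at 0) (\<lambda>t::real.
        ereal (julia_quotient f (Complex (\<tau> + t) (D * \<gamma> (C * \<bar>t\<bar>))))) < \<infinity>)"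
proof
  assume "gamma_regular \<gamma> f \<tau>"
  then obtain C \<delta> where C: "C > 0" and \<delta>: "\<delta> > 0"
    and fin: "(\<integral>\<^sup>+t\<in>ball \<tau> \<delta>. (1 / ennreal (\<gamma> (C * \<bar>t - \<tau>\<bar>))) \<partial>\<mu>) < \<infinity>"
    using gamma_regular_iff by auto
  obtain I where I: "I \<ge> 0" "\<And>d. 0 < d \<Longrightarrow> d \<le> \<delta> \<Longrightarrow> measure \<mu> (ball \<tau> d) \<le> I * \<gamma> (C * d)"
    using regular_mass[OF C \<delta> fin] by blast
  obtain q where q: "q \<ge> 0" "(\<integral>\<^sup>+t. ennreal (1 / (t - \<tau>)\<^sup>2) \<partial>\<mu>) \<le> ennreal q"
    using regular_moment[OF C \<delta> fin] by blast
  obtain c K e where c: "c > 0" and K: "K > 0" and e: "e > 0"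
    and decay: "\<And>s. 0 < s \<Longrightarrow> s < e \<Longrightarrow> \<gamma> (c * s) \<le> K * (\<gamma> s)\<^sup>2"
    using sqrt_augury_square_decay[OF aug] by blast
  define k where "k = 2 * C / c"
  have C': "k > 0" using C c by (simp add: k_def)
  have "\<forall>\<^sub>F t in at 0. julia_quotient f (Complex (\<tau> + t) (1 * \<gamma> (k * \<bar>t\<bar>))) \<le> b + I * K + 4 * q"
    unfolding eventually_at
  proof (intro exI[of _ "min (\<delta> / 2) (e / k)"] conjI ballI impI)
    show "0 < min (\<delta> / 2) (e / k)" using \<delta> divide_pos_pos[OF e C'] by simp
    fix t :: real assume t: "t \<noteq> 0 \<and> dist t 0 < min (\<delta> / 2) (e / k)"
    then have t: "0 < \<bar>t\<bar>" "\<bar>t\<bar> < \<delta> / 2" "\<bar>t\<bar> < e / k" by (auto simp: dist_real_def)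
    let ?s = "k * \<bar>t\<bar>"
    have s: "0 < ?s" using t(1) C' by (intro mult_pos_pos) auto
    have s2: "?s < e" using t(3) C' by (simp add: pos_less_divide_eq mult.commute)
    have y: "\<gamma> ?s > 0" using s by (rule pos)
    have eq: "C * (2 * \<bar>t\<bar>) = c * ?s" using c by (simp add: k_def)
    have "measure \<mu> (ball \<tau> (2 * \<bar>t\<bar>)) \<le> I * \<gamma> (c * ?s)"
      using I(2)[of "2 * \<bar>t\<bar>"] t unfolding eq by simp
    also have "\<dots> \<le> I * (K * (\<gamma> ?s)\<^sup>2)"
      by (intro mult_left_mono decay s s2 I)
    finally have "measure \<mu> (ball \<tau> (2 * \<bar>t\<bar>)) / (\<gamma> ?s)\<^sup>2 \<le> I * K"
      using y by (simp add: pos_divide_le_eq mult.assoc)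
    then show "julia_quotient f (Complex (\<tau> + t) (1 * \<gamma> (k * \<bar>t\<bar>))) \<le> b + I * K + 4 * q"
      using julia_le[OF regular_null[OF C \<delta> fin] q y, of "\<tau> + t" "\<bar>t\<bar>"] by simp
  qed
  then have "\<forall>\<^sub>F t in at 0. ereal (julia_quotient f (Complex (\<tau> + t) (1 * \<gamma> (k * \<bar>t\<bar>)))) \<le> ereal (b + I * K + 4 * q)"
    by eventually_elim simp
  then have "Limsup (at 0) (\<lambda>t. ereal (julia_quotient f (Complex (\<tau> + t) (1 * \<gamma> (k * \<bar>t\<bar>))))) \<le> ereal (b + I * K + 4 * q)"
    by (rule Limsup_bounded)
  then have "Limsup (at 0) (\<lambda>t. ereal (julia_quotient f (Complex (\<tau> + t) (1 * \<gamma> (k * \<bar>t\<bar>))))) < \<infinity>"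
    by (rule le_less_trans) simp
  then show "\<exists>C>0. \<exists>D>0. Limsup (at 0) (\<lambda>t::real. ereal (julia_quotient f (Complex (\<tau> + t) (D * \<gamma> (C * \<bar>t\<bar>))))) < \<infinity>"
    using C' by (intro exI[of _ k] exI[of _ 1] conjI) auto
next
  assume "\<exists>C>0. \<exists>D>0. Limsup (at 0) (\<lambda>t::real. ereal (julia_quotient f (Complex (\<tau> + t) (D * \<gamma> (C * \<bar>t\<bar>))))) < \<infinity>"
  then obtain C D where C: "C > 0" and D: "D > 0"
    and lim: "Limsup (at 0) (\<lambda>t::real. ereal (julia_quotient f (Complex (\<tau> + t) (D * \<gamma> (C * \<bar>t\<bar>))))) < \<infinity>"
    by blast
  obtain B where "Limsup (at 0) (\<lambda>t::real. ereal (julia_quotient f (Complex (\<tau> + t) (D * \<gamma> (C * \<bar>t\<bar>))))) < ereal (real B)"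
    using less_PInf_Ex_of_nat[THEN iffD1, of "Limsup (at 0) (\<lambda>t::real. ereal (julia_quotient f (Complex (\<tau> + t) (D * \<gamma> (C * \<bar>t\<bar>)))))"] lim by auto
  then have "\<forall>\<^sub>F t in at 0. ereal (julia_quotient f (Complex (\<tau> + t) (D * \<gamma> (C * \<bar>t\<bar>)))) < ereal (real B)"
    by (rule Limsup_lessD)
  then obtain r where r: "r > 0" "\<And>t. t \<noteq> 0 \<Longrightarrow> \<bar>t\<bar> < r \<Longrightarrow> julia_quotient f (Complex (\<tau> + t) (D * \<gamma> (C * \<bar>t\<bar>))) < real B"
    unfolding eventually_at by (auto simp: dist_real_def)
  let ?l = "\<lambda>t. sqrt (\<gamma> (C * t))"
  have aug': "gamma_augury \<gamma> ?l"
    by (rule augury_scale_argument[OF aug C])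
  have "\<forall>\<^sub>F d in at_right 0. norm (?l d) \<le> 1 * norm d"
    using aug' unfolding gamma_augury_def by (intro landau_o.smallD) auto
  moreover have "\<forall>\<^sub>F d in at_right 0. d < min r (1 / D)"
    using r D by (intro eventually_at_rightI[of 0 "min r (1 / D)"]) auto
  ultimately have "\<forall>\<^sub>F d in at_right 0. ?l d > 0 \<and> \<bar>amortized_julia f ?l \<tau> d\<bar> \<le> real B"
    using eventually_at_right_less[of 0]
  proof eventually_elim
    case (elim d)
    have g: "\<gamma> (C * d) > 0" using pos[of "C * d"] C elim by simp
    then have ld: "?l d > 0" by simp
    have "D * \<gamma> (C * d) = (D * ?l d) * ?l d" using g by simp
    also have "\<dots> \<le> 1 * ?l d"
    proof (intro mult_right_mono)
      have "D * ?l d \<le> D * (1 / D)" using elim ld D by (intro mult_left_mono) auto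
      then show "D * ?l d \<le> 1" using D by simp
    qed (use ld in simp)
    finally have h: "D * \<gamma> (C * d) \<le> ?l d" by simp
    have "julia_quotient f (Complex x (?l d)) \<le> real B" if x: "\<bar>x - \<tau>\<bar> \<le> d" "x \<noteq> \<tau>" for x
    proof -
      have p: "D * \<gamma> (C * \<bar>x - \<tau>\<bar>) > 0" using x C D by (intro mult_pos_pos pos) auto
      have "D * \<gamma> (C * \<bar>x - \<tau>\<bar>) \<le> D * \<gamma> (C * d)"
        using x C D by (intro mult_left_mono gamma_mono) auto
      also note h
      finally have "julia_quotient f (Complex x (?l d)) \<le> julia_quotient f (Complex x (D * \<gamma> (C * \<bar>x - \<tau>\<bar>)))"
        by (rule julia_antimono[OF p])
      also have "\<dots> \<le> real B" using r(2)[of "x - \<tau>"] x elim by (simp add: less_imp_le)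
      finally show ?thesis .
    qed
    then have "amortized_julia f ?l \<tau> d \<le> real B"
      using elim ld by (intro amortized_julia_le) auto
    then show ?case using ld amortized_julia_nonneg[where l = ?l, OF _ ld, of \<tau>] elim by auto
  qed
  then have "amortized_julia_bounded f ?l \<tau>"
    unfolding amortized_julia_bounded_def by blast
  with aug' show "gamma_regular \<gamma> f \<tau>" by (rule augury_imp_regular)
qed

end

theorem theorem1p1:
  fixes \<tau> :: real and \<gamma> :: "real \<Rightarrow> real"
  assumes "mono_on {0..} \<gamma>"
    and "\<forall>t\<ge>0. \<gamma> t \<ge> 0"
    and "\<forall>t>0. \<gamma> t > 0"
    and "\<gamma> \<in> O[at_right 0](\<lambda>t. t\<^sup>2)"
  shows "(\<forall>f. pick_function f \<longrightarrow>
            (gamma_regular \<gamma> f \<tau> \<longleftrightarrow>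
               (\<exists>l. gamma_augury \<gamma> l \<and> amortized_julia_bounded f l \<tau>))) \<and>
         (gamma_augury \<gamma> (\<lambda>t. sqrt (\<gamma> t)) \<longrightarrow>
            (\<forall>f. pick_function f \<longrightarrow>
               (gamma_regular \<gamma> f \<tau> \<longleftrightarrow>
                  (\<exists>C>0. \<exists>D>0. julia_bounded_on f (stolz_region (\<lambda>t. sqrt (D * \<gamma> (C * t))) \<tau>) \<tau>)) \<and>
               (gamma_regular \<gamma> f \<tau> \<longleftrightarrow>
                  (\<exists>C>0. \<exists>D>0.
                     Limsup (at 0) (\<lambda>t::real.
                       ereal (julia_quotient f (Complex (\<tau> + t) (D * \<gamma> (C * \<bar>t\<bar>))))) < \<infinity>)))) \<and>
         (gamma_augury \<gamma> (\<lambda>t. \<gamma> t / t) \<longrightarrow>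
            (\<forall>f. pick_function f \<longrightarrow>
               (gamma_regular \<gamma> f \<tau> \<longleftrightarrow>
                  (\<exists>C>0. amortized_julia_bounded f (\<lambda>t. \<gamma> (C * t) / (C * t)) \<tau>))))"
proof -
  have gauge: "gauge \<gamma>" using assms by (simp add: gauge_def)
  have reg: "\<exists>b \<mu>. regularity \<gamma> f b \<mu>" if f: "pick_function f" for f
  proof -
    obtain b \<mu> where "nevanlinna_data f b \<mu>"
      using nevanlinna_representation[OF f] f unfolding nevanlinna_data_def by blast
    with gauge show ?thesis unfolding regularity_def by blast
  qed
  show ?thesis
  proof (intro conjI allI impI)
    fix f assume "pick_function f"
    then obtain b \<mu> where "regularity \<gamma> f b \<mu>" using reg by blast
    then show "gamma_regular \<gamma> f \<tau> \<longleftrightarrow> (\<exists>l. gamma_augury \<gamma> l \<and> amortized_julia_bounded f l \<tau>)"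
      by (rule regularity.regular_iff_augury)
  next
    fix f assume aug: "gamma_augury \<gamma> (\<lambda>t. sqrt (\<gamma> t))" and "pick_function f"
    then obtain b \<mu> where "regularity \<gamma> f b \<mu>" using reg by blast
    then show "gamma_regular \<gamma> f \<tau> \<longleftrightarrow>
        (\<exists>C>0. \<exists>D>0. julia_bounded_on f (stolz_region (\<lambda>t. sqrt (D * \<gamma> (C * t))) \<tau>) \<tau>)"
      using aug by (rule regularity.regular_iff_stolz)
  next
    fix f assume aug: "gamma_augury \<gamma> (\<lambda>t. sqrt (\<gamma> t))" and "pick_function f"
    then obtain b \<mu> where "regularity \<gamma> f b \<mu>" using reg by blast
    then show "gamma_regular \<gamma> f \<tau> \<longleftrightarrow>
        (\<exists>C>0. \<exists>D>0. Limsup (at 0) (\<lambda>t::real.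
           ereal (julia_quotient f (Complex (\<tau> + t) (D * \<gamma> (C * \<bar>t\<bar>))))) < \<infinity>)"
      using aug by (rule regularity.regular_iff_curve)
  next
    fix f assume aug: "gamma_augury \<gamma> (\<lambda>t. \<gamma> t / t)" and "pick_function f"
    then obtain b \<mu> where "regularity \<gamma> f b \<mu>" using reg by blast
    then show "gamma_regular \<gamma> f \<tau> \<longleftrightarrow>
        (\<exists>C>0. amortized_julia_bounded f (\<lambda>t. \<gamma> (C * t) / (C * t)) \<tau>)"
      using aug by (rule regularity.regular_iff_ratio_augury)
  qed
qed

end
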